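(* Let $d\ge 1$, let $\omega\subset\mathbb{R}^d$ be a nonempty open connected set and let $v:\mathbb{R}^d\to\mathbb{R}^d$ be a Lipschitz and uniformly bounded vector field with flow $\Phi^v_t$. Let $\mu^0,\mu^1$ be two compactly supported probability measures on $\mathbb{R}^d$, absolutely continuous with respect to the Lebesgue measure, such that (i) for all $x^0\in\operatorname{supp}(\mu^0)$ there exists $t^0>0$ such that $\Phi^v_{t^0}(x^0)\in\omega$; (ii) for all $x^1\in\operatorname{supp}(\mu^1)$ there exists $t^1>0$ such that $\Phi^v_{-t^1}(x^1)\in\omega$. Then there exists $T>0$ such that the system $$\partial_t\mu+\nabla\cdot((v+\mathbf{1}_\omega u)\mu)=0 \text{ in }\mathbb{R}^d\times\mathbb{R}^+,\qquad \mu(\cdot,0)=\mu^0,$$ is approximately controllable from $\mu^0$ to $\mu^1$ at time $T$ with controls $\mathbf{1}_\omega u\in\mathcal{U}$; that is, for each $\varepsilon>0$ there exists a control $\mathbf{1}_\omega u\in\mathcal{U}$ such that the corresponding solution satisfies $W_p(\mu(T),\mu^1)\le\varepsilon$.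
   Context: $\Phi^v_t(x^0)$ denotes the value at time $t\in\mathbb{R}$ of the solution of $\dot x(t)=v(x(t))$, $x(0)=x^0$; similarly $\Phi^w_t$ is the flow of a time-dependent vector field $w$, i.e. $\dot x(t)=w(x(t),t)$, $x(0)=x^0$. $\mathcal{U}$ is the set of admissible controls: functions $\mathbf{1}_\omega u:\mathbb{R}^d\times\mathbb{R}^+\to\mathbb{R}^d$ (hence vanishing outside $\omega$) that are Lipschitz in space, measurable in time and uniformly bounded. For a control in $\mathcal{U}$, the solution of the system is the measure-valued curve $\mu(t)=\Phi_t^{v+\mathbf{1}_\omega u}\#\mu^0$, where the push-forward is $(\gamma\#\mu)(E)=\mu(\gamma^{-1}(E))$. $p\in[1,\infty)$ is fixed and $W_p$ is the Wasserstein distance: for compactly supported absolutely continuous probability measures, $W_p(\mu,\nu)=\inf\{(\int_{\mathbb{R}^d}|\gamma(x)-x|^p\,d\mu(x))^{1/p}:\gamma:\mathbb{R}^d\to\mathbb{R}^d\text{ Borel},\ \gamma\#\mu=\nu\}$. *)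

theory Defs
  imports "HOL-Probability.Probability"
begin

definition flow :: "('a::euclidean_space \<Rightarrow> 'a) \<Rightarrow> real \<Rightarrow> 'a \<Rightarrow> 'a" where
  "flow v t x0 =
     (THE y. \<exists>x. x 0 = x0 \<and> (\<forall>s. (x has_vector_derivative v (x s)) (at s)) \<and> y = x t)"

(* Fields that are only measurable in time: solutions on [0,\<infinity>) are understood in the sense of
   Caratheodory, i.e. x is locally absolutely continuous and satisfies the equation for almost
   every time, which is the integral equation below. *)
definition caratheodory_solution ::
    "('a::euclidean_space \<Rightarrow> real \<Rightarrow> 'a) \<Rightarrow> 'a \<Rightarrow> (real \<Rightarrow> 'a) \<Rightarrow> bool" where
  "caratheodory_solution w x0 x \<longleftrightarrow>
     (\<forall>t\<ge>0. (\<lambda>s. w (x s) s) absolutely_integrable_on {0..t} \<and>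
            x t = x0 + integral {0..t} (\<lambda>s. w (x s) s))"

(* Only meaningful for t \<ge> 0. *)
definition nonautonomous_flow ::
    "('a::euclidean_space \<Rightarrow> real \<Rightarrow> 'a) \<Rightarrow> real \<Rightarrow> 'a \<Rightarrow> 'a" where
  "nonautonomous_flow w t x0 = (THE y. \<exists>x. caratheodory_solution w x0 x \<and> y = x t)"

(* The elements are the products 1_\<omega> u; it is the product, not u, that is required to be
   Lipschitz, and the Lipschitz constant and the bound are uniform in time. *)
definition admissible_controls ::
    "'a::euclidean_space set \<Rightarrow> ('a \<Rightarrow> real \<Rightarrow> 'a) set" where
  "admissible_controls \<omega> = {f.
     (\<exists>u. f = (\<lambda>x t. indicat_real \<omega> x *\<^sub>R u x t)) \<and>
     (\<exists>L. \<forall>t\<ge>0. L-lipschitz_on UNIV (\<lambda>x. f x t)) \<and>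
     (\<forall>x. (\<lambda>t. f x t) \<in> borel_measurable (lebesgue_on {0..})) \<and>
     (\<exists>M. \<forall>x. \<forall>t\<ge>0. norm (f x t) \<le> M)}"

definition solution_measure ::
    "('a::euclidean_space \<Rightarrow> 'a) \<Rightarrow> ('a \<Rightarrow> real \<Rightarrow> 'a) \<Rightarrow> 'a measure \<Rightarrow> real \<Rightarrow> 'a measure" where
  "solution_measure v f \<mu>0 t =
     distr \<mu>0 borel (nonautonomous_flow (\<lambda>x s. v x + f x s) t)"

definition measure_support :: "'a::topological_space measure \<Rightarrow> 'a set" where
  "measure_support \<mu> = {x. \<forall>U. open U \<longrightarrow> x \<in> U \<longrightarrow> emeasure \<mu> U > 0}"

(* Maps of infinite cost are left out, since the Bochner integral would assign them cost 0;
   this does not change the infimum, which is \<infinity> over the empty set. *)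
definition wasserstein ::
    "real \<Rightarrow> 'a::euclidean_space measure \<Rightarrow> 'a measure \<Rightarrow> ennreal" where
  "wasserstein p \<mu> \<nu> =
     (INF \<gamma> \<in> {\<gamma>. \<gamma> \<in> borel_measurable borel \<and> distr \<mu> borel \<gamma> = \<nu> \<and>
                 integrable \<mu> (\<lambda>x. norm (\<gamma> x - x) powr p)}.
        ennreal ((\<integral>x. norm (\<gamma> x - x) powr p \<partial>\<mu>) powr (1 / p)))"

definition approximately_controllable ::
    "real \<Rightarrow> ('a::euclidean_space \<Rightarrow> 'a) \<Rightarrow> 'a set \<Rightarrow> 'a measure \<Rightarrow> 'a measure \<Rightarrow> real \<Rightarrow> bool" where
  "approximately_controllable p v \<omega> \<mu>0 \<mu>1 T \<longleftrightarrow>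
     (\<forall>\<epsilon>::real. \<epsilon> > 0 \<longrightarrow>
        (\<exists>f \<in> admissible_controls \<omega>.
           wasserstein p (solution_measure v f \<mu>0 T) \<mu>1 \<le> ennreal \<epsilon>))"

(* Compactly supported Borel probability measures that are absolutely continuous with respect to
   Lebesgue measure. *)
definition ac_compact_prob :: "'a::euclidean_space measure \<Rightarrow> bool" where
  "ac_compact_prob \<mu> \<longleftrightarrow>
     sets \<mu> = sets borel \<and> prob_space \<mu> \<and> compact (measure_support \<mu>) \<and>
     absolutely_continuous lborel \<mu>"

end

theory Submission
  imports Defs
begin

text \<open>Braking \<open>v\<close> inside \<open>\<omega>\<close> stops almost all trajectories issued from the support of \<open>\<mu>0\<close>
  near the point where they enter \<open>\<omega>\<close>, at a time that depends only on the data. Once the mass sits in a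
  compact part of \<open>\<omega>\<close>, the drift can be cancelled there and arbitrarily fast fields can be used: fields
  attracting a ball to a point gather the mass, along a chain of balls, in one fixed box of \<open>\<omega>\<close>. The same
  done backward in time brings \<open>\<mu>1\<close> to the box. Inside the box one bisects repeatedly: running a
  field that pushes a box towards a point of one of its halves changes the mass of that half continuously and
  almost up to its extreme values, so by the intermediate value theorem any prescribed positive masses of the small
  cells can be attained. Finally the backward motion of \<open>\<mu>1\<close> is undone; the cells stay small and
  carry almost equal masses, which makes the Wasserstein distance small.\<close>

section \<open>Flows of bounded Lipschitz fields\<close>

text \<open>The time \<open>T\<close> must be fixed before \<epsilon>. Only two durations come from
  the data, the compactness bounds for entering \<omega> forward from \<mu>0 and backward from
  \<mu>1; each motion inside \<omega> gets one unit of time, whatever its complexity, since fields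
  can be rescaled there. Accuracy costs stronger brakes, faster fields and finer cells, never more
  time. Three obstacles shape the rest. Some mass is missed at every stage and its position is
  unknown: fields are therefore bounded outside a fixed ball, which confines all trajectories
  independently of the control, so that an exceptional mass \<kappa> costs at most \<kappa> times a
  constant. Bisection needs positive target masses, while the image of \<mu>1 may miss a cell: a
  small share of Lebesgue measure is mixed into the targets. The Lipschitz constant of the map
  undoing the backward motion depends on \<epsilon>: cells are sized only once that map is known.
  Compositions of autonomous flows are bi-Lipschitz, so absolute continuity survives every stage and
  hyperplanes stay null; this is what makes masses vary continuously.\<close>

definition bounded_lipschitz :: "('a::euclidean_space \<Rightarrow> 'a) \<Rightarrow> bool" where
  "bounded_lipschitz G \<longleftrightarrow> (\<exists>L. L-lipschitz_on UNIV G) \<and> bounded (range G)"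

definition trajectory :: "('a::euclidean_space \<Rightarrow> 'a) \<Rightarrow> (real \<Rightarrow> 'a) \<Rightarrow> bool" where
  "trajectory G x \<longleftrightarrow> (\<forall>s. (x has_vector_derivative G (x s)) (at s))"

lemma bounded_lipschitzE:
  assumes "bounded_lipschitz G"
  obtains L B where "L > 0" "L-lipschitz_on UNIV G" "B > 0" "\<And>x. norm (G x) \<le> B"
proof -
  obtain L B where LB: "L-lipschitz_on UNIV G" "\<And>x. norm (G x) \<le> B"
    using assms unfolding bounded_lipschitz_def bounded_iff by auto
  have "(\<bar>L\<bar> + 1)-lipschitz_on UNIV G"
    by (rule lipschitz_on_le[OF LB(1)]) auto
  moreover have "norm (G x) \<le> \<bar>B\<bar> + 1" for x
    using LB(2)[of x] by linarith
  ultimately show ?thesis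
    using that[of "\<bar>L\<bar> + 1" "\<bar>B\<bar> + 1"] by auto
qed

lemma bounded_lipschitz_minus: "bounded_lipschitz G \<Longrightarrow> bounded_lipschitz (\<lambda>x. - G x)"
  unfolding bounded_lipschitz_def bounded_iff by (auto simp: lipschitz_on_minus_iff)

lemma bounded_lipschitz_continuous: "bounded_lipschitz G \<Longrightarrow> continuous_on S G"
  unfolding bounded_lipschitz_def
  by (meson continuous_on_subset lipschitz_on_continuous_on subset_UNIV)

section \<open>Symmetries of trajectories and dependence on the initial point\<close>

lemma trajectory_reverse: "trajectory G x \<Longrightarrow> trajectory (\<lambda>y. - G y) (\<lambda>s. x (- s))"
  unfolding trajectory_def
proof
  fix s assume a: "\<forall>s. (x has_vector_derivative G (x s)) (at s)"
  have "((x \<circ> uminus) has_vector_derivative (-1) *\<^sub>R G (x (- s))) (at s)"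
    by (rule vector_diff_chain_at) (use a in \<open>auto intro!: derivative_eq_intros\<close>)
  then show "((\<lambda>s. x (- s)) has_vector_derivative - G (x (- s))) (at s)"
    by (simp add: o_def)
qed

lemma trajectory_shift: "trajectory G x \<Longrightarrow> trajectory G (\<lambda>s. x (s + a))"
  unfolding trajectory_def
proof
  fix s assume a: "\<forall>s. (x has_vector_derivative G (x s)) (at s)"
  have "((x \<circ> (\<lambda>s. s + a)) has_vector_derivative 1 *\<^sub>R G (x (s + a))) (at s)"
    by (rule vector_diff_chain_at) (use a in \<open>auto intro!: derivative_eq_intros\<close>)
  then show "((\<lambda>s. x (s + a)) has_vector_derivative G (x (s + a))) (at s)"
    by (simp add: o_def)
qed

text \<open>Gronwall in energy form: the Lipschitz bound makes the squared distance times
  \<open>exp (- 2 L s)\<close> nonincreasing. Negative times follow from this by reversal.\<close>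

lemma trajectory_dist_forward:
  fixes G :: "'a::euclidean_space \<Rightarrow> 'a"
  assumes L: "L-lipschitz_on UNIV G" and "0 \<le> t"
    and x: "\<And>s. 0 \<le> s \<Longrightarrow> s \<le> t \<Longrightarrow> (x has_vector_derivative G (x s)) (at s within {0..t})"
    and y: "\<And>s. 0 \<le> s \<Longrightarrow> s \<le> t \<Longrightarrow> (y has_vector_derivative G (y s)) (at s within {0..t})"
  shows "norm (x t - y t) \<le> exp (L * t) * norm (x 0 - y 0)"
proof -
  define D where "D s = exp (- (2 * L * s)) * ((x s - y s) \<bullet> (x s - y s))" for s
  have der: "(D has_real_derivative
       exp (- (2 * L * s)) * (2 * ((x s - y s) \<bullet> (G (x s) - G (y s))) - 2 * L * ((x s - y s) \<bullet> (x s - y s))))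
       (at s within {0..t})" if "0 \<le> s" "s \<le> t" for s
  proof -
    have "((\<lambda>s. x s - y s) has_vector_derivative (G (x s) - G (y s))) (at s within {0..t})"
      using x[OF that] y[OF that] by (rule has_vector_derivative_diff)
    then have d: "((\<lambda>s. x s - y s) has_derivative (\<lambda>h. h *\<^sub>R (G (x s) - G (y s)))) (at s within {0..t})"
      unfolding has_vector_derivative_def .
    have q: "((\<lambda>s. (x s - y s) \<bullet> (x s - y s)) has_real_derivative
        2 * ((x s - y s) \<bullet> (G (x s) - G (y s)))) (at s within {0..t})"
      unfolding has_field_derivative_def
      by (rule has_derivative_eq_rhs[OF has_derivative_inner[OF d d]]) (simp add: fun_eq_iff inner_commute)
    have e: "((\<lambda>s. exp (- (2 * L * s))) has_real_derivative - (2 * L) * exp (- (2 * L * s))) (at s within {0..t})"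
      by (auto intro!: derivative_eq_intros)
    show ?thesis unfolding D_def
      by (rule DERIV_cong[OF DERIV_mult[OF e q]]) algebra
  qed
  have nonpos: "exp (- (2 * L * s)) * (2 * ((x s - y s) \<bullet> (G (x s) - G (y s))) - 2 * L * ((x s - y s) \<bullet> (x s - y s))) \<le> 0" for s
  proof -
    have "(x s - y s) \<bullet> (G (x s) - G (y s)) \<le> norm (x s - y s) * norm (G (x s) - G (y s))"
      by (rule norm_cauchy_schwarz)
    also have "\<dots> \<le> norm (x s - y s) * (L * norm (x s - y s))"
      using lipschitz_onD[OF L, of "x s" "y s"] by (intro mult_left_mono) (auto simp: dist_norm)
    also have "\<dots> = L * ((x s - y s) \<bullet> (x s - y s))"
      by (simp add: dot_square_norm power2_eq_square)
    finally show ?thesis by (simp add: mult_le_0_iff)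
  qed
  have "D t \<le> D 0"
  proof (cases "t = 0")
    case False
    then have "0 < t" using \<open>0 \<le> t\<close> by simp
    have cont: "continuous_on {0..t} D"
      by (rule DERIV_continuous_on) (use der in auto)
    show ?thesis
    proof (rule DERIV_nonpos_imp_decreasing_open[OF \<open>0 \<le> t\<close> _ cont])
      fix s assume s: "0 < s" "s < t"
      have "at s within {0..t} = at s" using s by (rule at_within_Icc_at)
      with der[of s] s nonpos[of s]
      show "\<exists>y. (D has_real_derivative y) (at s) \<and> y \<le> 0"
        by (metis less_imp_le)
    qed
  qed simp
  then have "(norm (x t - y t))\<^sup>2 \<le> exp (2 * L * t) * (norm (x 0 - y 0))\<^sup>2"
    unfolding D_def by (simp add: exp_minus dot_square_norm field_simps)
  also have "\<dots> = (exp (L * t) * norm (x 0 - y 0))\<^sup>2"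
    by (simp add: power_mult_distrib exp_double[symmetric] mult.assoc)
  finally show ?thesis
    by (rule power2_le_imp_le) auto
qed

lemma trajectory_dist:
  assumes L: "L-lipschitz_on UNIV G" and x: "trajectory G x" and y: "trajectory G y"
  shows "norm (x t - y t) \<le> exp (L * \<bar>t\<bar>) * norm (x 0 - y 0)"
proof (cases "t \<ge> 0")
  case True
  with trajectory_dist_forward[OF L, of t x y] x y show ?thesis
    unfolding trajectory_def by (auto intro: has_vector_derivative_at_within)
next
  case False
  have L': "L-lipschitz_on UNIV (\<lambda>x. - G x)" using L by (simp add: lipschitz_on_minus_iff)
  have "norm (x (- (-t)) - y (- (-t))) \<le> exp (L * (-t)) * norm (x (-0) - y (-0))"
    by (rule trajectory_dist_forward[OF L'])
      (use False trajectory_reverse[OF x] trajectory_reverse[OF y] in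
        \<open>auto simp: trajectory_def intro: has_vector_derivative_at_within\<close>)
  then show ?thesis using False by simp
qed

lemma trajectory_unique:
  assumes "bounded_lipschitz G" "trajectory G x" "trajectory G y" "x a = y a"
  shows "x = y"
proof
  fix t
  obtain L where L: "L-lipschitz_on UNIV G" using assms(1) unfolding bounded_lipschitz_def by auto
  show "x t = y t"
    using trajectory_dist[OF L trajectory_shift[OF assms(2), of a] trajectory_shift[OF assms(3), of a], of "t - a"]
      assms(4) by simp
qed

section \<open>Global existence\<close>

lemma antiderivative_exists:
  fixes h :: "real \<Rightarrow> 'a::euclidean_space"
  assumes "continuous_on UNIV h"
  shows "\<exists>H. H 0 = 0 \<and> (\<forall>s. (H has_vector_derivative h s) (at s))"
proof -
  obtain F where F: "\<And>x::real. (F has_vector_derivative h x) (at x)"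
    using einterval_antiderivative[of "-\<infinity>" "\<infinity>" h] assms
    by (auto simp: continuous_on_eq_continuous_at)
  have "((\<lambda>x. F x - F 0) has_vector_derivative h x) (at x)" for x
    using F[of x] by (auto intro!: derivative_eq_intros)
  then show ?thesis by (intro exI[of _ "\<lambda>x. F x - F 0"]) auto
qed

text \<open>Mean value inequality on both half lines at once, with a majorant depending on the
  absolute value of the time; negative times reduce to positive ones by reflection.\<close>

lemma derivative_bound_two_sided:
  fixes H :: "real \<Rightarrow> 'a::euclidean_space"
  assumes H: "\<And>s. (H has_vector_derivative h s) (at s)" "H 0 = 0"
    and phi: "\<And>s. (\<phi> has_real_derivative \<phi>' s) (at s)"
    and le: "\<And>s. norm (h s) \<le> \<phi>' \<bar>s\<bar>"
  shows "norm (H t) \<le> \<phi> \<bar>t\<bar> - \<phi> 0"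
proof -
  have fwd: "norm (K t) \<le> \<phi> t - \<phi> 0"
    if K: "\<And>s. (K has_vector_derivative k s) (at s)" "K 0 = 0" "\<And>s. norm (k s) \<le> \<phi>' \<bar>s\<bar>" "t > 0" 
    for K k and t :: real
  proof -
    have "norm (K t - K 0) \<le> \<phi> t - \<phi> 0"
    proof (rule differentiable_bound_general[where f' = k and \<phi>' = \<phi>'])
      show "continuous_on {0..t} K"
        using K(1) continuous_at_imp_continuous_on has_vector_derivative_continuous by blast
      show "continuous_on {0..t} \<phi>"
        using phi continuous_at_imp_continuous_on DERIV_isCont by blast
      show "norm (k s) \<le> \<phi>' s" if "0 < s" for s
        using K(3)[of s] that by simp
    qed (use K phi in \<open>auto simp: has_real_derivative_iff_has_vector_derivative\<close>)
    then show ?thesis using K by simp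
  qed
  consider "t > 0" | "t = 0" | "t < 0" by linarith
  then show ?thesis
  proof cases
    case 1 then show ?thesis using fwd[of H h t] assms by simp
  next
    case 2 then show ?thesis using assms by simp
  next
    case 3
    have "((H \<circ> uminus) has_vector_derivative (-1) *\<^sub>R h (- s)) (at s)" for s
      by (rule vector_diff_chain_at) (use H in \<open>auto intro!: derivative_eq_intros\<close>)
    then have "norm ((H \<circ> uminus) (- t)) \<le> \<phi> (- t) - \<phi> 0"
      by (rule fwd) (use 3 H le[of "- s" for s] in auto)
    then show ?thesis using 3 by simp
  qed
qed

text \<open>Picard iteration contracts in the supremum norm weighted by \<open>exp (- 2 L |t|)\<close>, so a
  single application of Banach's fixed point theorem gives the solution on all of \<open>\<real>\<close>.\<close>

lemma trajectory_exists:
  assumes G: "bounded_lipschitz G"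
  shows "\<exists>x. x 0 = x0 \<and> trajectory G x"
proof -
  obtain L B where LB: "L > 0" "L-lipschitz_on UNIV G" "B > 0" "\<And>x. norm (G x) \<le> B"
    using bounded_lipschitzE[OF G] by metis
  define w where "w t = exp (2 * L * \<bar>t\<bar>)" for t :: real
  have w: "w t > 0" "continuous_on UNIV w" for t
    by (auto simp: w_def intro!: continuous_intros)
  \<comment> \<open>The fixed point is sought for the rescaled deviation
    \<open>(x - x0) / w\<close>, which is bounded although \<open>x\<close> itself may grow
    linearly; this makes bounded continuous functions a suitable complete space.\<close>
  define h where "h u s = G (x0 + w s *\<^sub>R apply_bcontfun u s)" for u :: "real \<Rightarrow>\<^sub>C 'a" and s
  have cont_h: "continuous_on UNIV (h u)" for u
  proof -
    have "continuous_on UNIV (\<lambda>s. x0 + w s *\<^sub>R apply_bcontfun u s)"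
      by (intro continuous_on_add continuous_on_const continuous_on_scaleR w(2) continuous_on_apply_bcontfun)
    from continuous_on_compose2[OF bounded_lipschitz_continuous[OF G, of UNIV] this]
    show ?thesis unfolding h_def by simp
  qed
  obtain P where P: "\<And>u. P u 0 = 0" "\<And>u s. (P u has_vector_derivative h u s) (at s)"
    using antiderivative_exists[OF cont_h] by metis
  have contP: "continuous_on UNIV (P u)" for u
    using P(2) continuous_at_imp_continuous_on has_vector_derivative_continuous by blast
  have bndP: "norm (P u t) \<le> B * \<bar>t\<bar>" for u t
    using derivative_bound_two_sided[OF P(2) P(1), of "\<lambda>t. B * t" "\<lambda>_. B" u t] LB(4)
    by (auto simp: h_def intro!: derivative_eq_intros)
  define T where "T u = Bcontfun (\<lambda>t. inverse (w t) *\<^sub>R P u t)" for u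
  have "(\<lambda>t. inverse (w t) *\<^sub>R P u t) \<in> bcontfun" for u
  proof (rule bcontfun_normI)
    show "continuous_on UNIV (\<lambda>t. inverse (w t) *\<^sub>R P u t)"
      by (intro continuous_on_scaleR continuous_on_inverse w(2) contP) (simp add: w_def)
    fix t
    \<comment> \<open>The inequality \<open>exp y \<ge> 1 + y\<close> turns the linear growth of
      \<open>P u\<close> into a bound by a multiple of the weight.\<close>
    have "2 * L * \<bar>t\<bar> \<le> w t" unfolding w_def
      using exp_ge_add_one_self[of "2 * L * \<bar>t\<bar>"] by linarith
    then have "B * (2 * L * \<bar>t\<bar>) \<le> B * w t" using LB by (intro mult_left_mono) auto
    then have "B * \<bar>t\<bar> \<le> w t * (B / (2 * L))"
      using LB by (simp add: field_simps)
    then have "norm (P u t) \<le> w t * (B / (2 * L))" using bndP[of u t] by linarith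
    then show "norm (inverse (w t) *\<^sub>R P u t) \<le> B / (2 * L)"
      using w(1)[of t] LB by (simp add: field_simps)
  qed
  then have T: "apply_bcontfun (T u) t = inverse (w t) *\<^sub>R P u t" for u t
    unfolding T_def by (simp add: Bcontfun_inverse)
  have "dist (T u) (T u') \<le> (1/2) * dist u u'" for u u'
  proof (rule dist_bound)
    fix t
    let ?d = "dist u u'"
    have 1: "norm (h u s - h u' s) \<le> L * ?d * w \<bar>s\<bar>" for s
    proof -
      have "norm (h u s - h u' s) \<le> L * norm (w s *\<^sub>R apply_bcontfun u s - w s *\<^sub>R apply_bcontfun u' s)"
        unfolding h_def
        using lipschitz_onD[OF LB(2), of "x0 + w s *\<^sub>R apply_bcontfun u s" "x0 + w s *\<^sub>R apply_bcontfun u' s"]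
        by (simp add: dist_norm)
      also have "\<dots> = L * (w s * dist (apply_bcontfun u s) (apply_bcontfun u' s))"
        using w(1)[of s] by (simp add: dist_norm flip: scaleR_diff_right)
      also have "\<dots> \<le> L * (w s * ?d)"
        using LB w(1)[of s] dist_bounded[of u s u'] by (intro mult_left_mono) auto
      finally show ?thesis by (simp add: w_def mult_ac)
    qed
    \<comment> \<open>Integrating \<open>L d exp (2 L s)\<close> gives
      \<open>(d / 2) exp (2 L s)\<close>: the exponent \<open>2 L\<close> of the weight is what
      produces the contraction factor 1/2.\<close>
    have "norm (P u t - P u' t) \<le> (?d / 2) * exp (2 * L * \<bar>t\<bar>) - (?d / 2) * exp (2 * L * 0)"
      by (rule derivative_bound_two_sided[where h = "\<lambda>s. h u s - h u' s" and \<phi>' = "\<lambda>s. L * ?d * exp (2 * L * s)"])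
        (use P 1 in \<open>auto simp: w_def intro!: derivative_eq_intros\<close>)
    then have "norm (P u t - P u' t) \<le> (?d / 2) * w t"
      using zero_le_dist[of u u'] unfolding w_def mult_zero_right exp_zero mult_1_right by linarith
    then have "inverse (w t) * norm (P u t - P u' t) \<le> inverse (w t) * ((?d / 2) * w t)"
      using w(1)[of t] by (intro mult_left_mono) auto
    also have "\<dots> = 1 / 2 * ?d"
      using w(1)[of t] by simp
    finally show "dist (apply_bcontfun (T u) t) (apply_bcontfun (T u') t) \<le> 1 / 2 * ?d"
      using w(1)[of t] unfolding T dist_norm scaleR_diff_right[symmetric] norm_scaleR by simp
  qed
  then obtain u where u: "T u = u"
    using banach_fix_type[of "1/2" T] by auto
  define x where "x t = x0 + P u t" for t
  have "x t = x0 + w t *\<^sub>R apply_bcontfun u t" for t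
    using T[of u t] w(1)[of t] unfolding u x_def by simp
  then have "h u s = G (x s)" for s unfolding h_def by simp
  then have "trajectory G x"
    unfolding trajectory_def x_def using P(2)[of u] by (auto intro!: derivative_eq_intros)
  moreover have "x 0 = x0" using P by (simp add: x_def)
  ultimately show ?thesis by blast
qed

section \<open>The flow as a one-parameter group\<close>

lemma flow_eqI:
  assumes "bounded_lipschitz G" "trajectory G x" "x 0 = x0"
  shows "flow G t x0 = x t"
  unfolding flow_def
proof (rule the_equality)
  show "\<exists>x'. x' 0 = x0 \<and> (\<forall>s. (x' has_vector_derivative G (x' s)) (at s)) \<and> x t = x' t"
    using assms unfolding trajectory_def by blast
  show "y = x t" if "\<exists>x'. x' 0 = x0 \<and> (\<forall>s. (x' has_vector_derivative G (x' s)) (at s)) \<and> y = x' t" for y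
    using that trajectory_unique[OF assms(1,2), of _ 0] assms(3) unfolding trajectory_def by metis
qed

lemma flow_trajectory:
  assumes "bounded_lipschitz G"
  shows "trajectory G (\<lambda>t. flow G t x0)" and flow_0 [simp]: "flow G 0 x0 = x0"
proof -
  obtain x where x: "x 0 = x0" "trajectory G x" using trajectory_exists[OF assms] by blast
  then have "(\<lambda>t. flow G t x0) = x" using flow_eqI[OF assms x(2,1)] by auto
  with x show "trajectory G (\<lambda>t. flow G t x0)" "flow G 0 x0 = x0" by metis+
qed

lemma flow_has_derivative:
  "bounded_lipschitz G \<Longrightarrow> ((\<lambda>t. flow G t x0) has_vector_derivative G (flow G t x0)) (at t within S)"
  using flow_trajectory[of G] unfolding trajectory_def by (blast intro: has_vector_derivative_at_within)

lemma flow_continuous: "bounded_lipschitz G \<Longrightarrow> continuous_on S (\<lambda>t. flow G t x0)"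
  using flow_has_derivative has_vector_derivative_continuous continuous_on_eq_continuous_within by metis

lemma flow_add: 
  assumes "bounded_lipschitz G"
  shows "flow G (s + t) x = flow G s (flow G t x)"
  using flow_eqI[OF assms trajectory_shift[OF flow_trajectory(1)[OF assms, of x], of t]] by simp

lemma flow_inverse:
  assumes "bounded_lipschitz G"
  shows "flow G (- t) (flow G t x) = x" "flow G t (flow G (- t) x) = x"
  using flow_add[OF assms, of "-t" t x] flow_add[OF assms, of t "-t" x] assms by auto

lemma flow_minus: 
  assumes "bounded_lipschitz G"
  shows "flow (\<lambda>x. - G x) t x = flow G (- t) x"
  using flow_eqI[OF bounded_lipschitz_minus[OF assms] trajectory_reverse[OF flow_trajectory(1)[OF assms, of x]]]
    assms by simp

lemma flow_lipschitz:
  assumes "bounded_lipschitz G"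
  shows "\<exists>K. K-lipschitz_on UNIV (flow G t)"
proof -
  obtain L where L: "L-lipschitz_on UNIV G" using assms unfolding bounded_lipschitz_def by auto
  have "(exp (L * \<bar>t\<bar>))-lipschitz_on UNIV (flow G t)"
    using trajectory_dist[OF L flow_trajectory(1)[OF assms] flow_trajectory(1)[OF assms]] assms
    by (intro lipschitz_onI) (auto simp: dist_norm)
  then show ?thesis by blast
qed

lemma flow_fixed:
  assumes "bounded_lipschitz G" "G x = 0"
  shows "flow G t x = x"
  by (rule flow_eqI[OF assms(1), of "\<lambda>_. x"]) (auto simp: trajectory_def assms)

section \<open>Steering by compositions of flows\<close>

lemma caratheodory_solution_continuous:
  assumes "caratheodory_solution w x0 x" "0 \<le> t"
  shows "continuous_on {0..t} x"
proof -
  have "continuous_on {0..t} (\<lambda>s. x0 + integral {0..s} (\<lambda>s. w (x s) s))"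
    using assms unfolding caratheodory_solution_def
    by (intro continuous_intros indefinite_integral_continuous_1) (auto simp: absolutely_integrable_on_def)
  then show ?thesis
    by (rule continuous_on_eq) (use assms in \<open>auto simp: caratheodory_solution_def\<close>)
qed

text \<open>The field is only measurable in time, so the difference cannot be differentiated at
  every time. Instead the maximum \<open>m\<close> of \<open>exp (- 2 K s) * d s\<close> on
  \<open>{0..t}\<close> is attained at some \<open>r\<close>, and the integral equation up to
  \<open>r\<close> gives \<open>m exp (2 K r) \<le> (m / 2) (exp (2 K r) - 1)\<close>, which forces
  \<open>m \<le> 0\<close>.\<close>

lemma caratheodory_solution_unique:
  assumes L: "\<And>s. 0 \<le> s \<Longrightarrow> L-lipschitz_on UNIV (\<lambda>x. w x s)"
    and x: "caratheodory_solution w x0 x" and y: "caratheodory_solution w x0 y" and "0 \<le> t"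
  shows "x t = y t"
proof -
  define K where "K = \<bar>L\<bar> + 1"
  have K: "K > 0" "\<And>s. 0 \<le> s \<Longrightarrow> K-lipschitz_on UNIV (\<lambda>x. w x s)"
    using lipschitz_on_le[OF L, of _ K] by (auto simp: K_def)
  define d where "d s = norm (x s - y s)" for s
  have cd: "continuous_on {0..t} d"
    unfolding d_def using caratheodory_solution_continuous[OF x \<open>0 \<le> t\<close>] caratheodory_solution_continuous[OF y \<open>0 \<le> t\<close>]
    by (intro continuous_intros)
  have "continuous_on {0..t} (\<lambda>s. exp (- (2 * K * s)) * d s)"
    by (intro continuous_intros cd)
  moreover have "{0..t} \<noteq> {}" using \<open>0 \<le> t\<close> by simp
  ultimately obtain r where r: "r \<in> {0..t}" "\<And>s. s \<in> {0..t} \<Longrightarrow> exp (- (2 * K * s)) * d s \<le> exp (- (2 * K * r)) * d r"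
    using continuous_attains_sup[OF compact_Icc] by blast
  define m where "m = exp (- (2 * K * r)) * d r"
  have m: "d s \<le> m * exp (2 * K * s)" if "s \<in> {0..t}" for s
    using r(2)[OF that] unfolding m_def by (simp add: exp_minus field_simps)
  have "0 \<le> m" unfolding m_def d_def by simp
  have ix: "(\<lambda>s. w (x s) s) integrable_on {0..r}" "(\<lambda>s. w (y s) s) integrable_on {0..r}"
    using x y r(1) unfolding caratheodory_solution_def absolutely_integrable_on_def by auto
  have E: "((\<lambda>s. K * (m * exp (2 * K * s))) has_integral (m / 2) * exp (2 * K * r) - (m / 2) * exp (2 * K * 0)) {0..r}"
    by (rule fundamental_theorem_of_calculus)
      (use r K in \<open>auto simp flip: has_real_derivative_iff_has_vector_derivative intro!: derivative_eq_intros\<close>)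
  have "x r - y r = integral {0..r} (\<lambda>s. w (x s) s - w (y s) s)"
    using x y r(1) ix unfolding caratheodory_solution_def by (simp add: integral_diff)
  then have "d r = norm (integral {0..r} (\<lambda>s. w (x s) s - w (y s) s))"
    unfolding d_def by simp
  also have "\<dots> \<le> integral {0..r} (\<lambda>s. K * (m * exp (2 * K * s)))"
  proof (rule integral_norm_bound_integral)
    show "(\<lambda>s. w (x s) s - w (y s) s) integrable_on {0..r}" using ix by (rule integrable_diff)
    show "(\<lambda>s. K * (m * exp (2 * K * s))) integrable_on {0..r}" using E by blast
    fix s assume s: "s \<in> {0..r}"
    have "norm (w (x s) s - w (y s) s) \<le> K * d s"
      using lipschitz_onD[OF K(2)[of s], of "x s" "y s"] s by (simp add: dist_norm d_def)
    also have "\<dots> \<le> K * (m * exp (2 * K * s))"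
      using m[of s] s r(1) K by (intro mult_left_mono) auto
    finally show "norm (w (x s) s - w (y s) s) \<le> K * (m * exp (2 * K * s))" .
  qed
  also have "\<dots> = (m / 2) * exp (2 * K * r) - m / 2"
    using integral_unique[OF E] by simp
  finally have "d r \<le> (m / 2) * exp (2 * K * r) - m / 2" .
  moreover have "d r = m * exp (2 * K * r)"
    unfolding m_def by (simp add: exp_minus)
  ultimately have "m * (exp (2 * K * r) + 1) \<le> 0" by (simp add: algebra_simps)
  then have "m \<le> 0"
    by (metis add_pos_pos exp_gt_zero mult_pos_pos not_le zero_less_one)
  then have "d t \<le> 0" using m[of t] \<open>0 \<le> m\<close> \<open>0 \<le> t\<close> by simp
  then show ?thesis unfolding d_def by simp
qed

lemma nonautonomous_flow_eqI:
  assumes "\<And>s. 0 \<le> s \<Longrightarrow> L-lipschitz_on UNIV (\<lambda>x. w x s)"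
    and "caratheodory_solution w x0 x" and "0 \<le> t"
  shows "nonautonomous_flow w t x0 = x t"
  unfolding nonautonomous_flow_def
  by (rule the_equality) (use assms caratheodory_solution_unique in \<open>blast+\<close>)

text \<open>The bound off the ball of radius \<open>R\<close> confines all trajectories to a ball that does not depend on
  the control, although the fields may be arbitrarily fast near the origin.\<close>

definition steering_field ::
    "('a::euclidean_space \<Rightarrow> 'a) \<Rightarrow> 'a set \<Rightarrow> real \<Rightarrow> real \<Rightarrow> ('a \<Rightarrow> 'a) \<Rightarrow> bool" where
  "steering_field v \<omega> R M G \<longleftrightarrow>
     bounded_lipschitz G \<and> (\<forall>x. x \<notin> \<omega> \<longrightarrow> G x = v x) \<and> (\<forall>x. R \<le> norm x \<longrightarrow> norm (G x) \<le> M)"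

text \<open>The maps reached by controls that are piecewise constant in time, with the elapsed time
  as an index. Invertibility, confinement, reversal of time and realization by an admissible control
  each pass from a single flow to compositions by induction.\<close>

inductive steerable ::
    "('a::euclidean_space \<Rightarrow> 'a) \<Rightarrow> 'a set \<Rightarrow> real \<Rightarrow> real \<Rightarrow> real \<Rightarrow> ('a \<Rightarrow> 'a) \<Rightarrow> bool"
  for v \<omega> R M where
  steerable_id: "steerable v \<omega> R M 0 (\<lambda>x. x)"
| steerable_step: "steerable v \<omega> R M t \<Psi> \<Longrightarrow> steering_field v \<omega> R M G \<Longrightarrow> 0 \<le> s \<Longrightarrow>
    steerable v \<omega> R M (t + s) (\<lambda>x. flow G s (\<Psi> x))"

lemma steerable_flow:
  "steering_field v \<omega> R M G \<Longrightarrow> 0 \<le> s \<Longrightarrow> steerable v \<omega> R M s (flow G s)"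
  using steerable_step[OF steerable_id, of v \<omega> R M G s] by simp

lemma steerable_compose:
  assumes "steerable v \<omega> R M s \<Xi>" "steerable v \<omega> R M t \<Psi>"
  shows "steerable v \<omega> R M (t + s) (\<lambda>x. \<Xi> (\<Psi> x))"
  using assms(1)
proof induction
  case steerable_id
  then show ?case using assms(2) by simp
next
  case (steerable_step s \<Xi> G r)
  then show ?case
    using steerable.steerable_step[OF steerable_step.IH steerable_step.hyps(2,3)] by (simp add: add.assoc)
qed

lemma steerable_nonneg: "steerable v \<omega> R M t \<Psi> \<Longrightarrow> 0 \<le> t"
  by (induction rule: steerable.induct) auto

lemma steering_field_minus:
  "steering_field (\<lambda>x. - v x) \<omega> R M G \<Longrightarrow> steering_field v \<omega> R M (\<lambda>x. - G x)"
  unfolding steering_field_def by (auto intro: bounded_lipschitz_minus)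

text \<open>Backward in time the pieces are run in opposite order with opposite sign: a field
  agreeing with \<open>- v\<close> off \<omega> becomes one agreeing with \<open>v\<close>. Thus a
  steering found for the reversed drift is undone by an actual steering of the same
  duration.\<close>

lemma steerable_reverse:
  assumes "steerable (\<lambda>x. - v x) \<omega> R M t \<Psi>"
  shows "\<exists>\<Xi>. steerable v \<omega> R M t \<Xi> \<and> (\<forall>x. \<Xi> (\<Psi> x) = x \<and> \<Psi> (\<Xi> x) = x)"
  using assms
proof induction
  case steerable_id
  then show ?case by (intro exI[of _ "\<lambda>x. x"]) (auto intro: steerable.steerable_id)
next
  case (steerable_step t \<Psi> G s)
  then obtain \<Xi> where \<Xi>: "steerable v \<omega> R M t \<Xi>" "\<And>x. \<Xi> (\<Psi> x) = x" "\<And>x. \<Psi> (\<Xi> x) = x" by blast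
  have G: "bounded_lipschitz G" using steerable_step.hyps unfolding steering_field_def by blast
  have "steerable v \<omega> R M (s + t) (\<lambda>x. \<Xi> (flow (\<lambda>x. - G x) s x))"
    by (rule steerable_compose[OF \<Xi>(1) steerable_flow[OF steering_field_minus]]) (use steerable_step.hyps in auto)
  then show ?case
    by (intro exI[of _ "\<lambda>x. \<Xi> (flow (\<lambda>x. - G x) s x)"])
      (simp add: flow_minus[OF G] flow_inverse[OF G] \<Xi> add.commute)
qed

text \<open>Each flow is inverted by the flow for the negative time, and Lipschitz constants
  multiply. The bound on the inverse is what lets absolute continuity pass to push-forwards.\<close>

lemma steerable_bilipschitz:
  assumes "steerable v \<omega> R M t \<Psi>"
  shows "\<exists>\<Xi> K. K-lipschitz_on UNIV \<Psi> \<and> K-lipschitz_on UNIV \<Xi> \<and> (\<forall>x. \<Xi> (\<Psi> x) = x \<and> \<Psi> (\<Xi> x) = x)"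
  using assms
proof induction
  case steerable_id
  then show ?case by (intro exI[of _ "\<lambda>x. x"] exI[of _ 1]) (auto simp: lipschitz_on_def)
next
  case (steerable_step t \<Psi> G s)
  then obtain \<Xi> K where \<Xi>: "K-lipschitz_on UNIV \<Psi>" "K-lipschitz_on UNIV \<Xi>"
    "\<And>x. \<Xi> (\<Psi> x) = x" "\<And>x. \<Psi> (\<Xi> x) = x" by blast
  have G: "bounded_lipschitz G" using steerable_step.hyps unfolding steering_field_def by blast
  obtain A B where AB: "A-lipschitz_on UNIV (flow G s)" "B-lipschitz_on UNIV (flow G (- s))"
    using flow_lipschitz[OF G] by meson
  have "(A * K)-lipschitz_on UNIV (\<lambda>x. flow G s (\<Psi> x))"
    by (rule lipschitz_on_compose2[OF \<Xi>(1)]) (rule lipschitz_on_subset[OF AB(1)], simp)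
  moreover have "(K * B)-lipschitz_on UNIV (\<lambda>x. \<Xi> (flow G (- s) x))"
    by (rule lipschitz_on_compose2[OF AB(2)]) (rule lipschitz_on_subset[OF \<Xi>(2)], simp)
  ultimately have "(max (A * K) (K * B))-lipschitz_on UNIV (\<lambda>x. flow G s (\<Psi> x))"
    "(max (A * K) (K * B))-lipschitz_on UNIV (\<lambda>x. \<Xi> (flow G (- s) x))"
    by (auto intro: lipschitz_on_le)
  then show ?case
    by (intro exI[of _ "\<lambda>x. \<Xi> (flow G (- s) x)"] exI conjI) (auto simp: flow_inverse[OF G] \<Xi>)
qed

text \<open>Inside the ball of radius \<open>R\<close> the speed is uncontrolled, so the estimate
  starts at the last time \<open>r\<close> at which the norm is at most
  \<open>m = max R (norm x)\<close>; afterwards the trajectory is outside the ball, where the speed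
  is at most \<open>M\<close>.\<close>

lemma steering_field_norm_flow:
  assumes G: "steering_field v \<omega> R M G" and "0 \<le> s" "0 \<le> M"
  shows "norm (flow G s x) \<le> max R (norm x) + M * s"
proof -
  define m where "m = max R (norm x)"
  have BL: "bounded_lipschitz G" and bnd: "\<And>y. R \<le> norm y \<Longrightarrow> norm (G y) \<le> M"
    using G unfolding steering_field_def by auto
  let ?y = "\<lambda>r. flow G r x"
  have cont: "continuous_on {0..s} (\<lambda>r. norm (?y r))"
    by (intro continuous_intros flow_continuous[OF BL])
  define S where "S = {r \<in> {0..s}. norm (?y r) \<le> m}"
  have "compact S"
    using continuous_on_closed_Collect_le[OF cont continuous_on_const closed_atLeastAtMost, of m]
    unfolding S_def by (intro compact_eq_bounded_closed[THEN iffD2]) (auto intro: bounded_subset[of "{0..s}"])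
  moreover have "0 \<in> S" using \<open>0 \<le> s\<close> BL unfolding S_def m_def by simp
  ultimately obtain r where r: "r \<in> S" "\<And>q. q \<in> S \<Longrightarrow> q \<le> r"
    using compact_attains_sup[of S] by auto
  show ?thesis
  proof (cases "r = s")
    case True
    then show ?thesis using r(1) \<open>0 \<le> s\<close> \<open>0 \<le> M\<close> unfolding S_def m_def by (simp add: add_increasing2)
  next
    case False
    then have "r < s" "0 \<le> r" using r(1) unfolding S_def by auto
    have "norm (?y s - ?y r) \<le> M * s - M * r"
    proof (rule differentiable_bound_general[OF \<open>r < s\<close>, where f' = "\<lambda>q. G (?y q)" and \<phi>' = "\<lambda>_. M"])
      show "norm (G (?y q)) \<le> M" if "r < q" "q < s" for q
      proof -
        have "\<not> norm (?y q) \<le> m" using r(2)[of q] that \<open>0 \<le> r\<close> unfolding S_def by auto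
        then show ?thesis by (intro bnd) (simp add: m_def)
      qed
    qed (auto intro!: flow_continuous[OF BL] flow_has_derivative[OF BL] continuous_intros derivative_eq_intros)
    moreover have "norm (?y r) \<le> m" using r(1) unfolding S_def by simp
    moreover have "norm (?y s) \<le> norm (?y r) + norm (?y s - ?y r)" by (metis norm_triangle_sub)
    moreover have "0 \<le> M * r" using \<open>0 \<le> r\<close> \<open>0 \<le> M\<close> by simp
    ultimately show ?thesis unfolding m_def by linarith
  qed
qed

lemma steerable_norm:
  assumes "steerable v \<omega> R M t \<Psi>" "0 \<le> M"
  shows "norm (\<Psi> x) \<le> max R (norm x) + M * t"
  using assms(1)
proof induction
  case steerable_id
  then show ?case by simp
next
  case (steerable_step t \<Psi> G s)
  have "norm (flow G s (\<Psi> x)) \<le> max R (norm (\<Psi> x)) + M * s"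
    by (rule steering_field_norm_flow) (use steerable_step assms(2) in auto)
  moreover have "0 \<le> M * t" using steerable_nonneg[OF steerable_step.hyps(1)] assms(2) by simp
  ultimately show ?case using steerable_step.IH by (simp add: algebra_simps)
qed

text \<open>The integrand \<open>k\<close> may differ from the derivative at the left end point: at
  a switching time the control still has the value of the preceding piece, and a single time does
  not affect the integral.\<close>

lemma has_vector_derivative_absolutely_integrable:
  fixes y :: "real \<Rightarrow> 'a::euclidean_space"
  assumes "a \<le> b" and y: "\<And>s. s \<in> {a..b} \<Longrightarrow> (y has_vector_derivative h s) (at s within {a..b})"
    and h: "continuous_on {a..b} h" and k: "\<And>s. s \<in> {a..b} - {a} \<Longrightarrow> k s = h s"
  shows "k absolutely_integrable_on {a..b}" "(k has_integral (y b - y a)) {a..b}"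
proof -
  have "h absolutely_integrable_on {a..b}"
    using absolutely_integrable_continuous[of a b h] h by (simp add: cbox_interval)
  then show "k absolutely_integrable_on {a..b}"
    by (rule absolutely_integrable_spike[of _ _ "{a}"]) (use k in auto)
  have "(h has_integral (y b - y a)) {a..b}"
    by (rule fundamental_theorem_of_calculus) (use assms in auto)
  then show "(k has_integral (y b - y a)) {a..b}"
    by (rule has_integral_spike_finite[of "{a}", rotated 2]) (use k in auto)
qed

lemma caratheodory_solution_autonomous:
  assumes G: "bounded_lipschitz G"
  shows "caratheodory_solution (\<lambda>x s. G x) x0 (\<lambda>s. flow G s x0)"
  unfolding caratheodory_solution_def
proof (intro allI impI conjI)
  fix t :: real assume t: "0 \<le> t"
  have c: "continuous_on {0..t} (\<lambda>s. G (flow G s x0))"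
    using continuous_on_compose2[OF bounded_lipschitz_continuous[OF G, of UNIV] flow_continuous[OF G]] by auto
  note * = has_vector_derivative_absolutely_integrable[OF t flow_has_derivative[OF G, of x0] c refl]
  from * show "(\<lambda>s. G (flow G s x0)) absolutely_integrable_on {0..t}" by blast
  from *(2) show "flow G t x0 = x0 + integral {0..t} (\<lambda>s. G (flow G s x0))"
    using G by (simp add: integral_unique)
qed

text \<open>Controls are concatenated in time: after \<open>t\<close> the control is
  \<open>G x - v x\<close>, which replaces the drift by \<open>G\<close>. It vanishes off \<omega>
  because steering fields agree with \<open>v\<close> there.\<close>

lemma steerable_control:
  assumes "steerable v \<omega> R M t \<Psi>" and v: "bounded_lipschitz v"
  shows "\<exists>f \<in> admissible_controls \<omega>.
           \<forall>x. \<exists>y. caratheodory_solution (\<lambda>x s. v x + f x s) x y \<and> y t = \<Psi> x"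
  using assms(1)
proof induction
  case steerable_id
  have "(\<lambda>x t. 0) \<in> admissible_controls \<omega>"
    unfolding admissible_controls_def
    by (auto simp: lipschitz_on_def intro!: exI[of _ "\<lambda>x t. 0"] exI[of _ 0])
  then show ?case
    using caratheodory_solution_autonomous[OF v] flow_0[OF v]
    by (intro bexI[of _ "\<lambda>x t. 0"] allI exI[of _ "\<lambda>s. flow v s x" for x]) auto
next
  case (steerable_step t \<Psi> G r)
  have G: "bounded_lipschitz G" "\<And>x. x \<notin> \<omega> \<Longrightarrow> G x = v x"
    using steerable_step.hyps unfolding steering_field_def by auto
  have "0 \<le> t" using steerable_step.hyps steerable_nonneg by blast
  obtain f where f: "f \<in> admissible_controls \<omega>"
    "\<And>x. \<exists>y. caratheodory_solution (\<lambda>x s. v x + f x s) x y \<and> y t = \<Psi> x"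
    using steerable_step.IH by blast
  obtain u L B where u: "f = (\<lambda>x t. indicat_real \<omega> x *\<^sub>R u x t)"
    and L: "\<And>t. t \<ge> 0 \<Longrightarrow> L-lipschitz_on UNIV (\<lambda>x. f x t)"
    and B: "\<And>x t. t \<ge> 0 \<Longrightarrow> norm (f x t) \<le> B"
    and meas: "\<And>x. (\<lambda>t. f x t) \<in> borel_measurable (lebesgue_on {0..})"
    using f(1) unfolding admissible_controls_def mem_Collect_eq by metis
  obtain Lv Bv where Lv: "Lv-lipschitz_on UNIV v" "\<And>x. norm (v x) \<le> Bv"
    using bounded_lipschitzE[OF v] by metis
  obtain Lg Bg where Lg: "Lg-lipschitz_on UNIV G" "\<And>x. norm (G x) \<le> Bg"
    using bounded_lipschitzE[OF G(1)] by metis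
  define f' where "f' x s = (if s \<le> t then f x s else G x - v x)" for x s
  have "f' \<in> admissible_controls \<omega>"
    unfolding admissible_controls_def mem_Collect_eq
  proof (intro conjI)
    \<comment> \<open>\<open>f'\<close> itself serves as \<open>u\<close>, since it vanishes off
      \<omega>.\<close>
    have "f' = (\<lambda>x t. indicat_real \<omega> x *\<^sub>R f' x t)"
      using G(2) by (auto simp: f'_def u fun_eq_iff indicator_def)
    then show "\<exists>u. f' = (\<lambda>x t. indicat_real \<omega> x *\<^sub>R u x t)" by blast
    have "(max L (Lg + Lv))-lipschitz_on UNIV (\<lambda>x. f' x s)" if "s \<ge> 0" for s
    proof (cases "s \<le> t")
      case True
      then show ?thesis using lipschitz_on_le[OF L[OF that]] by (simp add: f'_def)
    next
      case False
      then show ?thesis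
        using lipschitz_on_le[OF lipschitz_on_diff[OF Lg(1) Lv(1)]] by (simp add: f'_def)
    qed
    then show "\<exists>L. \<forall>t\<ge>0. L-lipschitz_on UNIV (\<lambda>x. f' x t)" by blast
    show "\<forall>x. (\<lambda>t. f' x t) \<in> borel_measurable (lebesgue_on {0..})"
    proof
      fix x
      have "{s \<in> space (lebesgue_on {0..}). s \<le> t} = {0..t}"
        by auto
      also have "\<dots> \<in> sets (lebesgue_on {0..})"
        by (subst sets_restrict_space_iff) auto
      finally show "(\<lambda>t. f' x t) \<in> borel_measurable (lebesgue_on {0..})"
        unfolding f'_def by (intro measurable_If meas measurable_const) auto
    qed
    have "norm (f' x s) \<le> max B (Bg + Bv)" if "s \<ge> 0" for x s
      using B[OF that, of x] Lg(2)[of x] Lv(2)[of x] norm_triangle_ineq4[of "G x" "v x"]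
      unfolding f'_def by (auto simp: max_def)
    then show "\<exists>M. \<forall>x. \<forall>t\<ge>0. norm (f' x t) \<le> M" by blast
  qed
  moreover have "\<exists>y. caratheodory_solution (\<lambda>x s. v x + f' x s) x y \<and> y (t + r) = flow G r (\<Psi> x)" for x
  proof -
    obtain y where y: "caratheodory_solution (\<lambda>x s. v x + f x s) x y" "y t = \<Psi> x"
      using f(2) by blast
    define z where "z s = (if s \<le> t then y s else flow G (s - t) (\<Psi> x))" for s
    let ?k = "\<lambda>s. v (z s) + f' (z s) s"
    have keq: "?k s = v (y s) + f (y s) s" if "s \<le> t" for s
      using that by (simp add: z_def f'_def)
    have before: "?k absolutely_integrable_on {0..s}" "(?k has_integral (z s - x)) {0..s}"
      if s: "0 \<le> s" "s \<le> t" for s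
    proof -
      have *: "(\<lambda>s. v (y s) + f (y s) s) absolutely_integrable_on {0..s}"
        "y s = x + integral {0..s} (\<lambda>s. v (y s) + f (y s) s)"
        using y(1) s unfolding caratheodory_solution_def by auto
      have "((\<lambda>s. v (y s) + f (y s) s) has_integral (z s - x)) {0..s}"
        using *(1) *(2) s unfolding absolutely_integrable_on_def
        by (simp add: z_def has_integral_integral)
      then show "(?k has_integral (z s - x)) {0..s}"
        by (rule has_integral_eq[rotated]) (use keq s in auto)
      \<comment> \<open>With an empty exceptional set the spike rule acts as a congruence
        rule.\<close>
      from *(1) show "?k absolutely_integrable_on {0..s}"
        by (rule absolutely_integrable_spike[of _ _ "{}"]) (use keq s in auto)
    qed
    have "caratheodory_solution (\<lambda>x s. v x + f' x s) x z"
      unfolding caratheodory_solution_def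
    proof (intro allI impI)
      fix s :: real assume "0 \<le> s"
      have "?k absolutely_integrable_on {0..s} \<and> (?k has_integral (z s - x)) {0..s}"
      proof (cases "s \<le> t")
        case True
        then show ?thesis using before[OF \<open>0 \<le> s\<close>] by blast
      next
        case False
        then have "t \<le> s" by simp
        let ?y = "\<lambda>q. flow G (q - t) (\<Psi> x)"
        have d: "(?y has_vector_derivative G (?y q)) (at q within {t..s})" for q
          using trajectory_shift[OF flow_trajectory(1)[OF G(1), of "\<Psi> x"], of "-t"]
          unfolding trajectory_def by (auto intro: has_vector_derivative_at_within)
        have c: "continuous_on {t..s} (\<lambda>q. G (?y q))"
          using d by (intro continuous_on_compose2[OF bounded_lipschitz_continuous[OF G(1), of UNIV]])
            (auto simp: continuous_on_eq_continuous_within intro: has_vector_derivative_continuous)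
        have e: "?k q = G (?y q)" if "q \<in> {t..s} - {t}" for q
          using that by (simp add: f'_def z_def)
        note * = has_vector_derivative_absolutely_integrable[OF \<open>t \<le> s\<close> d c e]
        have zt: "z s - x = (z t - x) + (?y s - ?y t)"
          using y(2) False flow_0[OF G(1)] by (simp add: z_def)
        have "(?k has_integral (z s - x)) {0..s}"
          unfolding zt
          by (rule has_integral_combine[OF \<open>0 \<le> t\<close> \<open>t \<le> s\<close> before(2) *(2)]) (use \<open>0 \<le> t\<close> in auto)
        moreover have "?k absolutely_integrable_on ({0..t} \<union> {t..s})"
          using before(1)[OF \<open>0 \<le> t\<close>] *(1) by (intro set_integrable_Un) auto
        moreover have "{0..t} \<union> {t..s} = {0..s}" using \<open>0 \<le> t\<close> \<open>t \<le> s\<close> by auto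
        ultimately show ?thesis by auto
      qed
      then have k: "?k absolutely_integrable_on {0..s}" "integral {0..s} ?k = z s - x"
        by (auto intro: integral_unique)
      then show "?k absolutely_integrable_on {0..s} \<and> z s = x + integral {0..s} ?k"
        unfolding k(2) by simp
    qed
    moreover have "z (t + r) = flow G r (\<Psi> x)"
      using steerable_step.hyps(3) y(2) flow_0[OF G(1)] by (simp add: z_def)
    ultimately show ?thesis by blast
  qed
  ultimately show ?case by blast
qed

text \<open>Uniqueness identifies the definite description in the nonautonomous flow with the
  solution built above; one control serves all initial measures.\<close>

lemma steerable_solution_measure:
  assumes "steerable v \<omega> R M t \<Psi>" and v: "bounded_lipschitz v"
  shows "\<exists>f \<in> admissible_controls \<omega>. \<forall>\<mu>. solution_measure v f \<mu> t = distr \<mu> borel \<Psi>"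
proof -
  obtain f where f: "f \<in> admissible_controls \<omega>"
    "\<And>x. \<exists>y. caratheodory_solution (\<lambda>x s. v x + f x s) x y \<and> y t = \<Psi> x"
    using steerable_control[OF assms] by blast
  obtain L where L: "\<And>s. 0 \<le> s \<Longrightarrow> L-lipschitz_on UNIV (\<lambda>x. f x s)"
    using f(1) unfolding admissible_controls_def by auto
  obtain Lv where Lv: "Lv-lipschitz_on UNIV v" using v unfolding bounded_lipschitz_def by auto
  have lip: "(Lv + L)-lipschitz_on UNIV (\<lambda>x. v x + f x s)" if "0 \<le> s" for s
    by (rule lipschitz_on_add[OF Lv L[OF that]])
  have "nonautonomous_flow (\<lambda>x s. v x + f x s) t x = \<Psi> x" for x
  proof -
    obtain y where y: "caratheodory_solution (\<lambda>x s. v x + f x s) x y" "y t = \<Psi> x"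
      using f(2) by blast
    show ?thesis
      using nonautonomous_flow_eqI[of _ "\<lambda>x s. v x + f x s", OF lip y(1) steerable_nonneg[OF assms(1)]] y(2)
      by simp
  qed
  then have "nonautonomous_flow (\<lambda>x s. v x + f x s) t = \<Psi>" by blast
  then show ?thesis using f(1) by (intro bexI[of _ f]) (auto simp: solution_measure_def)
qed

section \<open>Braking inside the control region\<close>

lemma bounded_lipschitzI:
  assumes "L-lipschitz_on UNIV G" "\<And>x. norm (G x) \<le> B"
  shows "bounded_lipschitz G"
  using assms unfolding bounded_lipschitz_def bounded_iff by auto

lemma bounded_lipschitz_scale:
  fixes V :: "'a::euclidean_space \<Rightarrow> 'a" and \<phi> :: "'a \<Rightarrow> real"
  assumes \<phi>: "L-lipschitz_on UNIV \<phi>" "\<And>x. \<bar>\<phi> x\<bar> \<le> C" and V: "bounded_lipschitz V"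
  shows "bounded_lipschitz (\<lambda>x. \<phi> x *\<^sub>R V x)"
proof -
  obtain K B where KB: "K > 0" "K-lipschitz_on UNIV V" "B > 0" "\<And>x. norm (V x) \<le> B"
    using bounded_lipschitzE[OF V] by metis
  have C: "0 \<le> C" using \<phi>(2)[of 0] by linarith
  have L: "0 \<le> L" using \<phi>(1) unfolding lipschitz_on_def by auto
  show ?thesis
  proof (rule bounded_lipschitzI)
    show "norm (\<phi> x *\<^sub>R V x) \<le> C * B" for x
      using \<phi>(2)[of x] KB(4)[of x] C by (auto intro!: mult_mono)
    show "(C * K + L * B)-lipschitz_on UNIV (\<lambda>x. \<phi> x *\<^sub>R V x)"
    proof (rule lipschitz_onI)
      fix x y
      have "norm (\<phi> x *\<^sub>R V x - \<phi> y *\<^sub>R V y) = norm (\<phi> x *\<^sub>R (V x - V y) + (\<phi> x - \<phi> y) *\<^sub>R V y)"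
        by (simp add: algebra_simps)
      also have "\<dots> \<le> \<bar>\<phi> x\<bar> * norm (V x - V y) + \<bar>\<phi> x - \<phi> y\<bar> * norm (V y)"
        using norm_triangle_ineq[of "\<phi> x *\<^sub>R (V x - V y)" "(\<phi> x - \<phi> y) *\<^sub>R V y"] by simp
      also have "\<dots> \<le> C * (K * dist x y) + (L * dist x y) * B"
        using \<phi>(2)[of x] lipschitz_onD[OF KB(2), of x y] lipschitz_onD[OF \<phi>(1), of x y] KB(4)[of y] C L
        by (intro add_mono mult_mono) (auto simp: dist_norm)
      finally show "dist (\<phi> x *\<^sub>R V x) (\<phi> y *\<^sub>R V y) \<le> (C * K + L * B) * dist x y"
        by (simp add: dist_norm algebra_simps)
    next
      show "0 \<le> C * K + L * B" using C L KB by simp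
    qed
  qed
qed

lemma flow_lipschitz_time:
  assumes V: "bounded_lipschitz V" and B: "\<And>x. norm (V x) \<le> B"
  shows "norm (flow V s x - flow V t x) \<le> B * \<bar>s - t\<bar>"
proof -
  define H where "H r = flow V (r + t) x - flow V t x" for r
  have d: "(H has_vector_derivative V (flow V (r + t) x)) (at r)" for r
    using trajectory_shift[OF flow_trajectory(1)[OF V, of x], of t]
    unfolding trajectory_def H_def by (auto intro!: derivative_eq_intros)
  have "norm (H (s - t)) \<le> B * \<bar>s - t\<bar> - B * 0"
    by (rule derivative_bound_two_sided[where \<phi>' = "\<lambda>_. B", OF d])
      (auto simp: H_def B intro!: derivative_eq_intros)
  then show ?thesis by (simp add: H_def)
qed

lemma bounded_lipschitz_along_flow:
  fixes \<phi> :: "'a::euclidean_space \<Rightarrow> real"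
  assumes \<phi>: "L-lipschitz_on UNIV \<phi>" "\<And>x. \<bar>\<phi> x\<bar> \<le> C" and V: "bounded_lipschitz V"
  shows "bounded_lipschitz (\<lambda>\<tau>. \<phi> (flow V \<tau> x))"
proof -
  obtain B where B: "B > 0" "\<And>x. norm (V x) \<le> B" using bounded_lipschitzE[OF V] by metis
  have "B-lipschitz_on UNIV (\<lambda>\<tau>. flow V \<tau> x)"
    using flow_lipschitz_time[OF V B(2)] B(1) by (intro lipschitz_onI) (auto simp: dist_norm)
  then have "(L * B)-lipschitz_on UNIV (\<lambda>\<tau>. \<phi> (flow V \<tau> x))"
    by (rule lipschitz_on_compose2) (rule lipschitz_on_subset[OF \<phi>(1)], simp)
  then show ?thesis by (rule bounded_lipschitzI) (use \<phi>(2) in auto)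
qed

text \<open>A scalar factor changes only the speed along an orbit: the moving point sits on the
  orbit of \<open>V\<close> at a clock time that solves the scalar equation with right-hand side
  \<phi> along that orbit.\<close>

lemma flow_reparametrized:
  fixes \<phi> :: "'a::euclidean_space \<Rightarrow> real"
  assumes V: "bounded_lipschitz V" and W: "bounded_lipschitz (\<lambda>x. \<phi> x *\<^sub>R V x)"
    and f: "bounded_lipschitz (\<lambda>\<tau>. \<phi> (flow V \<tau> x))"
  shows "flow (\<lambda>x. \<phi> x *\<^sub>R V x) s x = flow V (flow (\<lambda>\<tau>. \<phi> (flow V \<tau> x)) s 0) x"
proof -
  let ?\<tau> = "\<lambda>s. flow (\<lambda>\<tau>. \<phi> (flow V \<tau> x)) s 0"
  have "trajectory (\<lambda>x. \<phi> x *\<^sub>R V x) (\<lambda>s. flow V (?\<tau> s) x)"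
    unfolding trajectory_def
  proof
    fix s
    have "((\<lambda>\<tau>. flow V \<tau> x) \<circ> ?\<tau> has_vector_derivative \<phi> (flow V (?\<tau> s) x) *\<^sub>R V (flow V (?\<tau> s) x)) (at s)"
      by (rule vector_diff_chain_at) (rule flow_has_derivative[OF f], rule flow_has_derivative[OF V])
    then show "((\<lambda>s. flow V (?\<tau> s) x) has_vector_derivative \<phi> (flow V (?\<tau> s) x) *\<^sub>R V (flow V (?\<tau> s) x)) (at s)"
      by (simp add: o_def)
  qed
  then show ?thesis
    by (rule flow_eqI[OF W]) (simp add: flow_0[OF f] flow_0[OF V])
qed

text \<open>An equilibrium is a barrier: passing \<open>b\<close> would mean being at
  \<open>b\<close> at some time, and uniqueness keeps a trajectory at an equilibrium
  forever.\<close>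

lemma scalar_flow_le_zero:
  fixes g :: "real \<Rightarrow> real"
  assumes g: "bounded_lipschitz g" and "g b = 0" "a \<le> b"
  shows "flow g s a \<le> b"
proof (rule ccontr)
  assume "\<not> flow g s a \<le> b"
  moreover have "connected (range (\<lambda>s. flow g s a))"
    by (rule connected_continuous_image[OF flow_continuous[OF g] connected_UNIV])
  moreover have "flow g 0 a \<le> b" using assms by (simp add: flow_0[OF g])
  ultimately obtain r where r: "flow g r a = b"
    using connectedD_interval[of "range (\<lambda>s. flow g s a)" "flow g 0 a" "flow g s a" b] by auto
  have "flow g s a = flow g (s - r) (flow g r a)"
    using flow_add[OF g, of "s - r" r a] by simp
  then show False using r flow_fixed[OF g \<open>g b = 0\<close>] \<open>\<not> flow g s a \<le> b\<close> by simp
qed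

lemma scalar_flow_mono:
  fixes g :: "real \<Rightarrow> real"
  assumes g: "bounded_lipschitz g" and "\<And>x. 0 \<le> g x" "s \<le> t"
  shows "flow g s a \<le> flow g t a"
  using \<open>s \<le> t\<close>
proof (rule DERIV_nonneg_imp_nondecreasing)
  fix x show "\<exists>y. ((\<lambda>r. flow g r a) has_real_derivative y) (at x) \<and> 0 \<le> y"
    using flow_has_derivative[OF g, of a x UNIV] assms(2)
    unfolding has_real_derivative_iff_has_vector_derivative by blast
qed

text \<open>As long as the clock is below \<open>b\<close> it runs at unit speed, so failing to
  reach \<open>b\<close> by time \<open>T\<close> would give the clock value
  \<open>T \<ge> b\<close>.\<close>

lemma scalar_flow_ge:
  fixes g :: "real \<Rightarrow> real"
  assumes g: "bounded_lipschitz g" and nn: "\<And>x. 0 \<le> g x"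
    and one: "\<And>x. 0 \<le> x \<Longrightarrow> x < b \<Longrightarrow> g x = 1" and "b \<le> T" "0 \<le> T"
  shows "b \<le> flow g T 0"
proof (rule ccontr)
  assume c: "\<not> b \<le> flow g T 0"
  have r: "g (flow g s 0) = 1" if "0 \<le> s" "s \<le> T" for s
    using scalar_flow_mono[OF g nn, of 0 s 0] scalar_flow_mono[OF g nn, of s T 0] that c flow_0[OF g, of 0]
    by (intro one) auto
  have "flow g T 0 = T"
  proof (cases "T = 0")
    case False
    then have "0 < T" using \<open>0 \<le> T\<close> by simp
    have "\<exists>z. 0 < z \<and> z < T \<and> flow g T 0 - flow g 0 0 = (T - 0) * g (flow g z 0)"
      by (rule MVT2[OF \<open>0 < T\<close>])
        (use flow_has_derivative[OF g, of 0 _ UNIV] in \<open>simp add: has_real_derivative_iff_has_vector_derivative\<close>)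
    then obtain z where "0 < z" "z < T" "flow g T 0 - flow g 0 0 = T * g (flow g z 0)" by auto
    then show ?thesis using r[of z] flow_0[OF g, of 0] by simp
  qed (simp add: flow_0[OF g])
  then show False using c \<open>b \<le> T\<close> by simp
qed

text \<open>The factor is 1 where \<theta> is zero and 0 once \<open>k * \<theta> x\<close> reaches
  1; the linear ramp in between keeps the field Lipschitz for every \<open>k\<close>.\<close>

definition braked :: "('a::euclidean_space \<Rightarrow> real) \<Rightarrow> ('a \<Rightarrow> 'a) \<Rightarrow> nat \<Rightarrow> 'a \<Rightarrow> 'a" where
  "braked \<theta> v k x = (1 - min 1 (real k * \<theta> x)) *\<^sub>R v x"

lemma brake_lipschitz:
  fixes \<theta> :: "'a::euclidean_space \<Rightarrow> real"
  assumes "L-lipschitz_on UNIV \<theta>"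
  shows "(real k * L)-lipschitz_on UNIV (\<lambda>x. 1 - min 1 (real k * \<theta> x))"
proof (rule lipschitz_onI)
  fix x y
  have "dist (\<theta> x) (\<theta> y) \<le> L * dist x y" by (rule lipschitz_onD[OF assms]) auto
  then have "real k * dist (\<theta> x) (\<theta> y) \<le> real k * (L * dist x y)" by (intro mult_left_mono) auto
  then have 1: "\<bar>real k * \<theta> x - real k * \<theta> y\<bar> \<le> real k * L * dist x y"
    by (simp add: dist_norm abs_mult mult.assoc flip: right_diff_distrib)
  have "\<bar>min 1 a - min 1 b\<bar> \<le> \<bar>a - b\<bar>" for a b :: real by (auto simp: min_def)
  then show "dist (1 - min 1 (real k * \<theta> x)) (1 - min 1 (real k * \<theta> y)) \<le> real k * L * dist x y"
    using 1 order_trans unfolding dist_norm by fastforce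
qed (use lipschitz_on_nonneg[OF assms] in simp)

text \<open>The braked trajectory is the original one run with a slower clock \<open>\<tau>\<close>. The clock is undisturbed
  until the first entrance \<open>t0\<close> into the brake region, and for large \<open>k\<close> it cannot pass a time
  just after \<open>t0\<close>; no control of what happens later on the orbit is needed.\<close>

lemma braked_flow_eventually:
  fixes v :: "'a::euclidean_space \<Rightarrow> 'a" and \<theta> :: "'a \<Rightarrow> real"
  assumes v: "bounded_lipschitz v" and \<theta>: "L-lipschitz_on UNIV \<theta>" "\<And>x. 0 \<le> \<theta> x"
    and hit: "0 \<le> t" "t \<le> T" "0 < \<theta> (flow v t x)"
    and N: "open N" "closure {y. 0 < \<theta> y} \<subseteq> N"
  shows "\<forall>\<^sub>F k in sequentially. flow (braked \<theta> v k) T x \<in> N"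
proof -
  define A where "A = {s. 0 \<le> s \<and> 0 < \<theta> (flow v s x)}"
  define t0 where "t0 = Inf A"
  have A: "t \<in> A" "bdd_below A" using hit unfolding A_def by (auto intro: bdd_belowI[of _ 0])
  have t0: "0 \<le> t0" "t0 \<le> T"
    using A hit cInf_lower[of t A] unfolding t0_def by (auto intro!: cInf_greatest simp: A_def)
  \<comment> \<open>The infimum \<open>t0\<close> need not belong to \<open>A\<close>, but times of
    \<open>A\<close> occur arbitrarily soon after it.\<close>
  have near: "\<exists>s\<in>A. t0 \<le> s \<and> s < t0 + \<delta>" if "\<delta> > 0" for \<delta>
    using cInf_lessD[of A "t0 + \<delta>"] cInf_lower[OF _ A(2)] A(1) that unfolding t0_def by force
  have cont: "isCont (\<lambda>s. flow v s x) t0"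
    using flow_continuous[OF v, of UNIV] by (simp add: continuous_on_eq_continuous_at)
  have near_flow: "\<exists>s\<in>A. t0 \<le> s \<and> (\<forall>r. t0 \<le> r \<longrightarrow> r \<le> s \<longrightarrow> flow v r x \<in> S)"
    if S: "open S" "flow v t0 x \<in> S" for S
  proof -
    have "\<forall>\<^sub>F s in nhds t0. flow v s x \<in> S"
      using cont S unfolding isCont_def tendsto_at_iff_tendsto_nhds[of "\<lambda>s. flow v s x" t0]
      by (rule topological_tendstoD)
    then obtain \<delta> where "\<delta> > 0" "\<And>s. dist s t0 < \<delta> \<Longrightarrow> flow v s x \<in> S"
      unfolding eventually_nhds_metric by blast
    then show ?thesis using near[of \<delta>] by (force simp: dist_real_def)
  qed
  have "flow v t0 x \<in> closure {y. 0 < \<theta> y}"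
    unfolding closure_iff_nhds_not_empty
  proof (intro allI impI)
    fix S S' assume S: "S' \<subseteq> S" "open S'" "flow v t0 x \<in> S'"
    obtain s where "s \<in> A" "t0 \<le> s" "\<forall>r. t0 \<le> r \<longrightarrow> r \<le> s \<longrightarrow> flow v r x \<in> S'"
      using near_flow[OF S(2,3)] by blast
    then have "flow v s x \<in> {y. 0 < \<theta> y} \<inter> S" using S(1) by (auto simp: A_def)
    then show "{y. 0 < \<theta> y} \<inter> S \<noteq> {}" by blast
  qed
  \<comment> \<open>The orbit point at time \<open>t0\<close> is in the closure, hence in
    \<open>N\<close>; \<open>s\<close> is a time of \<open>A\<close> so close to \<open>t0\<close>
    that the whole arc between them stays in \<open>N\<close>.\<close>
  then obtain s where s: "s \<in> A" "t0 \<le> s" "\<And>r. t0 \<le> r \<Longrightarrow> r \<le> s \<Longrightarrow> flow v r x \<in> N"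
    using near_flow[of N] N by blast
  have \<theta>s: "0 < \<theta> (flow v s x)" using s(1) unfolding A_def by simp
  \<comment> \<open>From \<open>k0\<close> on the brake is fully applied at the orbit point of time
    \<open>s\<close>, so \<open>s\<close> is an equilibrium of the clock.\<close>
  obtain k0 :: nat where k0: "1 / \<theta> (flow v s x) \<le> k0" using real_arch_simple by blast
  have "flow (braked \<theta> v k) T x \<in> N" if "k \<ge> k0" for k
  proof -
    define \<phi> where "\<phi> y = 1 - min 1 (real k * \<theta> y)" for y
    have \<phi>: "(real k * L)-lipschitz_on UNIV \<phi>" "0 \<le> \<phi> y" "\<bar>\<phi> y\<bar> \<le> 1" for y
      using brake_lipschitz[OF \<theta>(1), of k] \<theta>(2)[of y] unfolding \<phi>_def by (auto simp: min_def)
    have f: "bounded_lipschitz (\<lambda>\<tau>. \<phi> (flow v \<tau> x))"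
      by (rule bounded_lipschitz_along_flow[OF \<phi>(1,3) v])
    let ?\<tau> = "flow (\<lambda>\<tau>. \<phi> (flow v \<tau> x)) T 0"
    have b: "braked \<theta> v k = (\<lambda>x. \<phi> x *\<^sub>R v x)" by (auto simp: braked_def \<phi>_def)
    have eq: "flow (braked \<theta> v k) T x = flow v ?\<tau> x"
      unfolding b by (rule flow_reparametrized[OF v bounded_lipschitz_scale[OF \<phi>(1,3) v] f])
    have "1 / \<theta> (flow v s x) \<le> k" using k0 that by linarith
    then have "\<phi> (flow v s x) = 0" using \<theta>s by (simp add: \<phi>_def field_simps)
    then have "?\<tau> \<le> s"
      by (intro scalar_flow_le_zero[OF f]) (use s t0 in auto)
    moreover have "t0 \<le> ?\<tau>"
    proof (rule scalar_flow_ge[OF f \<phi>(2)])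
      fix r assume r: "0 \<le> r" "r < t0"
      then have "r \<notin> A" using cInf_lower[OF _ A(2), of r] unfolding t0_def by auto
      then have "\<theta> (flow v r x) = 0" using r(1) \<theta>(2)[of "flow v r x"] unfolding A_def by auto
      then show "\<phi> (flow v r x) = 1" by (simp add: \<phi>_def)
    qed (use t0 in auto)
    ultimately show ?thesis using s(3) eq by simp
  qed
  then show ?thesis unfolding eventually_sequentially by blast
qed

text \<open>Being in \<omega> at a given time is an open condition on the initial point, by
  continuity of the flow, so finitely many balls around hitting points serve all of
  \<open>K\<close>. Their closed versions lie in \<omega>, which leaves room between
  \<open>U\<close> and the complement of \<omega>.\<close>

lemma uniform_hitting_time:
  fixes v :: "'a::euclidean_space \<Rightarrow> 'a"
  assumes v: "bounded_lipschitz v" and "open \<omega>" "compact K"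
    and hit: "\<forall>x\<in>K. \<exists>t>0. flow v t x \<in> \<omega>"
  shows "\<exists>T>0. \<exists>U. open U \<and> bounded U \<and> closure U \<subseteq> \<omega> \<and> (\<forall>x\<in>K. \<exists>t. 0 \<le> t \<and> t \<le> T \<and> flow v t x \<in> U)"
proof -
  obtain t where t: "\<And>x. x \<in> K \<Longrightarrow> t x > 0 \<and> flow v (t x) x \<in> \<omega>" using hit by metis
  have "\<exists>r>0. cball (flow v (t x) x) r \<subseteq> \<omega>" if "x \<in> K" for x
    using t[OF that] \<open>open \<omega>\<close> open_contains_cball by blast
  then obtain r where r: "\<And>x. x \<in> K \<Longrightarrow> r x > 0 \<and> cball (flow v (t x) x) (r x) \<subseteq> \<omega>" by metis
  define U where "U x = flow v (t x) -` ball (flow v (t x) x) (r x)" for x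
  have cf: "continuous_on UNIV (flow v s)" for s
    using flow_lipschitz[OF v] lipschitz_on_continuous_on by blast
  have "open (U x)" for x
    unfolding U_def by (rule open_vimage[OF open_ball]) (use cf[of "t x"] in simp)
  moreover have "K \<subseteq> (\<Union>x\<in>K. U x)" using r by (auto simp: U_def)
  ultimately obtain C where C: "C \<subseteq> K" "finite C" "K \<subseteq> (\<Union>x\<in>C. U x)"
    using compactE_image[OF \<open>compact K\<close>, of K U] by blast
  define O1 where "O1 = (\<Union>x\<in>C. ball (flow v (t x) x) (r x))"
  \<comment> \<open>The summand 1 keeps the final time bound positive even when the finite cover is
    empty.\<close>
  have T: "t x \<le> 1 + sum t C" if "x \<in> C" for x
    using member_le_sum[of x C t] that C t by (force intro: less_imp_le)
  have tn: "0 \<le> sum t C" using t C by (intro sum_nonneg) (auto intro: less_imp_le)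
  have cl: "closure O1 \<subseteq> (\<Union>x\<in>C. cball (flow v (t x) x) (r x))"
    unfolding O1_def using C(2) by (intro closure_minimal UN_mono closed_UN) auto
  have "\<exists>s. 0 \<le> s \<and> s \<le> 1 + sum t C \<and> flow v s x \<in> O1" if "x \<in> K" for x
  proof -
    obtain y where y: "y \<in> C" "x \<in> U y" using C(3) \<open>x \<in> K\<close> by blast
    then show ?thesis
      using T[OF y(1)] t[of y] C(1) by (intro exI[of _ "t y"]) (auto simp: U_def O1_def)
  qed
  moreover have "open O1" "bounded O1" using C(2) by (auto simp: O1_def)
  moreover have "closure O1 \<subseteq> \<omega>" using cl r C(1) by blast
  ultimately show ?thesis using tn by (intro exI[of _ "1 + sum t C"] conjI exI[of _ O1]) auto
qed

text \<open>Each point off the support lies in a null basic open set, and a countable basis has only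
  countably many of these.\<close>

lemma null_outside_measure_support:
  fixes \<mu> :: "'a::second_countable_topology measure"
  assumes s: "sets \<mu> = sets borel"
  shows "AE x in \<mu>. x \<in> measure_support \<mu>"
proof -
  obtain B :: "'a set set" where B: "countable B" "topological_basis B"
    using ex_countable_basis by blast
  have bm: "b \<in> sets \<mu>" if "b \<in> B" for b
    using that B(2) topological_basis_open s by (metis borel_open)
  have "(\<Union>b\<in>{b\<in>B. emeasure \<mu> b = 0}. b) \<in> null_sets \<mu>"
    by (rule null_sets_UN') (use B(1) bm in \<open>auto intro!: null_setsI\<close>)
  moreover have "x \<in> (\<Union>b\<in>{b\<in>B. emeasure \<mu> b = 0}. b)" if x: "x \<notin> measure_support \<mu>" for x
  proof -
    obtain U where U: "open U" "x \<in> U" "emeasure \<mu> U = 0"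
      using x unfolding measure_support_def by (auto simp: not_gr_zero)
    obtain b where b: "b \<in> B" "x \<in> b" "b \<subseteq> U" using topological_basisE[OF B(2) U(1,2)] by blast
    have "emeasure \<mu> b \<le> emeasure \<mu> U" using b U s by (intro emeasure_mono) auto
    then show ?thesis using b U by auto
  qed
  ultimately show ?thesis
    by (intro AE_I'[of "(\<Union>b\<in>{b\<in>B. emeasure \<mu> b = 0}. b)"]) auto
qed

text \<open>Dominated convergence for indicators: it is enough that membership stabilizes at almost
  every point. This one criterion yields the effect of braking, the effect of attraction and the
  continuity of masses in time.\<close>

lemma measure_tendsto_AE:
  assumes "finite_measure M" and A: "\<And>n::nat. A n \<in> sets M" and B: "B \<in> sets M"
    and ae: "AE x in M. \<forall>\<^sub>F n in sequentially. x \<in> A n \<longleftrightarrow> x \<in> B"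
  shows "(\<lambda>n. measure M (A n)) \<longlonglongrightarrow> measure M B"
proof -
  interpret finite_measure M by fact
  have "(\<lambda>n. \<integral>x. indicat_real (A n) x \<partial>M) \<longlonglongrightarrow> (\<integral>x. indicat_real B x \<partial>M)"
  proof (rule integral_dominated_convergence[where w = "\<lambda>_. 1"])
    show "AE x in M. (\<lambda>n. indicat_real (A n) x) \<longlonglongrightarrow> indicat_real B x"
      using ae
    proof eventually_elim
      fix x assume "\<forall>\<^sub>F n in sequentially. x \<in> A n \<longleftrightarrow> x \<in> B"
      then have "\<forall>\<^sub>F n in sequentially. indicat_real (A n) x = indicat_real B x"
        by eventually_elim (simp add: indicator_def)
      then show "(\<lambda>n. indicat_real (A n) x) \<longlonglongrightarrow> indicat_real B x"
        by (rule tendsto_eventually)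
    qed
  qed (use A B in \<open>auto intro!: AE_I2 simp: indicator_def\<close>)
  then show ?thesis using A B by simp
qed

text \<open>\<open>T\<close> and \<open>C\<close> depend on the data only and are quantified before
  the accuracy \<delta>, which affects just the strength \<open>k\<close> of the brake. Every
  \<open>R\<close> is allowed because braking keeps the field within any bound on
  \<open>v\<close>.\<close>

lemma steer_support_into:
  fixes v :: "'a::euclidean_space \<Rightarrow> 'a"
  assumes v: "bounded_lipschitz v" and "open \<omega>" and \<mu>: "ac_compact_prob \<mu>"
    and hit: "\<forall>x\<in>measure_support \<mu>. \<exists>t>0. flow v t x \<in> \<omega>"
  shows "\<exists>T>0. \<exists>C. compact C \<and> C \<subseteq> \<omega> \<and>
    (\<forall>N R M \<delta>. open N \<longrightarrow> C \<subseteq> N \<longrightarrow> (\<forall>x. norm (v x) \<le> M) \<longrightarrow> 0 < \<delta> \<longrightarrow>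
       (\<exists>\<Psi>. steerable v \<omega> R M T \<Psi> \<and> measure \<mu> {x. \<Psi> x \<notin> N} < \<delta>))"
proof -
  have \<mu>': "sets \<mu> = sets borel" "prob_space \<mu>" "compact (measure_support \<mu>)"
    using \<mu> unfolding ac_compact_prob_def by auto
  interpret prob_space \<mu> by fact
  obtain T U where T: "T > 0" and U: "open U" "bounded U" "closure U \<subseteq> \<omega>"
    "\<And>x. x \<in> measure_support \<mu> \<Longrightarrow> \<exists>t. 0 \<le> t \<and> t \<le> T \<and> flow v t x \<in> U"
    using uniform_hitting_time[OF v \<open>open \<omega>\<close> \<mu>'(3) hit] by blast
  define \<theta> where "\<theta> x = infdist x (- U)" for x
  have \<theta>: "1-lipschitz_on UNIV \<theta>" "0 \<le> \<theta> x" for x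
    unfolding \<theta>_def using infdist_triangle_abs by (auto intro!: lipschitz_onI simp: dist_real_def infdist_nonneg)
  \<comment> \<open>A bounded \<open>U\<close> has nonempty complement; \<open>infdist\<close> to
    the empty set is 0, which would make \<theta> vanish on \<open>U\<close>.\<close>
  have "U \<noteq> UNIV" using U(2) not_bounded_UNIV by metis
  then have "- U \<noteq> {}" by auto
  then have pos: "0 < \<theta> x \<longleftrightarrow> x \<in> U" for x
    using in_closed_iff_infdist_zero[of "- U" x] U(1) infdist_nonneg[of x "- U"]
    unfolding \<theta>_def by (auto simp: closed_def less_le)
  have field: "steering_field v \<omega> R M (braked \<theta> v k)" if M: "\<And>x. norm (v x) \<le> M" for R M k
    unfolding steering_field_def
  proof (intro conjI allI impI)
    have b: "\<bar>1 - min 1 (real k * \<theta> x)\<bar> \<le> 1" for x using \<theta>(2)[of x] by (auto simp: min_def)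
    then show "bounded_lipschitz (braked \<theta> v k)"
      unfolding braked_def[abs_def] by (intro bounded_lipschitz_scale[OF brake_lipschitz[OF \<theta>(1)] _ v])
    show "norm (braked \<theta> v k x) \<le> M" for x
      using mult_mono[OF b[of x] M[of x]] by (simp add: braked_def)
    fix x assume "x \<notin> \<omega>"
    then have "x \<notin> U" using U(3) closure_subset by blast
    then have "\<theta> x = 0" using pos[of x] \<theta>(2)[of x] by auto
    then show "braked \<theta> v k x = v x" by (simp add: braked_def)
  qed
  have "\<exists>\<Psi>. steerable v \<omega> R M T \<Psi> \<and> measure \<mu> {x. \<Psi> x \<notin> N} < \<delta>"
    if N: "open N" "closure U \<subseteq> N" and M: "\<And>x. norm (v x) \<le> M" and "0 < \<delta>" for N R M \<delta>
  proof -
    have bl: "bounded_lipschitz (braked \<theta> v k)" for k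
      using field[OF M] unfolding steering_field_def by blast
    have "continuous_on UNIV (flow (braked \<theta> v k) T)" for k
      using flow_lipschitz[OF bl] lipschitz_on_continuous_on by blast
    then have "flow (braked \<theta> v k) T \<in> borel_measurable borel" for k
      by (rule borel_measurable_continuous_onI)
    then have ms: "{x. flow (braked \<theta> v k) T x \<notin> N} \<in> sets \<mu>" for k
      unfolding \<mu>'(1) using measurable_sets_borel[of "flow (braked \<theta> v k) T" borel "- N"] N(1)
      by (simp add: vimage_def)
    have "(\<lambda>k. measure \<mu> {x. flow (braked \<theta> v k) T x \<notin> N}) \<longlonglongrightarrow> measure \<mu> {}"
    proof (rule measure_tendsto_AE[OF finite_measure_axioms ms])
      show "AE x in \<mu>. \<forall>\<^sub>F k in sequentially. x \<in> {x. flow (braked \<theta> v k) T x \<notin> N} \<longleftrightarrow> x \<in> {}"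
        using null_outside_measure_support[OF \<mu>'(1)]
      proof eventually_elim
        fix x assume "x \<in> measure_support \<mu>"
        then obtain t where t: "0 \<le> t" "t \<le> T" "flow v t x \<in> U" using U(4) by blast
        have "\<forall>\<^sub>F k in sequentially. flow (braked \<theta> v k) T x \<in> N"
          by (rule braked_flow_eventually[OF v \<theta> t(1,2) _ N(1)]) (use t pos N in auto)
        then show "\<forall>\<^sub>F k in sequentially. x \<in> {x. flow (braked \<theta> v k) T x \<notin> N} \<longleftrightarrow> x \<in> {}"
          by eventually_elim simp
      qed
    qed simp
    then have "\<forall>\<^sub>F k in sequentially. measure \<mu> {x. flow (braked \<theta> v k) T x \<notin> N} < \<delta>"
      using \<open>0 < \<delta>\<close> by (intro order_tendstoD) auto
    then obtain k where k: "measure \<mu> {x. flow (braked \<theta> v k) T x \<notin> N} < \<delta>"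
      using eventually_happens'[OF sequentially_bot] by blast
    then show ?thesis
      using steerable_flow[OF field[OF M], of T] T by (intro exI[of _ "flow (braked \<theta> v k) T"]) auto
  qed
  moreover have "compact (closure U)" using U(2) by (simp add: compact_closure)
  ultimately show ?thesis using T U(3) by (intro exI[of _ T] conjI exI[of _ "closure U"]) auto
qed

section \<open>Moving mass locally\<close>

text \<open>Points off \<open>U\<close> are equilibria, and running time backward shows that no
  point of \<open>U\<close> can arrive at one.\<close>

lemma flow_in_invariant:
  assumes g: "bounded_lipschitz g" and out: "\<And>x. x \<notin> U \<Longrightarrow> g x = 0"
  shows "flow g s x \<in> U \<longleftrightarrow> x \<in> U"
proof -
  have *: "y \<notin> U \<Longrightarrow> flow g r y = y" for r y
    using flow_fixed[OF g out] by blast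
  show ?thesis
    using *[of x s] *[of "flow g s x" "- s"] flow_inverse(1)[OF g, of s x] by metis
qed

text \<open>The attracting field is \<open>g x = \<phi> x (c - x)\<close> with \<open>\<phi>\<close> the distance to the complement of \<open>U\<close>;
  its trajectories stay on the segments \<open>c + \<rho> (x - c)\<close>, on which \<open>\<phi>\<close> is bounded below.\<close>

lemma attracting_field_lipschitz:
  fixes U :: "'a::euclidean_space set"
  assumes "open U" "bounded U" "c \<in> U"
  shows "bounded_lipschitz (\<lambda>x. infdist x (- U) *\<^sub>R (c - x))"
proof -
  define g where "g x = infdist x (- U) *\<^sub>R (c - x)" for x
  have "U \<noteq> UNIV" using \<open>bounded U\<close> not_bounded_UNIV by metis
  then obtain z where z: "z \<notin> U" by blast
  obtain r where r: "\<And>x. x \<in> U \<Longrightarrow> dist c x \<le> r"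
    using \<open>bounded U\<close> bounded_any_center[of U c] by auto
  define C where "C = r + dist c z"
  have C: "norm (c - x) \<le> C" "infdist x (- U) \<le> C" if "x \<in> U" for x
  proof -
    have "infdist x (- U) \<le> dist x z" using z by (intro infdist_le) auto
    then show "infdist x (- U) \<le> C"
      using r[OF that] dist_triangle[of x z c] unfolding C_def by (simp add: dist_commute)
    show "norm (c - x) \<le> C" using r[OF that] unfolding C_def dist_norm by (simp add: add_increasing2)
  qed
  have C0: "0 \<le> C" using C(1)[OF \<open>c \<in> U\<close>] by simp
  have out: "g x = 0" if "x \<notin> U" for x using that by (simp add: g_def)
  have bd: "norm (g x) \<le> C * C" for x
    using C[of x] C0 out[of x] infdist_nonneg[of x "- U"] by (cases "x \<in> U") (auto simp: g_def intro!: mult_mono)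
  \<comment> \<open>The factor \<open>c - x\<close> is bounded only on \<open>U\<close>, so one of
    the points is taken in \<open>U\<close>; if the other is outside, the distance factor at
    \<open>y\<close> is at most \<open>norm (x - y)\<close>.\<close>
  have *: "norm (g x - g y) \<le> 2 * C * norm (x - y)" if "y \<in> U" for x y
  proof (cases "x \<in> U")
    case True
    have "norm (g x - g y) = norm (infdist x (- U) *\<^sub>R (y - x) + (infdist x (- U) - infdist y (- U)) *\<^sub>R (c - y))"
      by (simp add: g_def algebra_simps)
    also have "\<dots> \<le> infdist x (- U) * norm (y - x) + \<bar>infdist x (- U) - infdist y (- U)\<bar> * norm (c - y)"
      using norm_triangle_ineq[of "infdist x (- U) *\<^sub>R (y - x)" "(infdist x (- U) - infdist y (- U)) *\<^sub>R (c - y)"]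
      by (simp add: infdist_nonneg)
    also have "\<dots> \<le> C * norm (x - y) + norm (x - y) * C"
      using C(2)[OF True] C(1)[OF \<open>y \<in> U\<close>] infdist_triangle_abs[of x "- U" y]
      by (intro add_mono mult_mono) (auto simp: norm_minus_commute dist_norm C0)
    finally show ?thesis by simp
  next
    case False
    have "norm (g x - g y) = norm (g y)" using out[OF False] by simp
    also have "\<dots> = infdist y (- U) * norm (c - y)" by (simp add: g_def infdist_nonneg)
    also have "\<dots> \<le> norm (x - y) * C"
    proof (rule mult_mono)
      show "infdist y (- U) \<le> norm (x - y)"
        using False infdist_le[of x "- U" y] by (simp add: dist_norm norm_minus_commute)
    qed (use C(1)[OF \<open>y \<in> U\<close>] in auto)
    also have "\<dots> \<le> 2 * C * norm (x - y)" using C0 by (simp add: mult.commute mult_left_mono)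
    finally show ?thesis .
  qed
  have "norm (g x - g y) \<le> 2 * C * norm (x - y)" for x y
    using *[of y x] *[of x y] out[of x] out[of y] C0 by (cases "y \<in> U"; cases "x \<in> U") (auto simp: norm_minus_commute)
  then have "(2 * C)-lipschitz_on UNIV g"
    using C0 by (intro lipschitz_onI) (auto simp: dist_norm)
  then show ?thesis using bd unfolding g_def by (rule bounded_lipschitzI)
qed

lemma attracting_field:
  fixes U :: "'a::euclidean_space set"
  assumes "open U" "bounded U" "convex U" "c \<in> U"
  shows "\<exists>g. bounded_lipschitz g \<and> (\<forall>x. x \<notin> U \<longrightarrow> g x = 0) \<and>
    (\<forall>x\<in>U. ((\<lambda>s. flow g s x) \<longlongrightarrow> c) at_top)"
proof (intro exI conjI ballI allI impI)
  define g where "g = (\<lambda>x. infdist x (- U) *\<^sub>R (c - x))"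
  show g: "bounded_lipschitz g" unfolding g_def by (rule attracting_field_lipschitz) fact+
  show "g x = 0" if "x \<notin> U" for x using that by (simp add: g_def)
  fix x assume "x \<in> U"
  show "((\<lambda>s. flow g s x) \<longlongrightarrow> c) at_top"
  proof (cases "x = c")
    case True
    then have "flow g s x = c" for s using flow_fixed[OF g, of c] by (simp add: g_def)
    then show ?thesis by simp
  next
    case False
    then have xc: "norm (x - c) > 0" by simp
    \<comment> \<open>On the line through \<open>c\<close> and \<open>x\<close> the equation reduces
      to the scalar one with right-hand side \<open>f\<close>.\<close>
    define p where "p \<rho> = c + \<rho> *\<^sub>R (x - c)" for \<rho>
    define f where "f \<rho> = - infdist (p \<rho>) (- U) * \<rho>" for \<rho>
    have gp: "g (p \<rho>) = f \<rho> *\<^sub>R (x - c)" for \<rho> by (simp add: g_def f_def p_def)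
    obtain L B where LB: "L > 0" "L-lipschitz_on UNIV g" "B > 0" "\<And>x. norm (g x) \<le> B"
      using bounded_lipschitzE[OF g] by metis
    have f: "bounded_lipschitz f"
    proof (rule bounded_lipschitzI[where L = L and B = "B / norm (x - c)"])
      show "norm (f \<rho>) \<le> B / norm (x - c)" for \<rho>
        using LB(4)[of "p \<rho>"] xc unfolding gp norm_scaleR by (simp add: pos_le_divide_eq)
      show "L-lipschitz_on UNIV f"
      proof (rule lipschitz_onI)
        fix a b :: real
        have "norm (g (p a) - g (p b)) \<le> L * norm (p a - p b)"
          using lipschitz_onD[OF LB(2), of "p a" "p b"] by (simp add: dist_norm)
        moreover have "p a - p b = (a - b) *\<^sub>R (x - c)"
          by (simp add: p_def scaleR_diff_left)
        moreover have "g (p a) - g (p b) = (f a - f b) *\<^sub>R (x - c)"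
          by (simp only: gp scaleR_diff_left)
        ultimately have "\<bar>f a - f b\<bar> * norm (x - c) \<le> (L * \<bar>a - b\<bar>) * norm (x - c)"
          by (metis mult.assoc norm_scaleR)
        then show "dist (f a) (f b) \<le> L * dist a b"
          using xc by (simp add: dist_real_def)
      qed (use LB in simp)
    qed
    let ?\<rho> = "\<lambda>s. flow f s 1"
    have d\<rho>: "(?\<rho> has_real_derivative f (?\<rho> s)) (at s)" for s
      using flow_has_derivative[OF f] by (simp add: has_real_derivative_iff_has_vector_derivative)
    have "trajectory g (\<lambda>s. p (?\<rho> s))"
      unfolding trajectory_def gp
    proof
      fix s
      have "((\<lambda>s. c + ?\<rho> s *\<^sub>R (x - c)) has_vector_derivative (0 + (?\<rho> s *\<^sub>R 0 + f (?\<rho> s) *\<^sub>R (x - c)))) (at s)"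
        by (intro has_vector_derivative_add has_vector_derivative_const has_vector_derivative_scaleR d\<rho>)
      then show "((\<lambda>s. p (?\<rho> s)) has_vector_derivative f (?\<rho> s) *\<^sub>R (x - c)) (at s)"
        by (simp add: p_def)
    qed
    then have flow_eq: "flow g s x = p (?\<rho> s)" for s
      by (rule flow_eqI[OF g]) (simp add: flow_0[OF f] p_def)
    have f0: "f 0 = 0" by (simp add: f_def)
    have nonneg: "0 \<le> ?\<rho> s" for s
    proof (rule ccontr)
      assume neg: "\<not> 0 \<le> ?\<rho> s"
      have "connected (range ?\<rho>)"
        by (rule connected_continuous_image[OF flow_continuous[OF f] connected_UNIV])
      then obtain r where r: "?\<rho> r = 0"
        using connectedD_interval[of "range ?\<rho>" "?\<rho> s" "?\<rho> 0" 0] neg flow_0[OF f, of 1] by auto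
      have "?\<rho> s = flow f (s - r) (?\<rho> r)" using flow_add[OF f, of "s - r" r 1] by simp
      then show False using r flow_fixed[OF f f0] neg by simp
    qed
    have le1: "?\<rho> s \<le> 1" if "0 \<le> s" for s
    proof -
      have "f (?\<rho> r) \<le> 0" for r
        using nonneg[of r] infdist_nonneg[of "p (?\<rho> r)" "- U"] unfolding f_def by simp
      then have "?\<rho> s \<le> ?\<rho> 0"
        using DERIV_nonpos_imp_nonincreasing[OF that] d\<rho> by blast
      then show ?thesis by (simp add: flow_0[OF f])
    qed
    have "compact (p ` {0..1})"
      unfolding p_def by (intro compact_continuous_image continuous_intros) auto
    moreover have pU: "p ` {0..1} \<subseteq> U"
    proof
      fix y assume "y \<in> p ` {0..1}"
      then obtain a where a: "0 \<le> a" "a \<le> 1" "y = p a" by auto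
      have "y = (1 - a) *\<^sub>R c + a *\<^sub>R x" by (simp add: a(3) p_def algebra_simps)
      then show "y \<in> U" using convexD[OF \<open>convex U\<close> \<open>c \<in> U\<close> \<open>x \<in> U\<close>, of "1 - a" a] a by simp
    qed
    moreover have "p ` {0..1} \<noteq> {}" by auto
    moreover have "continuous_on (p ` {0..1}) (\<lambda>y. infdist y (- U))"
      by (intro continuous_intros)
    ultimately obtain y where y: "y \<in> p ` {0..1}" "\<And>z. z \<in> p ` {0..1} \<Longrightarrow> infdist y (- U) \<le> infdist z (- U)"
      using continuous_attains_inf[of "p ` {0..1}" "\<lambda>y. infdist y (- U)"] by blast
    \<comment> \<open>The segment is compact and lies in \<open>U\<close> by convexity, so the
      distance to the complement has a positive minimum on it; this minimum is the rate of the
      exponential decay towards \<open>c\<close>.\<close>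
    define m where "m = infdist y (- U)"
    have "U \<noteq> UNIV" using \<open>bounded U\<close> not_bounded_UNIV by metis
    then have "m > 0"
      using in_closed_iff_infdist_zero[of "- U" y] \<open>open U\<close> y(1) pU infdist_nonneg[of y "- U"]
      unfolding m_def by (auto simp: closed_def less_le)
    have decay: "?\<rho> s \<le> exp (- m * s)" if "0 \<le> s" for s
    proof -
      have "exp (m * s) * ?\<rho> s \<le> exp (m * 0) * ?\<rho> 0"
      proof (rule DERIV_nonpos_imp_nonincreasing[OF that])
        fix r assume r: "0 \<le> r" "r \<le> s"
        have "((\<lambda>s. exp (m * s) * ?\<rho> s) has_real_derivative
            (m * exp (m * r)) * ?\<rho> r + f (?\<rho> r) * exp (m * r)) (at r)"
          by (rule DERIV_mult[OF _ d\<rho>]) (auto intro!: derivative_eq_intros)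
        moreover have "(m * exp (m * r)) * ?\<rho> r + f (?\<rho> r) * exp (m * r)
            = exp (m * r) * ?\<rho> r * (m - infdist (p (?\<rho> r)) (- U))"
          unfolding f_def by (simp add: algebra_simps)
        moreover have "m \<le> infdist (p (?\<rho> r)) (- U)"
          unfolding m_def using nonneg[of r] le1[OF r(1)] by (intro y(2)) auto
        then have "exp (m * r) * ?\<rho> r * (m - infdist (p (?\<rho> r)) (- U)) \<le> 0"
          using nonneg[of r] by (intro mult_nonneg_nonpos) auto
        ultimately show "\<exists>y. ((\<lambda>s. exp (m * s) * ?\<rho> s) has_real_derivative y) (at r) \<and> y \<le> 0"
          by (intro exI conjI) auto
      qed
      then show ?thesis by (simp add: flow_0[OF f] exp_minus field_simps)
    qed
    have e: "((\<lambda>s. exp (- m * s)) \<longlongrightarrow> 0) at_top"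
    proof -
      have "filterlim (\<lambda>s. m * s) at_top at_top"
        by (rule filterlim_tendsto_pos_mult_at_top[OF tendsto_const \<open>m > 0\<close> filterlim_ident])
      then show ?thesis
        by (intro filterlim_compose[OF exp_at_bot]) (simp add: filterlim_uminus_at_bot)
    qed
    have "(?\<rho> \<longlongrightarrow> 0) at_top"
    proof (rule tendsto_sandwich[OF _ _ tendsto_const e])
      show "\<forall>\<^sub>F s in at_top. 0 \<le> ?\<rho> s" using nonneg by simp
      show "\<forall>\<^sub>F s in at_top. ?\<rho> s \<le> exp (- m * s)"
        using eventually_ge_at_top[of 0] by eventually_elim (rule decay)
    qed
    then have "((\<lambda>s. c + ?\<rho> s *\<^sub>R (x - c)) \<longlongrightarrow> c + 0 *\<^sub>R (x - c)) at_top"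
      by (intro tendsto_intros)
    then show ?thesis unfolding flow_eq p_def by simp
  qed
qed

section \<open>Absolute continuity under bi-Lipschitz maps\<close>

definition finite_ac :: "'a::euclidean_space measure \<Rightarrow> bool" where
  "finite_ac \<alpha> \<longleftrightarrow> finite_measure \<alpha> \<and> sets \<alpha> = sets borel \<and> absolutely_continuous lborel \<alpha>"

lemma lipschitz_borel:
  "K-lipschitz_on UNIV \<Psi> \<Longrightarrow> \<Psi> \<in> borel_measurable borel"
  by (rule borel_measurable_continuous_onI) (rule lipschitz_on_continuous_on)

text \<open>The preimage of a null set under \<Psi> is contained in its image under the inverse
  \<Xi>, and Lipschitz maps send null sets to null sets.\<close>

lemma finite_ac_distr:
  fixes \<alpha> :: "'a::euclidean_space measure" and \<Psi> \<Xi> :: "'a \<Rightarrow> 'a"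
  assumes \<alpha>: "finite_ac \<alpha>"
    and \<Psi>: "K-lipschitz_on UNIV \<Psi>" and \<Xi>: "K-lipschitz_on UNIV \<Xi>" "\<And>x. \<Xi> (\<Psi> x) = x"
  shows "finite_ac (distr \<alpha> borel \<Psi>)"
proof -
  interpret finite_measure \<alpha> using \<alpha> unfolding finite_ac_def by blast
  have s: "sets \<alpha> = sets borel" using \<alpha> unfolding finite_ac_def by blast
  have m: "\<Psi> \<in> measurable \<alpha> borel"
    using lipschitz_borel[OF \<Psi>] s by (simp cong: measurable_cong_sets)
  have "A \<in> null_sets (distr \<alpha> borel \<Psi>)" if A: "A \<in> null_sets lborel" for A
  proof -
    have neg: "negligible A" using A unfolding negligible_iff_null_sets
      by (simp add: null_sets_completionI)
    have "negligible (\<Xi> ` A)"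
    proof (rule negligible_locally_Lipschitz_image[OF _ neg])
      show "\<exists>T B. open T \<and> x \<in> T \<and> (\<forall>y\<in>A \<inter> T. norm (\<Xi> y - \<Xi> x) \<le> B * norm (y - x))" for x
        using lipschitz_onD[OF \<Xi>(1), of _ x]
        by (intro exI[of _ UNIV] exI[of _ K]) (auto simp: dist_norm)
    qed simp
    moreover have "\<Psi> -` A \<subseteq> \<Xi> ` A"
    proof
      fix x assume "x \<in> \<Psi> -` A"
      then have "\<Xi> (\<Psi> x) \<in> \<Xi> ` A" by (intro imageI) simp
      then show "x \<in> \<Xi> ` A" using \<Xi>(2)[of x] by simp
    qed
    ultimately have "negligible (\<Psi> -` A)" by (rule negligible_subset)
    have Ab: "A \<in> sets borel" using A by (simp add: null_sets_def)
    have bm: "\<Psi> -` A \<in> sets borel"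
      by (rule measurable_sets_borel[OF lipschitz_borel[OF \<Psi>] Ab])
    have "\<Psi> -` A \<in> null_sets lborel"
      using \<open>negligible (\<Psi> -` A)\<close> bm null_sets_completion_iff[of "\<Psi> -` A" lborel]
      unfolding negligible_iff_null_sets by simp
    then have "\<Psi> -` A \<in> null_sets \<alpha>"
      using \<alpha> unfolding finite_ac_def absolutely_continuous_def by blast
    moreover have "space \<alpha> = UNIV" using sets_eq_imp_space_eq[OF s] by simp
    ultimately show ?thesis
      using Ab by (simp add: null_sets_def emeasure_distr[OF m])
  qed
  then show ?thesis
    unfolding finite_ac_def absolutely_continuous_def
    using finite_measure_distr[OF m] by auto
qed

locale steering =
  fixes v :: "'a::euclidean_space \<Rightarrow> 'a" and \<omega> :: "'a set" and R M :: real and D :: "'a set"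
  assumes v: "bounded_lipschitz v" and M: "\<And>x. norm (v x) \<le> M"
    and open_\<omega>: "open \<omega>" and compact_D: "compact D" and D_sub: "D \<subseteq> \<omega>" and D_ne: "D \<noteq> {}"
    and D_ball: "D \<subseteq> ball 0 R"
begin

text \<open>Nothing is said about points outside \<open>D\<close>: the drift still acts there, and
  between \<open>D\<close> and the complement of \<omega> it is only partly cancelled.\<close>

definition local_steering :: "'a set \<Rightarrow> real \<Rightarrow> ('a \<Rightarrow> 'a) \<Rightarrow> bool" where
  "local_steering U t \<Psi> \<longleftrightarrow> steerable v \<omega> R M t \<Psi> \<and> \<Psi> ` U = U \<and> (\<forall>x\<in>D - U. \<Psi> x = x)"

lemma steerable_inj: "steerable v \<omega> R M t \<Psi> \<Longrightarrow> inj \<Psi>"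
  using steerable_bilipschitz[of v \<omega> R M t \<Psi>] by (metis injI)

text \<open>Points off \<open>D\<close> move in an unspecified way, but injectivity keeps them out:
  every point of \<open>U\<close> and of \<open>D - U\<close> is already the image of a point of the
  same set.\<close>

lemma local_steering_in:
  assumes "local_steering U t \<Psi>" "U \<subseteq> D" "C \<subseteq> D"
  shows "C \<subseteq> U \<Longrightarrow> \<Psi> x \<in> C \<Longrightarrow> x \<in> U" "C \<inter> U = {} \<Longrightarrow> \<Psi> x \<in> C \<longleftrightarrow> x \<in> C"
proof -
  have *: "inj \<Psi>" "\<Psi> ` U = U" "\<And>x. x \<in> D - U \<Longrightarrow> \<Psi> x = x"
    using assms(1) steerable_inj unfolding local_steering_def by auto
  show "x \<in> U" if "C \<subseteq> U" "\<Psi> x \<in> C"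
    using that *(1,2) by (metis inj_image_mem_iff subsetD)
  show "\<Psi> x \<in> C \<longleftrightarrow> x \<in> C" if "C \<inter> U = {}"
  proof
    assume "\<Psi> x \<in> C"
    then have "\<Psi> (\<Psi> x) = \<Psi> x" using that assms(3) by (intro *(3)) auto
    then show "x \<in> C" using *(1) \<open>\<Psi> x \<in> C\<close> by (metis injD)
  next
    assume "x \<in> C"
    then have "\<Psi> x = x" using that assms(3) by (intro *(3)) auto
    then show "\<Psi> x \<in> C" using \<open>x \<in> C\<close> by simp
  qed
qed

lemma local_steering_compose:
  assumes "local_steering U' s \<Xi>" "local_steering U t \<Psi>" "U' \<subseteq> U" "U \<subseteq> D"
  shows "local_steering U (t + s) (\<lambda>x. \<Xi> (\<Psi> x))"
proof -
  have a: "steerable v \<omega> R M s \<Xi>" "\<Xi> ` U' = U'" "\<And>x. x \<in> D - U' \<Longrightarrow> \<Xi> x = x"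
    and b: "steerable v \<omega> R M t \<Psi>" "\<Psi> ` U = U" "\<And>x. x \<in> D - U \<Longrightarrow> \<Psi> x = x"
    using assms(1,2) unfolding local_steering_def by auto
  have "U = U' \<union> (U - U')" using assms(3) by blast
  moreover have "\<Xi> ` (U - U') = (\<lambda>x. x) ` (U - U')"
    by (rule image_cong) (use a(3) assms(4) in auto)
  ultimately have "\<Xi> ` U = U" using a(2) by (metis image_Un image_ident)
  then have "(\<lambda>x. \<Xi> (\<Psi> x)) ` U = U" using b(2) by (metis image_image)
  moreover have "\<Xi> (\<Psi> x) = x" if "x \<in> D - U" for x
  proof -
    have "x \<in> D - U'" using that assms(3) by blast
    then show ?thesis using a(3) b(3)[OF that] by simp
  qed
  ultimately show ?thesis
    unfolding local_steering_def using steerable_compose[OF a(1) b(1)] by blast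
qed

text \<open>On \<open>D\<close> the control cancels the drift, so there any field vanishing off \<open>U\<close> can be run,
  and at any speed.\<close>

lemma local_flow:
  assumes g: "bounded_lipschitz g" and out: "\<And>x. x \<notin> U \<Longrightarrow> g x = 0" and U: "U \<subseteq> D"
    and "0 \<le> \<sigma>" "0 < t"
  shows "\<exists>\<Psi>. local_steering U t \<Psi> \<and> (\<forall>x\<in>D. \<Psi> x = flow g \<sigma> x)"
proof -
  have "closed (- \<omega>)" "D \<inter> - \<omega> = {}" using open_\<omega> D_sub by (auto simp: closed_def)
  from separate_compact_closed[OF compact_D this]
  obtain d where d: "d > 0" and d': "\<forall>x\<in>D. \<forall>y\<in>- \<omega>. d \<le> dist x y" by (elim exE conjE)
  \<comment> \<open>A cutoff equal to 1 on \<open>D\<close> and to 0 off \<omega>; \<open>d\<close>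
    bounds the distance between \<open>D\<close> and the complement of \<omega> from below.\<close>
  define \<theta> where "\<theta> x = max 0 (1 - infdist x D / d)" for x
  have \<theta>D: "\<theta> x = 1" if "x \<in> D" for x using that by (simp add: \<theta>_def)
  have \<theta>\<omega>: "\<theta> x = 0" if "x \<notin> \<omega>" for x
  proof -
    have "d \<le> infdist x D"
      unfolding infdist_notempty[OF D_ne]
      by (rule cINF_greatest[OF D_ne]) (use d' that in \<open>simp add: dist_commute\<close>)
    then show ?thesis using d by (simp add: \<theta>_def max_def field_simps)
  qed
  have \<theta>01: "\<bar>1 - \<theta> x\<bar> \<le> 1" "0 \<le> 1 - \<theta> x" for x
    using infdist_nonneg[of x D] d by (auto simp: \<theta>_def max_def field_simps)
  have "(1 / d)-lipschitz_on UNIV (\<lambda>x. 1 - \<theta> x)"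
  proof (rule lipschitz_onI)
    fix x y
    have 1: "\<bar>infdist x D / d - infdist y D / d\<bar> \<le> 1 / d * dist x y"
      using infdist_triangle_abs[of x D y] d by (simp add: field_simps flip: diff_divide_distrib)
    have "\<bar>(1 - max 0 (1 - a)) - (1 - max 0 (1 - b))\<bar> \<le> \<bar>a - b\<bar>" for a b :: real
      by (auto simp: max_def)
    from order_trans[OF this 1]
    show "dist (1 - \<theta> x) (1 - \<theta> y) \<le> 1 / d * dist x y"
      unfolding \<theta>_def dist_real_def .
  qed (use d in simp)
  from bounded_lipschitz_scale[OF this \<theta>01(1) v]
  have bl1: "bounded_lipschitz (\<lambda>x. (1 - \<theta> x) *\<^sub>R v x)" .
  have "0-lipschitz_on UNIV (\<lambda>x::'a. \<sigma> / t)" by (rule lipschitz_on_constant)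
  from bounded_lipschitz_scale[OF this _ g, of "\<bar>\<sigma> / t\<bar>"]
  have bl2: "bounded_lipschitz (\<lambda>x. (\<sigma> / t) *\<^sub>R g x)" by simp
  \<comment> \<open>The factor \<open>\<sigma> / t\<close> fits the motion of \<open>g\<close>
    during \<sigma> into the available time \<open>t\<close>.\<close>
  define G where "G x = (1 - \<theta> x) *\<^sub>R v x + (\<sigma> / t) *\<^sub>R g x" for x
  have bl: "bounded_lipschitz G"
  proof -
    obtain L1 B1 where 1: "L1-lipschitz_on UNIV (\<lambda>x. (1 - \<theta> x) *\<^sub>R v x)" "\<And>x. norm ((1 - \<theta> x) *\<^sub>R v x) \<le> B1"
      using bounded_lipschitzE[OF bl1] by metis
    obtain L2 B2 where 2: "L2-lipschitz_on UNIV (\<lambda>x. (\<sigma> / t) *\<^sub>R g x)" "\<And>x. norm ((\<sigma> / t) *\<^sub>R g x) \<le> B2"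
      using bounded_lipschitzE[OF bl2] by metis
    have "(L1 + L2)-lipschitz_on UNIV G" unfolding G_def by (rule lipschitz_on_add[OF 1(1) 2(1)])
    moreover have "norm (G x) \<le> B1 + B2" for x unfolding G_def by (rule norm_triangle_mono[OF 1(2) 2(2)])
    ultimately show ?thesis by (rule bounded_lipschitzI)
  qed
  have sf: "steering_field v \<omega> R M G"
    unfolding steering_field_def
  proof (intro conjI allI impI bl)
    show "G x = v x" if "x \<notin> \<omega>" for x
      using that \<theta>\<omega> out[of x] U D_sub by (auto simp: G_def)
    fix x :: 'a assume "R \<le> norm x"
    then have "x \<notin> D" using D_ball by auto
    then have "g x = 0" using out U by blast
    then show "norm (G x) \<le> M"
      using mult_mono[OF \<theta>01(1)[of x] M[of x]] by (simp add: G_def)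
  qed
  have eq: "flow G t x = flow g \<sigma> x" if "x \<in> D" for x
  proof -
    \<comment> \<open>Trajectories of \<open>g\<close> issued from \<open>D\<close> stay in
      \<open>D\<close>, where the drift is fully cancelled, so after rescaling time they solve the
      equation for \<open>G\<close>.\<close>
    have inD: "flow g r x \<in> D" for r
    proof (cases "x \<in> U")
      case True
      then show ?thesis using flow_in_invariant[OF g out, of U r x] U by auto
    next
      case False
      then show ?thesis using flow_fixed[OF g out, of x r] \<open>x \<in> D\<close> by simp
    qed
    have "trajectory G (\<lambda>s. flow g (\<sigma> / t * s) x)"
      unfolding trajectory_def
    proof
      fix s
      have "((\<lambda>r. flow g r x) \<circ> (\<lambda>s. \<sigma> / t * s) has_vector_derivative (\<sigma> / t) *\<^sub>R g (flow g (\<sigma> / t * s) x)) (at s)"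
        by (rule vector_diff_chain_at) (use \<open>0 < t\<close> in \<open>auto intro!: derivative_eq_intros flow_has_derivative[OF g]
          simp flip: has_real_derivative_iff_has_vector_derivative\<close>)
      then show "((\<lambda>s. flow g (\<sigma> / t * s) x) has_vector_derivative G (flow g (\<sigma> / t * s) x)) (at s)"
        using \<theta>D[OF inD] by (simp add: o_def G_def)
    qed
    from flow_eqI[OF bl this, of x t] show ?thesis using \<open>0 < t\<close> by (simp add: flow_0[OF g])
  qed
  have fix': "flow G t x = x" if "x \<in> D - U" for x
    using eq[of x] flow_fixed[OF g out, of x \<sigma>] that by auto
  have "flow G t ` U = flow g \<sigma> ` U"
    using eq U by (intro image_cong) auto
  also have "\<dots> = U"
  proof
    show "flow g \<sigma> ` U \<subseteq> U" using flow_in_invariant[OF g out] by blast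
    show "U \<subseteq> flow g \<sigma> ` U"
    proof
      fix x assume "x \<in> U"
      then have "flow g (- \<sigma>) x \<in> U" using flow_in_invariant[OF g out] by blast
      then show "x \<in> flow g \<sigma> ` U" using flow_inverse(2)[OF g, of \<sigma> x] by (metis image_eqI)
    qed
  qed
  finally show ?thesis
    using steerable_flow[OF sf, of t] eq fix' \<open>0 < t\<close> unfolding local_steering_def
    by (intro exI[of _ "flow G t"]) auto
qed

end

section \<open>Dependence of transported mass on time\<close>

lemma finite_acD:
  assumes "finite_ac \<alpha>"
  shows "finite_measure \<alpha>" "sets \<alpha> = sets borel" "space \<alpha> = UNIV"
    "N \<in> null_sets lborel \<Longrightarrow> N \<in> null_sets \<alpha>"
  using assms sets_eq_imp_space_eq[of \<alpha> borel]
  unfolding finite_ac_def absolutely_continuous_def by auto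

lemma flow_bilipschitz:
  assumes g: "bounded_lipschitz g"
  shows "\<exists>K. K-lipschitz_on UNIV (flow g s) \<and> K-lipschitz_on UNIV (flow g (- s))"
proof -
  obtain A B where "A-lipschitz_on UNIV (flow g s)" "B-lipschitz_on UNIV (flow g (- s))"
    using flow_lipschitz[OF g] by meson
  then have "(max A B)-lipschitz_on UNIV (flow g s)" "(max A B)-lipschitz_on UNIV (flow g (- s))"
    by (auto intro: lipschitz_on_le)
  then show ?thesis by blast
qed

text \<open>Being in \<open>A\<close> or in \<open>B\<close> at time \<open>a\<close> persists at
  nearby times, both sets being open, so only points lying on \<open>Z\<close> at time
  \<open>a\<close> can cause a jump. These are null because the flow preserves absolute
  continuity.\<close>

lemma flow_mass_continuous:
  assumes \<alpha>: "finite_ac \<alpha>" and g: "bounded_lipschitz g" and out: "\<And>x. x \<notin> U \<Longrightarrow> g x = 0"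
    and AB: "open A" "open B" "A \<inter> B = {}" and U: "open U" "U = A \<union> B \<union> Z" and Z: "Z \<in> null_sets lborel"
  shows "continuous_on UNIV (\<lambda>s. measure \<alpha> {x\<in>U. flow g s x \<in> A})"
proof (rule continuous_on_sequentiallyI)
  fix u :: "nat \<Rightarrow> real" and a assume u: "u \<longlonglongrightarrow> a"
  obtain K where K: "K-lipschitz_on UNIV (flow g a)" "K-lipschitz_on UNIV (flow g (- a))"
    using flow_bilipschitz[OF g] by blast
  note \<alpha>' = finite_acD[OF \<alpha>]
  have mf: "flow g s \<in> borel_measurable borel" for s
    using flow_lipschitz[OF g] lipschitz_borel by blast
  have sets: "{x\<in>U. flow g s x \<in> A} \<in> sets \<alpha>" for s
    using measurable_sets_borel[OF mf, of A s] AB U(1) by (simp add: \<alpha>'(2) Collect_conj_eq vimage_def)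
  have "Z \<in> null_sets (distr \<alpha> borel (flow g a))"
    by (rule finite_acD(4)[OF finite_ac_distr[OF \<alpha> K flow_inverse(1)[OF g]] Z])
  then have "AE x in distr \<alpha> borel (flow g a). x \<notin> Z" by (rule AE_not_in)
  then have ae: "AE x in \<alpha>. flow g a x \<notin> Z"
    by (rule AE_distrD[rotated]) (use mf[of a] \<alpha>'(2) in \<open>simp cong: measurable_cong_sets\<close>)
  show "(\<lambda>n. measure \<alpha> {x\<in>U. flow g (u n) x \<in> A}) \<longlonglongrightarrow> measure \<alpha> {x\<in>U. flow g a x \<in> A}"
  proof (rule measure_tendsto_AE[OF \<alpha>'(1) sets sets])
    show "AE x in \<alpha>. \<forall>\<^sub>F n in sequentially. x \<in> {x\<in>U. flow g (u n) x \<in> A} \<longleftrightarrow> x \<in> {x\<in>U. flow g a x \<in> A}"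
      using ae
    proof eventually_elim
      fix x assume x: "flow g a x \<notin> Z"
      show "\<forall>\<^sub>F n in sequentially. x \<in> {x\<in>U. flow g (u n) x \<in> A} \<longleftrightarrow> x \<in> {x\<in>U. flow g a x \<in> A}"
      proof (cases "x \<in> U")
        case True
        then have "flow g a x \<in> U" using flow_in_invariant[OF g out] by blast
        then consider "flow g a x \<in> A" | "flow g a x \<in> B" using x U(2) by blast
        moreover have "isCont (\<lambda>s. flow g s x) a"
          using flow_continuous[OF g, of UNIV] by (simp add: continuous_on_eq_continuous_at)
        then have lim: "(\<lambda>n. flow g (u n) x) \<longlonglongrightarrow> flow g a x"
          by (rule isCont_tendsto_compose[OF _ u])
        ultimately show ?thesis
        proof cases
          case 1
          then have "\<forall>\<^sub>F n in sequentially. flow g (u n) x \<in> A"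
            using topological_tendstoD[OF lim] AB by blast
          then show ?thesis by eventually_elim (use 1 in auto)
        next
          case 2
          then have "\<forall>\<^sub>F n in sequentially. flow g (u n) x \<in> B"
            using topological_tendstoD[OF lim] AB by blast
          then show ?thesis by eventually_elim (use 2 AB(3) in auto)
        qed
      qed simp
    qed
  qed
qed

text \<open>The set \<open>{x\<in>U. c \<in> A}\<close> is all of \<open>U\<close> or empty, so
  filling \<open>A\<close> and emptying \<open>A\<close> are treated at once. The neighbourhood
  \<open>E\<close> of \<open>c\<close> lies on one side of \<open>A\<close>, whence membership
  stabilizes at every point.\<close>

lemma attracted_mass_tendsto:
  assumes \<alpha>: "finite_ac \<alpha>" and g: "bounded_lipschitz g" and U: "open U" and E: "open E" "E \<inter> A = {} \<or> E \<subseteq> A" "c \<in> E"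
    and A: "open A" and lim: "\<And>x. x \<in> U \<Longrightarrow> ((\<lambda>s. flow g s x) \<longlongrightarrow> c) at_top"
  shows "(\<lambda>n. measure \<alpha> {x\<in>U. flow g (real n) x \<in> A}) \<longlonglongrightarrow> measure \<alpha> {x\<in>U. c \<in> A}"
proof (rule measure_tendsto_AE)
  note \<alpha>' = finite_acD[OF \<alpha>]
  show "finite_measure \<alpha>" by fact
  have mf: "flow g s \<in> borel_measurable borel" for s
    using flow_lipschitz[OF g] lipschitz_borel by blast
  show "{x\<in>U. flow g (real n) x \<in> A} \<in> sets \<alpha>" for n
    using measurable_sets_borel[OF mf, of A "real n"] A U by (simp add: \<alpha>'(2) Collect_conj_eq vimage_def)
  show "{x\<in>U. c \<in> A} \<in> sets \<alpha>" using U by (cases "c \<in> A") (auto simp: \<alpha>'(2))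
  show "AE x in \<alpha>. \<forall>\<^sub>F n in sequentially. x \<in> {x\<in>U. flow g (real n) x \<in> A} \<longleftrightarrow> x \<in> {x\<in>U. c \<in> A}"
  proof (rule AE_I2)
    fix x
    show "\<forall>\<^sub>F n in sequentially. x \<in> {x\<in>U. flow g (real n) x \<in> A} \<longleftrightarrow> x \<in> {x\<in>U. c \<in> A}"
    proof (cases "x \<in> U")
      case True
      have "(\<lambda>n. flow g (real n) x) \<longlonglongrightarrow> c"
        using filterlim_compose[OF lim[OF True] filterlim_real_sequentially] .
      then have "\<forall>\<^sub>F n in sequentially. flow g (real n) x \<in> E"
        using topological_tendstoD E by blast
      then show ?thesis by eventually_elim (use E in auto)
    qed simp
  qed
qed

section \<open>Cutting boxes and chaining balls\<close>

lemma box_split: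
  fixes a b :: "'a::euclidean_space"
  assumes i: "i \<in> Basis" and m: "a \<bullet> i < m" "m < b \<bullet> i"
  defines "b' \<equiv> b + (m - b \<bullet> i) *\<^sub>R i" and "a' \<equiv> a + (m - a \<bullet> i) *\<^sub>R i"
  shows "box a b' = {x \<in> box a b. x \<bullet> i < m}" "box a' b = {x \<in> box a b. m < x \<bullet> i}"
    "\<And>j. j \<in> Basis \<Longrightarrow> b' \<bullet> j = (if j = i then m else b \<bullet> j)"
    "\<And>j. j \<in> Basis \<Longrightarrow> a' \<bullet> j = (if j = i then m else a \<bullet> j)"
proof -
  show b': "\<And>j. j \<in> Basis \<Longrightarrow> b' \<bullet> j = (if j = i then m else b \<bullet> j)"
    and a': "\<And>j. j \<in> Basis \<Longrightarrow> a' \<bullet> j = (if j = i then m else a \<bullet> j)"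
    using i by (auto simp: b'_def a'_def inner_add_left inner_Basis)
  show "box a b' = {x \<in> box a b. x \<bullet> i < m}"
    using b' i m by (fastforce simp: mem_box split: if_splits)
  show "box a' b = {x \<in> box a b. m < x \<bullet> i}"
    using a' i m by (fastforce simp: mem_box split: if_splits)
qed

lemma hyperplane_null:
  assumes "i \<in> Basis"
  shows "{x::'a::euclidean_space. x \<bullet> i = m} \<in> null_sets lborel"
proof -
  have "{x. x \<bullet> i = m} \<in> sets borel" by measurable
  then show ?thesis
    using negligible_standard_hyperplane[OF assms, of m] null_sets_completion_iff[of "{x. x \<bullet> i = m}" lborel]
    unfolding negligible_iff_null_sets by simp
qed

text \<open>Additivity under a single cut by a coordinate hyperplane, with the slice itself
  discarded: the property of measures vanishing on hyperplanes that induction along bisections uses.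
  It also makes sense for the target weights, which are combinations of measures.\<close>

definition box_additive :: "('a::euclidean_space set \<Rightarrow> real) \<Rightarrow> bool" where
  "box_additive w \<longleftrightarrow> (\<forall>i\<in>Basis. \<forall>m a b. a \<bullet> i < m \<longrightarrow> m < b \<bullet> i \<longrightarrow>
     w (box a b) = w {x \<in> box a b. x \<bullet> i < m} + w {x \<in> box a b. m < x \<bullet> i})"

text \<open>The discarded slice is null. Finiteness is asked on boxes only, so that Lebesgue measure
  is covered.\<close>

lemma measure_box_additive:
  fixes N :: "'a::euclidean_space measure"
  assumes s: "sets N = sets borel" and fin: "\<And>a b. emeasure N (box a b) < \<infinity>"
    and ac: "absolutely_continuous lborel N"
  shows "box_additive (measure N)"
  unfolding box_additive_def
proof (intro ballI allI impI)
  fix i m and a b :: 'a assume i: "i \<in> Basis" and m: "a \<bullet> i < m" "m < b \<bullet> i"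
  note split = box_split(1,2)[OF i m]
  let ?A = "{x \<in> box a b. x \<bullet> i < m}" and ?B = "{x \<in> box a b. m < x \<bullet> i}"
  have AB: "?A \<in> sets N" "?B \<in> sets N" "emeasure N ?A \<noteq> \<infinity>" "emeasure N ?B \<noteq> \<infinity>"
    unfolding split[symmetric] using s fin by (auto simp: less_top)
  have "{x \<in> box a b. x \<bullet> i = m} \<in> null_sets lborel"
    using null_set_Int1[OF hyperplane_null[OF i, of m], of "box a b"] by (simp add: Int_def conj_commute)
  then have Z: "{x \<in> box a b. x \<bullet> i = m} \<in> null_sets N"
    using ac unfolding absolutely_continuous_def by blast
  have "box a b = (?A \<union> ?B) \<union> {x \<in> box a b. x \<bullet> i = m}" by auto
  then have "measure N (box a b) = measure N (?A \<union> ?B)"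
    using measure_Un_null_set[OF _ Z, of "?A \<union> ?B"] AB(1,2) by (metis sets.Un)
  also have "\<dots> = measure N ?A + measure N ?B"
    by (rule measure_Union[OF AB(3,4,1,2)]) auto
  finally show "measure N (box a b) = measure N ?A + measure N ?B" .
qed

text \<open>Balls are attached one at a time, each meeting what is already there and with its closed
  ball inside \<omega>. Followed from the last ball back, this order is the route along which mass
  is brought to \<open>B0\<close>.\<close>

inductive ball_chain :: "'a::euclidean_space set \<Rightarrow> 'a set \<Rightarrow> 'a set \<Rightarrow> bool"
  for \<omega> B0 where
  base: "ball_chain \<omega> B0 B0"
| step: "ball_chain \<omega> B0 V \<Longrightarrow> cball z r \<subseteq> \<omega> \<Longrightarrow> ball z r \<inter> V \<noteq> {} \<Longrightarrow> ball_chain \<omega> B0 (ball z r \<union> V)"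

lemma ball_chain_props:
  assumes "ball_chain \<omega> B0 V" "open B0" "bounded B0" "closure B0 \<subseteq> \<omega>"
  shows "open V \<and> bounded V \<and> closure V \<subseteq> \<omega> \<and> B0 \<subseteq> V"
  using assms(1)
proof induction
  case base
  then show ?case using assms by simp
next
  case (step V z r)
  have "closure (ball z r) \<subseteq> cball z r" by (rule closure_minimal) auto
  then show ?case using step by (auto simp: closure_Un)
qed

text \<open>The balls of \<open>V\<close> are attached anew on top of \<open>W\<close>, which
  contains their starting set \<open>B0\<close>. Thus finitely many chains merge into one.\<close>

lemma ball_chain_Un:
  assumes "ball_chain \<omega> B0 V" "ball_chain \<omega> B0 W" "B0 \<subseteq> W"
  shows "ball_chain \<omega> B0 (V \<union> W)"
  using assms(1)
proof induction
  case base
  then show ?case using assms by (simp add: sup.absorb2)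
next
  case (step V z r)
  have "ball z r \<inter> (V \<union> W) \<noteq> {}" using step.hyps by blast
  from ball_chain.step[OF step.IH step.hyps(2) this] show ?case by (simp add: Un_assoc)
qed

text \<open>The union \<open>Y\<close> of all chains is open, and so is its complement in \<omega>:
  a ball in \<omega> that meets a chain could be attached to it, center included. Connectedness
  gives \<omega> inside \<open>Y\<close>, and compactness reduces to finitely many chains, which
  merge.\<close>

lemma ball_chain_covers:
  assumes \<omega>: "open \<omega>" "connected \<omega>" and B0: "open B0" "bounded B0" "closure B0 \<subseteq> \<omega>" "B0 \<noteq> {}"
    and C: "compact C" "C \<subseteq> \<omega>"
  shows "\<exists>V. ball_chain \<omega> B0 V \<and> C \<subseteq> V"
proof -
  define Y where "Y = \<Union>{V. ball_chain \<omega> B0 V}"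
  have props: "open V \<and> bounded V \<and> closure V \<subseteq> \<omega> \<and> B0 \<subseteq> V" if "ball_chain \<omega> B0 V" for V
    using ball_chain_props[OF that B0(1-3)] .
  have "open Y" unfolding Y_def using props by blast
  have "B0 \<subseteq> \<omega>" using B0(3) closure_subset by blast
  have "open (\<omega> - Y)"
    unfolding open_contains_ball
  proof
    fix z assume z: "z \<in> \<omega> - Y"
    obtain r where r: "r > 0" "cball z r \<subseteq> \<omega>" using \<omega>(1) z open_contains_cball by blast
    have "ball z r \<inter> V = {}" if V: "ball_chain \<omega> B0 V" for V
    proof (rule ccontr)
      assume "ball z r \<inter> V \<noteq> {}"
      then have "ball_chain \<omega> B0 (ball z r \<union> V)" by (rule ball_chain.step[OF V r(2)])
      moreover have "z \<in> ball z r \<union> V" using r(1) by simp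
      ultimately show False using z unfolding Y_def by blast
    qed
    then have "ball z r \<inter> Y = {}" unfolding Y_def by blast
    moreover have "ball z r \<subseteq> \<omega>" using r(2) ball_subset_cball by blast
    ultimately show "\<exists>e>0. ball z e \<subseteq> \<omega> - Y" using r(1) by blast
  qed
  have "B0 \<subseteq> Y" unfolding Y_def using ball_chain.base by blast
  then have "Y \<inter> \<omega> \<noteq> {}" using B0(4) \<open>B0 \<subseteq> \<omega>\<close> by blast
  have "\<omega> \<subseteq> Y"
  proof (rule ccontr)
    assume "\<not> \<omega> \<subseteq> Y"
    then have "(\<omega> - Y) \<inter> \<omega> \<noteq> {}" by blast
    moreover have "\<omega> \<subseteq> Y \<union> (\<omega> - Y)" "Y \<inter> (\<omega> - Y) \<inter> \<omega> = {}" by blast+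
    ultimately show False
      using connectedD[OF \<omega>(2) \<open>open Y\<close> \<open>open (\<omega> - Y)\<close>] \<open>Y \<inter> \<omega> \<noteq> {}\<close> by blast
  qed
  then have "C \<subseteq> \<Union>{V. ball_chain \<omega> B0 V}" using C(2) Y_def by blast
  moreover have "\<And>V. V \<in> {V. ball_chain \<omega> B0 V} \<Longrightarrow> open V" using props by blast
  ultimately obtain \<V> where \<V>: "\<V> \<subseteq> {V. ball_chain \<omega> B0 V}" "finite \<V>" "C \<subseteq> \<Union>\<V>"
    using compactE[OF C(1)] by metis
  have "ball_chain \<omega> B0 (\<Union>\<V> \<union> B0)" using \<V>(2,1)
  proof (induction rule: finite_induct)
    case empty
    then show ?case by (simp add: ball_chain.base)
  next
    case (insert V \<V>)
    then have "ball_chain \<omega> B0 (V \<union> (\<Union>\<V> \<union> B0))" using ball_chain_Un[of \<omega> B0 V "\<Union>\<V> \<union> B0"] by auto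
    then show ?case by (simp add: Un_assoc)
  qed
  then show ?thesis using \<V>(3) by blast
qed

section \<open>Prescribing masses in cells and gathering mass\<close>

context steering
begin

lemma steerable_push:
  assumes "finite_ac \<alpha>" "steerable v \<omega> R M t \<Psi>"
  shows "finite_ac (distr \<alpha> borel \<Psi>)" "\<Psi> \<in> borel_measurable borel"
    "C \<in> sets borel \<Longrightarrow> measure (distr \<alpha> borel \<Psi>) C = measure \<alpha> {x. \<Psi> x \<in> C}"
    "C \<in> sets borel \<Longrightarrow> {x. \<Psi> x \<in> C} \<in> sets borel"
proof -
  obtain \<Xi> K where K: "K-lipschitz_on UNIV \<Psi>" "K-lipschitz_on UNIV \<Xi>" "\<And>x. \<Xi> (\<Psi> x) = x"
    using steerable_bilipschitz[OF assms(2)] by blast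
  show "finite_ac (distr \<alpha> borel \<Psi>)" by (rule finite_ac_distr[OF assms(1) K])
  show b: "\<Psi> \<in> borel_measurable borel" by (rule lipschitz_borel[OF K(1)])
  show "{x. \<Psi> x \<in> C} \<in> sets borel" if "C \<in> sets borel"
    using measurable_sets_borel[OF b that] by (simp add: vimage_def)
  have "\<Psi> \<in> measurable \<alpha> borel" using b finite_acD(2)[OF assms(1)] by (simp cong: measurable_cong_sets)
  then show "measure (distr \<alpha> borel \<Psi>) C = measure \<alpha> {x. \<Psi> x \<in> C}" if "C \<in> sets borel"
    using that finite_acD(3)[OF assms(1)] by (simp add: measure_distr vimage_def)
qed

text \<open>If \<open>A\<close> carries at least \<open>a\<close>, the attracting point is taken in
  \<open>B\<close> and the mass of \<open>A\<close> tends to 0; otherwise it is taken in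
  \<open>A\<close> and the mass tends to that of \<open>U\<close>. The limits need not be attained,
  hence the strict bounds on \<open>a\<close>.\<close>

lemma bisect_mass:
  assumes \<alpha>: "finite_ac \<alpha>" and U: "open U" "convex U" "U \<subseteq> D" "U = A \<union> B \<union> Z"
    and AB: "open A" "open B" "A \<inter> B = {}" "A \<noteq> {}" "B \<noteq> {}" and Z: "Z \<in> null_sets lborel"
    and a: "0 < a" "a < measure \<alpha> U" and "0 < t"
  shows "\<exists>\<Psi>. local_steering U t \<Psi> \<and> measure \<alpha> {x. \<Psi> x \<in> A} = a
     \<and> measure \<alpha> {x. \<Psi> x \<in> B} = measure \<alpha> U - a"
proof -
  note \<alpha>' = finite_acD[OF \<alpha>]
  interpret finite_measure \<alpha> by fact
  have bU: "bounded U" using U(3) compact_D bounded_subset compact_imp_bounded by blast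
  have "\<exists>g \<sigma>. bounded_lipschitz g \<and> (\<forall>x. x \<notin> U \<longrightarrow> g x = 0) \<and> 0 \<le> \<sigma> \<and> measure \<alpha> {x\<in>U. flow g \<sigma> x \<in> A} = a"
  proof (cases "a \<le> measure \<alpha> A")
    case True
    obtain c where c: "c \<in> B" using AB by blast
    then have "c \<in> U" using U by blast
    obtain g where g: "bounded_lipschitz g" "\<And>x. x \<notin> U \<Longrightarrow> g x = 0"
      "\<And>x. x \<in> U \<Longrightarrow> ((\<lambda>s. flow g s x) \<longlongrightarrow> c) at_top"
      using attracting_field[OF U(1) bU U(2) \<open>c \<in> U\<close>] by blast
    have "(\<lambda>n. measure \<alpha> {x\<in>U. flow g (real n) x \<in> A}) \<longlonglongrightarrow> measure \<alpha> {x\<in>U. c \<in> A}"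
      by (rule attracted_mass_tendsto[OF \<alpha> g(1) U(1) AB(2) _ c AB(1) g(3)]) (use AB in auto)
    moreover have "{x\<in>U. c \<in> A} = {}" using c AB(3) by auto
    ultimately have "(\<lambda>n. measure \<alpha> {x\<in>U. flow g (real n) x \<in> A}) \<longlonglongrightarrow> 0" by simp
    then have "\<forall>\<^sub>F n in sequentially. measure \<alpha> {x\<in>U. flow g (real n) x \<in> A} < a"
      using a(1) order_tendstoD(2) by blast
    then obtain n where n: "measure \<alpha> {x\<in>U. flow g (real n) x \<in> A} < a"
      using eventually_happens'[OF sequentially_bot] by blast
    have "{x\<in>U. flow g 0 x \<in> A} = A" using U(4) flow_0[OF g(1)] by auto
    then have "\<exists>\<sigma>\<ge>0. \<sigma> \<le> real n \<and> measure \<alpha> {x\<in>U. flow g \<sigma> x \<in> A} = a"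
      using n True continuous_on_subset[OF flow_mass_continuous[OF \<alpha> g(1,2) AB(1-3) U(1,4) Z]]
      by (intro IVT2') auto
    then show ?thesis using g by blast
  next
    case False
    obtain c where c: "c \<in> A" using AB by blast
    then have "c \<in> U" using U by blast
    obtain g where g: "bounded_lipschitz g" "\<And>x. x \<notin> U \<Longrightarrow> g x = 0"
      "\<And>x. x \<in> U \<Longrightarrow> ((\<lambda>s. flow g s x) \<longlongrightarrow> c) at_top"
      using attracting_field[OF U(1) bU U(2) \<open>c \<in> U\<close>] by blast
    have "(\<lambda>n. measure \<alpha> {x\<in>U. flow g (real n) x \<in> A}) \<longlonglongrightarrow> measure \<alpha> {x\<in>U. c \<in> A}"
      by (rule attracted_mass_tendsto[OF \<alpha> g(1) U(1) AB(1) _ c AB(1) g(3)]) auto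
    moreover have "{x\<in>U. c \<in> A} = U" using c by auto
    ultimately have "(\<lambda>n. measure \<alpha> {x\<in>U. flow g (real n) x \<in> A}) \<longlonglongrightarrow> measure \<alpha> U" by simp
    then have "\<forall>\<^sub>F n in sequentially. a < measure \<alpha> {x\<in>U. flow g (real n) x \<in> A}"
      using a(2) order_tendstoD(1) by blast
    then obtain n where n: "a < measure \<alpha> {x\<in>U. flow g (real n) x \<in> A}"
      using eventually_happens'[OF sequentially_bot] by blast
    have "{x\<in>U. flow g 0 x \<in> A} = A" using U(4) flow_0[OF g(1)] by auto
    then have "\<exists>\<sigma>\<ge>0. \<sigma> \<le> real n \<and> measure \<alpha> {x\<in>U. flow g \<sigma> x \<in> A} = a"
      using n False continuous_on_subset[OF flow_mass_continuous[OF \<alpha> g(1,2) AB(1-3) U(1,4) Z]]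
      by (intro IVT') auto
    then show ?thesis using g by blast
  qed
  then obtain g \<sigma> where g: "bounded_lipschitz g" "\<And>x. x \<notin> U \<Longrightarrow> g x = 0" "0 \<le> \<sigma>"
    "measure \<alpha> {x\<in>U. flow g \<sigma> x \<in> A} = a" by blast
  obtain \<Psi> where \<Psi>: "local_steering U t \<Psi>" "\<And>x. x \<in> D \<Longrightarrow> \<Psi> x = flow g \<sigma> x"
    using local_flow[OF g(1,2) U(3) g(3) \<open>0 < t\<close>] by blast
  have \<Psi>s: "steerable v \<omega> R M t \<Psi>" "\<Psi> ` U = U" using \<Psi>(1) unfolding local_steering_def by auto
  note push = steerable_push[OF \<alpha> \<Psi>s(1)]
  have sub: "A \<subseteq> U" "B \<subseteq> U" "U \<subseteq> U" using U(4) by auto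
  \<comment> \<open>Injectivity prevents mass outside \<open>U\<close>, even off \<open>D\<close>,
    from entering \<open>U\<close>, so masses before and after can be compared.\<close>
  have in_U: "\<Psi> x \<in> U \<longleftrightarrow> x \<in> U" for x
    using local_steering_in(1)[OF \<Psi>(1) U(3) U(3), of x] \<Psi>s(2) by blast
  have "{x. \<Psi> x \<in> A} = {x\<in>U. flow g \<sigma> x \<in> A}"
    using in_U sub(1) \<Psi>(2) U(3) by (metis (no_types, lifting) subsetD)
  then have A: "measure \<alpha> {x. \<Psi> x \<in> A} = a" using g(4) by simp
  have "measure \<alpha> U = measure \<alpha> {x. \<Psi> x \<in> U}" using in_U by simp
  also have "\<dots> = measure (distr \<alpha> borel \<Psi>) U" using push(3)[of U] U(1) by simp
  also have "\<dots> = measure (distr \<alpha> borel \<Psi>) (A \<union> B)"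
  proof -
    have "U = (A \<union> B) \<union> Z" using U(4) by blast
    moreover have "Z \<in> null_sets (distr \<alpha> borel \<Psi>)" by (rule finite_acD(4)[OF push(1) Z])
    ultimately show ?thesis
      using measure_Un_null_set[of "A \<union> B" "distr \<alpha> borel \<Psi>" Z] AB(1,2) by simp
  qed
  also have "\<dots> = measure (distr \<alpha> borel \<Psi>) A + measure (distr \<alpha> borel \<Psi>) B"
    using AB by (intro finite_measure.finite_measure_Union[OF finite_acD(1)[OF push(1)]]) auto
  also have "\<dots> = measure \<alpha> {x. \<Psi> x \<in> A} + measure \<alpha> {x. \<Psi> x \<in> B}"
    using push(3) AB by simp
  finally show ?thesis using A \<Psi>(1) by (intro exI[of _ \<Psi>]) auto
qed

text \<open>\<open>L\<close> lists the directions of the successive cuts. The measure is general in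
  the induction because each half is treated after earlier motions have changed it. The identity for
  every \<open>box_additive\<close> function, rather than for \<open>w\<close> alone, allows the
  cells to be summed later against a measure that enters only as a part of \<open>w\<close>.\<close>

lemma box_matching:
  assumes w: "box_additive w" and pos: "\<forall>a b. box a b \<noteq> {} \<longrightarrow> 0 < w (box a b)"
    and "set L \<subseteq> Basis" "finite_ac \<alpha>" "box a b \<noteq> {}" "box a b \<subseteq> D"
    "measure \<alpha> (box a b) = w (box a b)" "0 < t"
  shows "\<exists>\<Psi> F. local_steering (box a b) t \<Psi> \<and> finite F \<and>
     (\<forall>C\<in>F. \<exists>c d. C = box c d \<and> C \<noteq> {} \<and> C \<subseteq> box a b \<and>
        (\<forall>j\<in>Basis. (d - c) \<bullet> j = (b - a) \<bullet> j / 2 ^ count_list L j)) \<and>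
     (\<forall>C\<in>F. \<forall>C'\<in>F. C \<noteq> C' \<longrightarrow> C \<inter> C' = {}) \<and>
     (\<forall>\<phi>. box_additive \<phi> \<longrightarrow> (\<Sum>C\<in>F. \<phi> C) = \<phi> (box a b)) \<and>
     (\<forall>C\<in>F. measure \<alpha> {x. \<Psi> x \<in> C} = w C)"
  using assms(3-)
proof (induction L arbitrary: a b \<alpha> t)
  case Nil
  have "bounded_lipschitz (\<lambda>x::'a. 0::'a)" by (rule bounded_lipschitzI[of 0 _ 0]) (auto simp: lipschitz_on_def)
  from local_flow[OF this _ Nil.prems(4), of 0 t] Nil.prems(6)
  obtain \<Psi> where \<Psi>: "local_steering (box a b) t \<Psi>" by auto
  have "\<Psi> x \<in> box a b \<longleftrightarrow> x \<in> box a b" for x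
    using local_steering_in(1)[OF \<Psi> Nil.prems(4) Nil.prems(4), of x] \<Psi>
    unfolding local_steering_def by blast
  then have "{x. \<Psi> x \<in> box a b} = box a b" by blast
  then show ?case
    using \<Psi> Nil.prems by (intro exI[of _ \<Psi>] exI[of _ "{box a b}"]) auto
next
  case (Cons i L)
  note \<alpha> = Cons.prems(2)
  have i: "i \<in> Basis" and L: "set L \<subseteq> Basis" using Cons.prems(1) by auto
  have ab: "a \<bullet> j < b \<bullet> j" if "j \<in> Basis" for j using Cons.prems(3) that by (simp add: box_ne_empty)
  define m where "m = (a \<bullet> i + b \<bullet> i) / 2"
  have m: "a \<bullet> i < m" "m < b \<bullet> i" using ab[OF i] by (auto simp: m_def)
  define b' where "b' = b + (m - b \<bullet> i) *\<^sub>R i"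
  define a' where "a' = a + (m - a \<bullet> i) *\<^sub>R i"
  note split = box_split[OF i m, folded b'_def a'_def]
  let ?U = "box a b" and ?A = "box a b'" and ?B = "box a' b"
  define Z where "Z = ?U \<inter> {x. x \<bullet> i = m}"
  have Z: "Z \<in> null_sets lborel"
    unfolding Z_def by (rule null_set_Int1[OF hyperplane_null[OF i]]) simp
  have U: "?U = ?A \<union> ?B \<union> Z" unfolding split(1,2) Z_def by auto
  have disj: "?A \<inter> ?B = {}" unfolding split(1,2) by auto
  have ne: "?A \<noteq> {}" "?B \<noteq> {}" using ab m by (auto simp: box_ne_empty split(3,4))
  have sub: "?A \<subseteq> ?U" "?B \<subseteq> ?U" using U by auto
  have additive: "\<phi> ?U = \<phi> ?A + \<phi> ?B" if "box_additive \<phi>" for \<phi>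
    using that i m unfolding box_additive_def split(1,2) by blast
  have wsplit: "w ?U = w ?A + w ?B" by (rule additive[OF w])
  have posA: "0 < w ?A" and posB: "0 < w ?B" using pos ne by auto
  \<comment> \<open>One third of the time is for the cut and one for each half.\<close>
  have t3: "0 < t / 3" using Cons.prems(6) by simp
  have "w ?A < measure \<alpha> ?U" using wsplit posB Cons.prems(5) by simp
  from bisect_mass[OF \<alpha> open_box convex_box(2) Cons.prems(4) U open_box open_box disj ne Z posA this t3]
  obtain \<Psi>1 where \<Psi>1: "local_steering ?U (t / 3) \<Psi>1" "measure \<alpha> {x. \<Psi>1 x \<in> ?A} = w ?A"
    "measure \<alpha> {x. \<Psi>1 x \<in> ?B} = measure \<alpha> ?U - w ?A" by blast
  have s1: "steerable v \<omega> R M (t / 3) \<Psi>1" using \<Psi>1(1) unfolding local_steering_def by blast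
  note push1 = steerable_push[OF \<alpha> s1]
  have AD: "?A \<subseteq> D" and BD: "?B \<subseteq> D" using sub Cons.prems(4) by auto
  have "measure (distr \<alpha> borel \<Psi>1) ?A = w ?A" using push1(3) \<Psi>1(2) by simp
  from Cons.IH[OF L push1(1) ne(1) AD this t3]
  obtain \<Psi>2 F1 where \<Psi>2: "local_steering ?A (t / 3) \<Psi>2" and F1: "finite F1"
    "\<forall>C\<in>F1. \<exists>c d. C = box c d \<and> C \<noteq> {} \<and> C \<subseteq> ?A \<and>
        (\<forall>j\<in>Basis. (d - c) \<bullet> j = (b' - a) \<bullet> j / 2 ^ count_list L j)"
    "\<forall>C\<in>F1. \<forall>C'\<in>F1. C \<noteq> C' \<longrightarrow> C \<inter> C' = {}"
    "\<forall>\<phi>. box_additive \<phi> \<longrightarrow> (\<Sum>C\<in>F1. \<phi> C) = \<phi> ?A"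
    "\<forall>C\<in>F1. measure (distr \<alpha> borel \<Psi>1) {x. \<Psi>2 x \<in> C} = w C"
    by (elim exE conjE)
  have s2: "steerable v \<omega> R M (t / 3) \<Psi>2" using \<Psi>2 unfolding local_steering_def by blast
  have \<Psi>21: "local_steering ?U (t / 3 + t / 3) (\<lambda>x. \<Psi>2 (\<Psi>1 x))"
    by (rule local_steering_compose[OF \<Psi>2 \<Psi>1(1) sub(1) Cons.prems(4)])
  have s21: "steerable v \<omega> R M (t / 3 + t / 3) (\<lambda>x. \<Psi>2 (\<Psi>1 x))" using \<Psi>21 unfolding local_steering_def by blast
  note push21 = steerable_push[OF \<alpha> s21]
  \<comment> \<open>The motion inside the first half fixes the second, whose mass is therefore still
    the prescribed one.\<close>
  have "\<Psi>2 y \<in> ?B \<longleftrightarrow> y \<in> ?B" for y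
    by (rule local_steering_in(2)[OF \<Psi>2 AD BD]) (use disj in blast)
  then have "measure (distr \<alpha> borel (\<lambda>x. \<Psi>2 (\<Psi>1 x))) ?B = w ?B"
    using push21(3)[of ?B] \<Psi>1(3) wsplit Cons.prems(5) by simp
  from Cons.IH[OF L push21(1) ne(2) BD this t3]
  obtain \<Psi>3 F2 where \<Psi>3: "local_steering ?B (t / 3) \<Psi>3" and F2: "finite F2"
    "\<forall>C\<in>F2. \<exists>c d. C = box c d \<and> C \<noteq> {} \<and> C \<subseteq> ?B \<and>
        (\<forall>j\<in>Basis. (d - c) \<bullet> j = (b - a') \<bullet> j / 2 ^ count_list L j)"
    "\<forall>C\<in>F2. \<forall>C'\<in>F2. C \<noteq> C' \<longrightarrow> C \<inter> C' = {}"
    "\<forall>\<phi>. box_additive \<phi> \<longrightarrow> (\<Sum>C\<in>F2. \<phi> C) = \<phi> ?B"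
    "\<forall>C\<in>F2. measure (distr \<alpha> borel (\<lambda>x. \<Psi>2 (\<Psi>1 x))) {x. \<Psi>3 x \<in> C} = w C"
    by (elim exE conjE)
  have s3: "steerable v \<omega> R M (t / 3) \<Psi>3" using \<Psi>3 unfolding local_steering_def by blast
  let ?\<Psi> = "\<lambda>x. \<Psi>3 (\<Psi>2 (\<Psi>1 x))"
  have "local_steering ?U (t / 3 + t / 3 + t / 3) ?\<Psi>"
    by (rule local_steering_compose[OF \<Psi>3 \<Psi>21 sub(2) Cons.prems(4)])
  then have 1: "local_steering ?U t ?\<Psi>" by simp
  have F1': "C \<noteq> {}" "C \<subseteq> ?A" "open C" if "C \<in> F1" for C using F1(2) that by (metis open_box)+
  have F2': "C \<noteq> {}" "C \<subseteq> ?B" "open C" if "C \<in> F2" for C using F2(2) that by (metis open_box)+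
  have F12: "C \<inter> C' = {}" if "C \<in> F1" "C' \<in> F2" for C C' using F1'[OF that(1)] F2'[OF that(2)] disj by blast
  \<comment> \<open>Nonempty cells from disjoint halves cannot coincide, so sums over the two
    families add up.\<close>
  have "C \<notin> F2" if "C \<in> F1" for C using F12[OF that, of C] F1'(1)[OF that] by auto
  then have dF: "F1 \<inter> F2 = {}" by blast
  \<comment> \<open>A cut at the midpoint halves the side in direction \<open>i\<close>, which
    matches the additional occurrence of \<open>i\<close> in the list.\<close>
  have sides1: "(b' - a) \<bullet> j / 2 ^ count_list L j = (b - a) \<bullet> j / 2 ^ count_list (i # L) j" if "j \<in> Basis" for j
    using split(3)[OF that] by (auto simp: inner_diff_left m_def field_simps)
  have sides2: "(b - a') \<bullet> j / 2 ^ count_list L j = (b - a) \<bullet> j / 2 ^ count_list (i # L) j" if "j \<in> Basis" for j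
    using split(4)[OF that] by (auto simp: inner_diff_left m_def field_simps)
  have 2: "\<forall>C\<in>F1 \<union> F2. \<exists>c d. C = box c d \<and> C \<noteq> {} \<and> C \<subseteq> ?U \<and>
        (\<forall>j\<in>Basis. (d - c) \<bullet> j = (b - a) \<bullet> j / 2 ^ count_list (i # L) j)"
  proof
    fix C assume "C \<in> F1 \<union> F2"
    then show "\<exists>c d. C = box c d \<and> C \<noteq> {} \<and> C \<subseteq> ?U \<and>
        (\<forall>j\<in>Basis. (d - c) \<bullet> j = (b - a) \<bullet> j / 2 ^ count_list (i # L) j)"
    proof
      assume "C \<in> F1"
      from bspec[OF F1(2) this] obtain c d where C: "C = box c d" "C \<noteq> {}" "C \<subseteq> ?A"
        and cd: "\<forall>j\<in>Basis. (d - c) \<bullet> j = (b' - a) \<bullet> j / 2 ^ count_list L j" by (elim exE conjE)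
      have "\<forall>j\<in>Basis. (d - c) \<bullet> j = (b - a) \<bullet> j / 2 ^ count_list (i # L) j"
      proof
        fix j :: 'a assume j: "j \<in> Basis"
        show "(d - c) \<bullet> j = (b - a) \<bullet> j / 2 ^ count_list (i # L) j"
          using bspec[OF cd j] sides1[OF j] by (rule trans)
      qed
      then show ?thesis using C(1,2) order_trans[OF C(3) sub(1)] by blast
    next
      assume "C \<in> F2"
      from bspec[OF F2(2) this] obtain c d where C: "C = box c d" "C \<noteq> {}" "C \<subseteq> ?B"
        and cd: "\<forall>j\<in>Basis. (d - c) \<bullet> j = (b - a') \<bullet> j / 2 ^ count_list L j" by (elim exE conjE)
      have "\<forall>j\<in>Basis. (d - c) \<bullet> j = (b - a) \<bullet> j / 2 ^ count_list (i # L) j"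
      proof
        fix j :: 'a assume j: "j \<in> Basis"
        show "(d - c) \<bullet> j = (b - a) \<bullet> j / 2 ^ count_list (i # L) j"
          using bspec[OF cd j] sides2[OF j] by (rule trans)
      qed
      then show ?thesis using C(1,2) order_trans[OF C(3) sub(2)] by blast
    qed
  qed
  have 3: "\<forall>C\<in>F1 \<union> F2. \<forall>C'\<in>F1 \<union> F2. C \<noteq> C' \<longrightarrow> C \<inter> C' = {}"
    using F1(3) F2(3) F12 by (metis Int_commute UnE)
  have 4: "\<forall>\<phi>. box_additive \<phi> \<longrightarrow> (\<Sum>C\<in>F1 \<union> F2. \<phi> C) = \<phi> ?U"
    unfolding sum.union_disjoint[OF F1(1) F2(1) dF] using F1(4) F2(4) additive by simp
  have 5: "measure \<alpha> {x. ?\<Psi> x \<in> C} = w C" if "C \<in> F1 \<union> F2" for C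
    using that
  proof
    assume C: "C \<in> F1"
    have "\<Psi>3 y \<in> C \<longleftrightarrow> y \<in> C" for y
      by (rule local_steering_in(2)[OF \<Psi>3 BD]) (use F1'[OF C] AD disj in blast)+
    then have "measure \<alpha> {x. ?\<Psi> x \<in> C} = measure (distr \<alpha> borel \<Psi>1) {x. \<Psi>2 x \<in> C}"
      using push1(3)[of "{x. \<Psi>2 x \<in> C}"] steerable_push(4)[OF \<alpha> s2, of C] F1'(3)[OF C] by simp
    then show ?thesis using F1(5) C by simp
  next
    assume C: "C \<in> F2"
    have "measure \<alpha> {x. ?\<Psi> x \<in> C} = measure (distr \<alpha> borel (\<lambda>x. \<Psi>2 (\<Psi>1 x))) {x. \<Psi>3 x \<in> C}"
      using push21(3)[of "{x. \<Psi>3 x \<in> C}"] steerable_push(4)[OF \<alpha> s3, of C] F2'(3)[OF C] by simp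
    then show ?thesis using F2(5) C by simp
  qed
  have masses: "\<forall>C\<in>F1 \<union> F2. measure \<alpha> {x. ?\<Psi> x \<in> C} = w C" by (intro ballI 5)
  have fin: "finite (F1 \<union> F2)" using F1(1) F2(1) by simp
  show ?case
    by (rule exI[of _ ?\<Psi>], rule exI[of _ "F1 \<union> F2"]) (intro conjI 1 2 3 4 masses fin)
qed

text \<open>The last ball of the chain is attracted to a point \<open>c\<close> of its overlap with
  the rest \<open>V\<close>, leaving less than \<open>\<delta> / 2\<close> behind; the induction
  hypothesis gathers \<open>V\<close> with the other half of the error and of the time. Points of
  \<open>V\<close> outside the ball stay fixed meanwhile, being in \<open>D\<close>.\<close>

lemma gather:
  assumes "ball_chain \<omega> B0 V" "open B0" "bounded B0" "closure B0 \<subseteq> \<omega>"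
    and "V \<subseteq> D" "finite_ac \<alpha>" "0 < \<delta>" "0 < t"
  shows "\<exists>\<Psi>. steerable v \<omega> R M t \<Psi> \<and> measure \<alpha> {x\<in>V. \<Psi> x \<notin> B0} < \<delta>"
  using assms(1) assms(5-8)
proof (induction arbitrary: \<alpha> \<delta> t)
  case base
  have "bounded_lipschitz (\<lambda>x::'a. 0::'a)" by (rule bounded_lipschitzI[of 0 _ 0]) (auto simp: lipschitz_on_def)
  from local_flow[OF this _ base.prems(1), of 0 t] base.prems(4)
  obtain \<Psi> where \<Psi>: "local_steering B0 t \<Psi>" by auto
  then have e: "{x\<in>B0. \<Psi> x \<notin> B0} = {}" unfolding local_steering_def by blast
  have "measure \<alpha> {x\<in>B0. \<Psi> x \<notin> B0} < \<delta>" unfolding e using base.prems(3) by simp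
  then show ?case using \<Psi> unfolding local_steering_def by blast
next
  case (step V z r)
  note \<alpha> = step.prems(2)
  note \<alpha>' = finite_acD[OF \<alpha>]
  interpret finite_measure \<alpha> by fact
  have oV: "open V" using ball_chain_props[OF step.hyps(1) assms(2-4)] by blast
  let ?B = "ball z r"
  have BD: "?B \<subseteq> D" and VD: "V \<subseteq> D" using step.prems(1) by auto
  obtain c where c: "c \<in> ?B" "c \<in> V" using step.hyps(3) by blast
  obtain g where g: "bounded_lipschitz g" "\<And>x. x \<notin> ?B \<Longrightarrow> g x = 0"
    "\<And>x. x \<in> ?B \<Longrightarrow> ((\<lambda>s. flow g s x) \<longlongrightarrow> c) at_top"
    using attracting_field[OF open_ball bounded_ball convex_ball c(1)] by blast
  have m: "{x\<in>?B. flow g s x \<in> V} \<in> sets borel" for s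
  proof -
    have "flow g s \<in> borel_measurable borel" using flow_lipschitz[OF g(1)] lipschitz_borel by blast
    from measurable_sets_borel[OF this, of V] show ?thesis using oV by (simp add: Collect_conj_eq vimage_def)
  qed
  have "(\<lambda>n. measure \<alpha> {x\<in>?B. flow g (real n) x \<in> V}) \<longlonglongrightarrow> measure \<alpha> {x\<in>?B. c \<in> V}"
    by (rule attracted_mass_tendsto[OF \<alpha> g(1) open_ball oV _ c(2) oV g(3)]) auto
  moreover have "{x\<in>?B. c \<in> V} = ?B" using c(2) by auto
  ultimately have "(\<lambda>n. measure \<alpha> {x\<in>?B. flow g (real n) x \<in> V}) \<longlonglongrightarrow> measure \<alpha> ?B"
    by (simp only:)
  then have "\<forall>\<^sub>F n in sequentially. measure \<alpha> ?B - \<delta> / 2 < measure \<alpha> {x\<in>?B. flow g (real n) x \<in> V}"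
    using step.prems(3) by (intro order_tendstoD(1)) auto
  then obtain n where n: "measure \<alpha> ?B - \<delta> / 2 < measure \<alpha> {x\<in>?B. flow g (real n) x \<in> V}"
    using eventually_happens'[OF sequentially_bot] by blast
  have t2: "0 < t / 2" "0 < \<delta> / 2" using step.prems by auto
  obtain \<Psi>1 where \<Psi>1: "local_steering ?B (t / 2) \<Psi>1" "\<And>x. x \<in> D \<Longrightarrow> \<Psi>1 x = flow g (real n) x"
    using local_flow[OF g(1,2) BD _ t2(1), of "real n"] by auto
  have s1: "steerable v \<omega> R M (t / 2) \<Psi>1" using \<Psi>1(1) unfolding local_steering_def by blast
  note push1 = steerable_push[OF \<alpha> s1]
  obtain \<Psi>2 where \<Psi>2: "steerable v \<omega> R M (t / 2) \<Psi>2"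
    "measure (distr \<alpha> borel \<Psi>1) {x\<in>V. \<Psi>2 x \<notin> B0} < \<delta> / 2"
    using step.IH[OF VD push1(1) t2(2,1)] by blast
  \<comment> \<open>The two ways to fail: points of the ball that miss \<open>V\<close> in the first
    motion, and points that reach \<open>V\<close> but are lost in the second.\<close>
  define S1 where "S1 = ?B - {x\<in>?B. flow g (real n) x \<in> V}"
  define S2 where "S2 = {x. \<Psi>1 x \<in> {y\<in>V. \<Psi>2 y \<notin> B0}}"
  have mS2': "{y\<in>V. \<Psi>2 y \<notin> B0} \<in> sets borel"
    using steerable_push(4)[OF \<alpha> \<Psi>2(1), of "- B0"] oV assms(2) by (simp add: Collect_conj_eq)
  have mS: "S1 \<in> sets \<alpha>" "S2 \<in> sets \<alpha>"
    unfolding S1_def S2_def \<alpha>'(2) using m push1(4)[OF mS2'] by auto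
  have S1: "measure \<alpha> S1 < \<delta> / 2"
    unfolding S1_def using n m[of "real n"] by (subst finite_measure_Diff) (auto simp: \<alpha>'(2))
  have S2: "measure \<alpha> S2 < \<delta> / 2"
    using \<Psi>2(2) push1(3)[OF mS2'] unfolding S2_def by simp
  have "{x\<in>?B \<union> V. \<Psi>2 (\<Psi>1 x) \<notin> B0} \<subseteq> S1 \<union> S2"
  proof
    fix x assume x: "x \<in> {x\<in>?B \<union> V. \<Psi>2 (\<Psi>1 x) \<notin> B0}"
    show "x \<in> S1 \<union> S2"
    proof (cases "x \<in> ?B")
      case True
      then show ?thesis using x \<Psi>1(2)[of x] BD unfolding S1_def S2_def by auto
    next
      case False
      then have "\<Psi>1 x = x" using \<Psi>1(1) x VD unfolding local_steering_def by blast
      then show ?thesis using False x unfolding S2_def by auto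
    qed
  qed
  then have "measure \<alpha> {x\<in>?B \<union> V. \<Psi>2 (\<Psi>1 x) \<notin> B0} \<le> measure \<alpha> (S1 \<union> S2)"
    using mS by (intro finite_measure_mono) auto
  also have "\<dots> \<le> measure \<alpha> S1 + measure \<alpha> S2" using mS by (intro measure_Un_le) auto
  also have "\<dots> < \<delta>" using S1 S2 by simp
  finally have "measure \<alpha> {x\<in>?B \<union> V. \<Psi>2 (\<Psi>1 x) \<notin> B0} < \<delta>" .
  moreover have "steerable v \<omega> R M (t / 2 + t / 2) (\<lambda>x. \<Psi>2 (\<Psi>1 x))"
    by (rule steerable_compose[OF \<Psi>2(1) s1])
  then have "steerable v \<omega> R M t (\<lambda>x. \<Psi>2 (\<Psi>1 x))" by simp
  ultimately show ?case by (intro exI[of _ "\<lambda>x. \<Psi>2 (\<Psi>1 x)"]) blast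
qed

end

section \<open>Transport maps and the Wasserstein distance\<close>

text \<open>Digits \<open>0, 1\<close> in base 4 leave gaps, so that the bits can be read off the sum measurably.\<close>

lemma base4_digits:
  fixes b :: "nat \<Rightarrow> bool"
  shows "odd \<lfloor>4 ^ Suc n * (\<Sum>m. of_bool (b m) / 4 ^ Suc m :: real)\<rfloor> \<longleftrightarrow> b n"
proof -
  define Y where "Y b = (\<Sum>m. of_bool (b m) / 4 ^ Suc m :: real)" for b :: "nat \<Rightarrow> bool"
  have geo: "(\<lambda>m. 1 / 4 ^ Suc m :: real) sums (1 / 3)"
    using sums_mult[OF geometric_sums[of "1 / 4 :: real"], of "1 / 4"] by (simp add: power_divide)
  have sm: "summable (\<lambda>m. of_bool (b m) / 4 ^ Suc m :: real)" for b :: "nat \<Rightarrow> bool"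
    by (rule summable_comparison_test[OF _ sums_summable[OF geo]]) (auto intro!: exI[of _ 0])
  have Y01: "0 \<le> Y b" "Y b < 1" for b
  proof -
    show "0 \<le> Y b" unfolding Y_def by (rule suminf_nonneg[OF sm]) simp
    have "Y b \<le> (\<Sum>m. 1 / 4 ^ Suc m)"
      unfolding Y_def by (rule suminf_le[OF _ sm sums_summable[OF geo]]) simp
    then show "Y b < 1" using sums_unique[OF geo] by simp
  qed
  have rec: "4 * Y b = of_bool (b 0) + Y (\<lambda>m. b (Suc m))" for b
  proof -
    have "Y b = of_bool (b 0) / 4 + (\<Sum>m. of_bool (b (Suc m)) / 4 ^ Suc (Suc m))"
      unfolding Y_def using suminf_split_head[OF sm[of b]] by simp
    also have "(\<Sum>m. of_bool (b (Suc m)) / 4 ^ Suc (Suc m)) = (\<Sum>m. (1 / 4) * (of_bool (b (Suc m)) / 4 ^ Suc m) :: real)"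
      by (rule arg_cong[where f = suminf]) (simp add: fun_eq_iff)
    also have "\<dots> = (1 / 4) * Y (\<lambda>m. b (Suc m))"
      unfolding Y_def by (rule suminf_mult[OF sm])
    finally show ?thesis by simp
  qed
  have "odd \<lfloor>4 ^ Suc n * Y b\<rfloor> \<longleftrightarrow> b n" for b
  proof (induction n arbitrary: b)
    case 0
    have "\<lfloor>4 * Y b\<rfloor> = of_bool (b 0)"
      unfolding rec using Y01[of "\<lambda>m. b (Suc m)"] by (auto simp: floor_eq_iff)
    then show ?case by simp
  next
    case (Suc n)
    have "4 ^ Suc (Suc n) * Y b = 4 ^ Suc n * (4 * Y b)" by simp
    also have "\<dots> = 4 ^ Suc n * Y (\<lambda>m. b (Suc m)) + of_int (4 ^ Suc n * of_bool (b 0))"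
      unfolding rec by (simp add: algebra_simps)
    \<comment> \<open>The added multiple of a positive power of 4 is an even integer, so the parity
      of the floor is decided by the shifted sequence.\<close>
    finally have "\<lfloor>4 ^ Suc (Suc n) * Y b\<rfloor> = \<lfloor>4 ^ Suc n * Y (\<lambda>m. b (Suc m))\<rfloor> + 4 ^ Suc n * of_bool (b 0)"
      using floor_add_int by metis
    then show ?case using Suc.IH[of "\<lambda>m. b (Suc m)"] by simp
  qed
  then show ?thesis unfolding Y_def .
qed

text \<open>A point is coded by the bits \<open>q < x \<bullet> i\<close> for rational \<open>q\<close> and basis vectors \<open>i\<close>.\<close>

lemma borel_coding:
  "\<exists>h k. h \<in> borel_measurable borel \<and> k \<in> borel_measurable borel \<and> (\<forall>x::'a::euclidean_space. k (h x :: real) = x)"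
proof -
  define e where "e = from_nat_into ((Basis :: 'a set) \<times> (\<rat> :: real set))"
  have cI: "countable ((Basis :: 'a set) \<times> (\<rat> :: real set))"
    by (intro countable_SIGMA countable_finite finite_Basis countable_rat)
  have neI: "(Basis :: 'a set) \<times> (\<rat> :: real set) \<noteq> {}" by (auto intro: Rats_0)
  have range_e: "range e = Basis \<times> \<rat>"
    unfolding e_def by (rule range_from_nat_into[OF neI cI])
  define h where "h x = (\<Sum>n. of_bool (snd (e n) < x \<bullet> fst (e n)) / 4 ^ Suc n :: real)" for x :: 'a
  define bit where "bit n y \<longleftrightarrow> odd \<lfloor>4 ^ Suc n * y\<rfloor>" for n and y :: real
  \<comment> \<open>A coordinate is the supremum of the rationals below it. Extended reals, with
    \<open>-\<infinity>\<close> for the other pairs, keep the supremum meaningful for arbitrary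
    codes \<open>y\<close>.\<close>
  define c where "c i y = (SUP n. if fst (e n) = i \<and> bit n y then ereal (snd (e n)) else -\<infinity>)" for i and y :: real
  define k where "k y = (\<Sum>i\<in>Basis. real_of_ereal (c i y) *\<^sub>R i)" for y
  have bit: "bit n (h x) \<longleftrightarrow> snd (e n) < x \<bullet> fst (e n)" for n x
    unfolding bit_def h_def by (rule base4_digits)
  have ci: "c i (h x) = ereal (x \<bullet> i)" if i: "i \<in> Basis" for i x
  proof (rule antisym)
    show "c i (h x) \<le> ereal (x \<bullet> i)"
      unfolding c_def bit by (rule SUP_least) auto
    show "ereal (x \<bullet> i) \<le> c i (h x)"
    proof (rule ereal_le_real)
      fix z assume "c i (h x) \<le> ereal z"
      show "ereal (x \<bullet> i) \<le> ereal z"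
      proof (rule ccontr)
        assume "\<not> ereal (x \<bullet> i) \<le> ereal z"
        then have "z < x \<bullet> i" by simp
        then obtain q where q: "q \<in> \<rat>" "z < q" "q < x \<bullet> i" using Rats_dense_in_real by blast
        have "(i, q) \<in> range e" using range_e i q(1) by simp
        then obtain n where n: "e n = (i, q)" by (metis imageE)
        have "ereal q \<le> c i (h x)"
          unfolding c_def bit using n q(3) by (intro SUP_upper2[of n]) auto
        then show False using \<open>c i (h x) \<le> ereal z\<close> q(2) by (metis ereal_less_eq(3) not_le order_trans)
      qed
    qed
  qed
  have "k (h x) = x" for x
    unfolding k_def using ci by (simp add: euclidean_representation)
  moreover have "h \<in> borel_measurable borel"
    unfolding h_def by measurable
  moreover have "k \<in> borel_measurable borel"
  proof -
    have [measurable]: "Measurable.pred borel (bit n)" for n unfolding bit_def by measurable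
    have "c i \<in> borel_measurable borel" for i unfolding c_def by measurable
    then show ?thesis unfolding k_def by measurable
  qed
  ultimately show ?thesis by blast
qed

text \<open>Monotone rearrangement: an atomless law is sent to the uniform one by its distribution
  function, and the quantile function of \<open>N\<close> sends that to \<open>N\<close>. Since
  \<open>M\<close> is the image of the uniform law under its own quantile \<open>IM\<close>, it
  suffices that \<open>T\<close> composed with \<open>IM\<close> is \<open>IN\<close> on the open
  unit interval.\<close>

lemma real_transport:
  assumes M: "real_distribution M" and N: "real_distribution N" and atom: "\<And>x. measure M {x} = 0"
  shows "\<exists>T \<in> borel_measurable borel. distr M borel T = N"
proof -
  interpret M: cdf_distribution M unfolding cdf_distribution_def by fact
  interpret N: cdf_distribution N unfolding cdf_distribution_def by fact
  let ?\<Omega> = "restrict_space lborel {0<..<1} :: real measure"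
  define IM where "IM u = Inf {x. u \<le> cdf M x}" for u
  define IN where "IN u = Inf {x. u \<le> cdf N x}" for u
  \<comment> \<open>Where the distribution function is 0 or 1, the set in the infimum may be
    unbounded below or empty; an arbitrary value is used there.\<close>
  define T where "T x = (if cdf M x \<in> {0<..<1} then IN (cdf M x) else 0)" for x
  have cont: "isCont (cdf M) x" for x using M.isCont_cdf atom by simp
  have inv: "cdf M (IM u) = u" if u: "0 < u" "u < 1" for u
  proof (rule antisym)
    have pseudo: "u \<le> cdf M x \<longleftrightarrow> IM u \<le> x" for x
      unfolding IM_def by (rule M.pseudoinverse[OF u])
    then show "u \<le> cdf M (IM u)" by simp
    \<comment> \<open>Strictly left of the quantile the distribution function is at most
      \<open>u\<close>; continuity carries this bound to the quantile itself.\<close>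
    have "((\<lambda>x. cdf M x) \<longlongrightarrow> cdf M (IM u)) (at_left (IM u))"
      using cont[of "IM u"] unfolding isCont_def by (rule filterlim_mono[OF _ order_refl at_le]) simp
    moreover have "cdf M x \<le> u" if "x < IM u" for x using pseudo[of x] that by linarith
    then have "\<forall>\<^sub>F x in at_left (IM u). cdf M x \<le> u"
      by (intro eventually_at_leftI[of "IM u - 1"]) simp_all
    ultimately show "cdf M (IM u) \<le> u"
      by (intro tendsto_upperbound[of "cdf M"]) (auto simp: trivial_limit_at_left_real)
  qed
  have IN0: "(\<lambda>u. if u \<in> {0<..<1} then IN u else 0) \<in> borel_measurable borel"
    using N.measurable_CI unfolding IN_def
    by (subst (asm) measurable_restrict_space_iff[where c = 0]) auto
  have T: "T \<in> borel_measurable borel"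
    using measurable_compose[OF M.measurable_C IN0] by (simp add: T_def[abs_def])
  have IMm: "IM \<in> measurable ?\<Omega> borel"
    using M.measurable_CI unfolding IM_def[abs_def] by (simp cong: measurable_cong_sets add: sets_restrict_space)
  have "distr M borel T = distr (distr ?\<Omega> borel IM) borel T"
    using M.distr_I_eq_M unfolding IM_def[abs_def] by simp
  also have "\<dots> = distr ?\<Omega> borel (T \<circ> IM)"
    by (rule distr_distr[OF T IMm])
  also have "\<dots> = distr ?\<Omega> borel IN"
    by (rule distr_cong) (auto simp: space_restrict_space T_def inv)
  also have "\<dots> = N"
    using N.distr_I_eq_M unfolding IN_def[abs_def] .
  finally show ?thesis using T by blast
qed

section \<open>Transport between measures of equal mass\<close>

lemma scale_measure_prob:
  assumes "finite_measure \<alpha>" "measure \<alpha> (space \<alpha>) > 0"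
  shows "prob_space (scale_measure (ennreal (1 / measure \<alpha> (space \<alpha>))) \<alpha>)"
proof (rule prob_spaceI)
  interpret finite_measure \<alpha> by fact
  show "emeasure (scale_measure (ennreal (1 / measure \<alpha> (space \<alpha>))) \<alpha>) (space (scale_measure (ennreal (1 / measure \<alpha> (space \<alpha>))) \<alpha>)) = 1"
    using assms(2) by (simp add: emeasure_eq_measure space_scale_measure flip: ennreal_mult)
qed

text \<open>A single coordinate already has an atomless law under \<alpha>, which can be mapped onto
  the law of a real code of \<nu>; decoding gives the map. No size of displacement is claimed:
  smallness will come from confining source and target to a common cell.\<close>

lemma transport_exists:
  fixes \<alpha> \<nu> :: "'a::euclidean_space measure"
  assumes \<alpha>: "finite_measure \<alpha>" "sets \<alpha> = sets borel" and \<nu>: "finite_measure \<nu>" "sets \<nu> = sets borel"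
    and null: "\<And>i c. i \<in> Basis \<Longrightarrow> measure \<alpha> {x. x \<bullet> i = c} = 0"
    and mass: "measure \<alpha> UNIV = measure \<nu> UNIV"
  shows "\<exists>\<gamma> \<in> borel_measurable borel. distr \<alpha> borel \<gamma> = \<nu>"
proof -
  have sp: "space \<alpha> = UNIV" "space \<nu> = UNIV"
    using sets_eq_imp_space_eq[OF \<alpha>(2)] sets_eq_imp_space_eq[OF \<nu>(2)] by auto
  interpret A: finite_measure \<alpha> by fact
  interpret N: finite_measure \<nu> by fact
  show ?thesis
  proof (cases "measure \<alpha> UNIV = 0")
    case True
    have "measure \<alpha> E = 0" for E
      using A.bounded_measure[of E] True measure_nonneg[of \<alpha> E] unfolding sp by linarith
    moreover have "measure \<nu> E = 0" for E
      using N.bounded_measure[of E] True mass measure_nonneg[of \<nu> E] unfolding sp by linarith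
    ultimately have "distr \<alpha> borel (\<lambda>x. 0) = \<nu>"
      using \<alpha>(2) \<nu>(2) by (intro measure_eqI) (auto simp: emeasure_distr A.emeasure_eq_measure N.emeasure_eq_measure)
    then show ?thesis by (intro bexI[of _ "\<lambda>x. 0"]) auto
  next
    case False
    then have pos: "measure \<alpha> UNIV > 0" by (simp add: zero_less_measure_iff)
    define r where "r = ennreal (1 / measure \<alpha> UNIV)"
    let ?\<alpha> = "scale_measure r \<alpha>" and ?\<nu> = "scale_measure r \<nu>"
    have pr: "prob_space ?\<alpha>" "prob_space ?\<nu>"
      using scale_measure_prob[OF \<alpha>(1)] scale_measure_prob[OF \<nu>(1)] pos mass sp by (auto simp: r_def)
    obtain h k where hk: "h \<in> borel_measurable borel" "k \<in> borel_measurable borel" "\<And>x::'a. k (h x :: real) = x"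
      using borel_coding by blast
    obtain i :: 'a where i: "i \<in> Basis" using nonempty_Basis by blast
    have hm: "h \<in> borel_measurable ?\<nu>" and im: "(\<lambda>x. x \<bullet> i) \<in> borel_measurable ?\<alpha>"
      using hk(1) \<alpha>(2) \<nu>(2) by (simp_all cong: measurable_cong_sets)
    have 1: "real_distribution (distr ?\<alpha> borel (\<lambda>x. x \<bullet> i))"
      by (intro real_distribution.intro real_distribution_axioms.intro prob_space.prob_space_distr[OF pr(1) im]) auto
    have 2: "real_distribution (distr ?\<nu> borel h)"
      by (intro real_distribution.intro real_distribution_axioms.intro prob_space.prob_space_distr[OF pr(2) hm]) auto
    have "measure (distr ?\<alpha> borel (\<lambda>x. x \<bullet> i)) {c} = 0" for c
    proof -
      have "measure (distr ?\<alpha> borel (\<lambda>x. x \<bullet> i)) {c} = measure ?\<alpha> {x. x \<bullet> i = c}"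
        using im sp by (subst measure_distr) (auto simp: space_scale_measure vimage_def)
      also have "\<dots> = 0"
      proof -
        have "emeasure \<alpha> {x. x \<bullet> i = c} = 0" using null[OF i, of c] by (simp add: A.emeasure_eq_measure)
        then show ?thesis by (simp add: measure_def)
      qed
      finally show ?thesis .
    qed
    from real_transport[OF 1 2 this] obtain T where T: "T \<in> borel_measurable borel"
      "distr (distr ?\<alpha> borel (\<lambda>x. x \<bullet> i)) borel T = distr ?\<nu> borel h" by blast
    define \<gamma> where "\<gamma> x = k (T (x \<bullet> i))" for x
    have \<gamma>: "\<gamma> \<in> borel_measurable borel"
      unfolding \<gamma>_def by (intro measurable_compose[OF _ hk(2)] measurable_compose[OF _ T(1)]) simp
    have "distr ?\<alpha> borel \<gamma> = distr (distr (distr ?\<alpha> borel (\<lambda>x. x \<bullet> i)) borel T) borel k"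
      using im T(1) hk(2) by (simp add: distr_distr \<gamma>_def[abs_def] o_def)
    also have "\<dots> = distr ?\<nu> borel (\<lambda>x. k (h x))"
      unfolding T(2) using hm hk(2) by (simp add: distr_distr o_def)
    finally have eq: "distr ?\<alpha> borel \<gamma> = distr ?\<nu> borel (\<lambda>x. x)" using hk(3) by simp
    have r0: "r \<noteq> 0" "r \<noteq> \<top>" using pos by (auto simp: r_def)
    have "distr \<alpha> borel \<gamma> = \<nu>"
    proof (rule measure_eqI)
      show "sets (distr \<alpha> borel \<gamma>) = sets \<nu>" using \<nu>(2) by simp
      fix E assume "E \<in> sets (distr \<alpha> borel \<gamma>)"
      then have E: "E \<in> sets borel" by simp
      have \<gamma>m: "\<gamma> \<in> measurable \<alpha> borel" "\<gamma> \<in> measurable ?\<alpha> borel" "(\<lambda>x. x) \<in> measurable ?\<nu> borel"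
        using \<gamma> \<alpha>(2) \<nu>(2) by (simp_all cong: measurable_cong_sets)
      have "emeasure (distr ?\<alpha> borel \<gamma>) E = r * emeasure (distr \<alpha> borel \<gamma>) E"
        using E \<gamma>m by (simp add: emeasure_distr space_scale_measure)
      moreover have "emeasure (distr ?\<nu> borel (\<lambda>x. x)) E = r * emeasure \<nu> E"
        using E \<gamma>m sp by (simp add: emeasure_distr space_scale_measure)
      ultimately have "r * emeasure (distr \<alpha> borel \<gamma>) E = r * emeasure \<nu> E" using eq by simp
      then show "emeasure (distr \<alpha> borel \<gamma>) E = emeasure \<nu> E"
        using r0 by (simp add: ennreal_mult_cancel_left)
    qed
    then show ?thesis using \<gamma> by blast
  qed
qed

text \<open>Restriction by indicator densities keeps both measures on the whole space, where the
  preceding transport applies.\<close>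

lemma transport_pieces:
  fixes \<mu> \<nu> :: "'a::euclidean_space measure"
  assumes \<mu>: "finite_ac \<mu>" and \<nu>: "finite_measure \<nu>" "sets \<nu> = sets borel"
    and E: "P \<in> sets borel" "Q \<in> sets borel" "measure \<mu> P = measure \<nu> Q"
  shows "\<exists>\<gamma> \<in> borel_measurable borel. \<forall>A\<in>sets borel. emeasure \<mu> (P \<inter> \<gamma> -` A) = emeasure \<nu> (Q \<inter> A)"
proof -
  note \<mu>' = finite_acD[OF \<mu>]
  interpret M: finite_measure \<mu> by fact
  interpret N: finite_measure \<nu> by fact
  let ?\<mu> = "density \<mu> (indicator P)" and ?\<nu> = "density \<nu> (indicator Q)"
  have e\<mu>: "emeasure ?\<mu> A = emeasure \<mu> (P \<inter> A)" if "A \<in> sets borel" for A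
    using E(1) that \<mu>'(2) by (simp add: emeasure_restricted)
  have e\<nu>: "emeasure ?\<nu> A = emeasure \<nu> (Q \<inter> A)" if "A \<in> sets borel" for A
    using E(2) that \<nu>(2) by (simp add: emeasure_restricted)
  have sp: "space \<nu> = UNIV" using sets_eq_imp_space_eq[OF \<nu>(2)] by simp
  have fm: "finite_measure ?\<mu>" "finite_measure ?\<nu>"
    using e\<mu>[of UNIV] e\<nu>[of UNIV] sp \<mu>'(3) by (auto intro!: finite_measureI)
  have "measure ?\<mu> {x. x \<bullet> i = c} = 0" if "i \<in> Basis" for i c
  proof -
    have "{x. x \<bullet> i = c} \<in> null_sets \<mu>" by (rule \<mu>'(4)[OF hyperplane_null[OF that]])
    moreover have "{x::'a. x \<bullet> i = c} \<in> sets borel" by measurable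
    ultimately show ?thesis
      using e\<mu>[of "{x. x \<bullet> i = c}"] null_set_Int1[of "{x. x \<bullet> i = c}" \<mu> P] E(1) \<mu>'(2)
      by (simp add: measure_def null_sets_def Int_commute)
  qed
  moreover have "measure ?\<mu> UNIV = measure ?\<nu> UNIV"
    using E(3) e\<mu>[of UNIV] e\<nu>[of UNIV] by (simp add: measure_def)
  ultimately obtain \<gamma> where \<gamma>: "\<gamma> \<in> borel_measurable borel" "distr ?\<mu> borel \<gamma> = ?\<nu>"
    using transport_exists[OF fm(1) _ fm(2)] \<mu>'(2) \<nu>(2) by auto
  have "emeasure \<mu> (P \<inter> \<gamma> -` A) = emeasure \<nu> (Q \<inter> A)" if A: "A \<in> sets borel" for A
  proof -
    have "emeasure \<mu> (P \<inter> \<gamma> -` A) = emeasure ?\<mu> (\<gamma> -` A)"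
      using e\<mu> measurable_sets_borel[OF \<gamma>(1) A] by simp
    also have "\<dots> = emeasure (distr ?\<mu> borel \<gamma>) A"
      using \<gamma>(1) A \<mu>'(2,3) by (subst emeasure_distr) (auto cong: measurable_cong_sets)
    also have "\<dots> = emeasure \<nu> (Q \<inter> A)" unfolding \<gamma>(2) by (rule e\<nu>[OF A])
    finally show ?thesis .
  qed
  then show ?thesis using \<gamma>(1) by blast
qed

text \<open>Sweeping \<open>E\<close> by half spaces changes the mass continuously, since
  hyperplanes are null; the two extreme values are taken by the empty set and by
  \<open>E\<close>.\<close>

lemma subset_of_mass:
  fixes \<mu> :: "'a::euclidean_space measure"
  assumes \<mu>: "finite_ac \<mu>" and E: "E \<in> sets borel" and m: "0 \<le> m" "m \<le> measure \<mu> E"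
  shows "\<exists>E'\<in>sets borel. E' \<subseteq> E \<and> measure \<mu> E' = m"
proof -
  note \<mu>' = finite_acD[OF \<mu>]
  interpret finite_measure \<mu> by fact
  obtain i :: 'a where i: "i \<in> Basis" using nonempty_Basis by blast
  define f where "f s = measure \<mu> {x\<in>E. x \<bullet> i \<le> s}" for s
  have ms: "{x\<in>E. x \<bullet> i \<le> s} \<in> sets borel" for s
  proof -
    have "{x. x \<bullet> i \<le> s} \<in> sets borel" by measurable
    then show ?thesis using E by (simp add: Collect_conj_eq)
  qed
  have cont: "continuous_on S f" for S
  proof (rule continuous_on_sequentiallyI)
    fix u :: "nat \<Rightarrow> real" and a assume u: "u \<longlonglongrightarrow> a"
    have "AE x in \<mu>. x \<notin> {x. x \<bullet> i = a}" by (rule AE_not_in[OF \<mu>'(4)[OF hyperplane_null[OF i]]])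
    then have "AE x in \<mu>. \<forall>\<^sub>F n in sequentially. x \<in> {x\<in>E. x \<bullet> i \<le> u n} \<longleftrightarrow> x \<in> {x\<in>E. x \<bullet> i \<le> a}"
    proof eventually_elim
      fix x assume "x \<notin> {x. x \<bullet> i = a}"
      then consider "x \<bullet> i < a" | "a < x \<bullet> i" by fastforce
      then show "\<forall>\<^sub>F n in sequentially. x \<in> {x\<in>E. x \<bullet> i \<le> u n} \<longleftrightarrow> x \<in> {x\<in>E. x \<bullet> i \<le> a}"
      proof cases
        case 1
        from order_tendstoD(1)[OF u 1] show ?thesis by eventually_elim (use 1 in auto)
      next
        case 2
        from order_tendstoD(2)[OF u 2] show ?thesis by eventually_elim (use 2 in auto)
      qed
    qed
    then show "(\<lambda>n. f (u n)) \<longlonglongrightarrow> f a"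
      unfolding f_def using ms \<mu>'(2) by (intro measure_tendsto_AE) (auto intro: finite_measure_axioms)
  qed
  have lim1: "(\<lambda>n. f (real n)) \<longlonglongrightarrow> measure \<mu> E"
    unfolding f_def
  proof (rule measure_tendsto_AE)
    show "AE x in \<mu>. \<forall>\<^sub>F n in sequentially. x \<in> {x\<in>E. x \<bullet> i \<le> real n} \<longleftrightarrow> x \<in> E"
    proof (rule AE_I2)
      fix x
      have "\<forall>\<^sub>F n in sequentially. x \<bullet> i \<le> real n"
        using filterlim_real_sequentially unfolding filterlim_at_top by blast
      then show "\<forall>\<^sub>F n in sequentially. x \<in> {x\<in>E. x \<bullet> i \<le> real n} \<longleftrightarrow> x \<in> E"
        by eventually_elim auto
    qed
  qed (use ms E \<mu>'(2) finite_measure_axioms in auto)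
  have lim2: "(\<lambda>n. f (- real n)) \<longlonglongrightarrow> measure \<mu> {}"
    unfolding f_def
  proof (rule measure_tendsto_AE)
    show "AE x in \<mu>. \<forall>\<^sub>F n in sequentially. x \<in> {x\<in>E. x \<bullet> i \<le> - real n} \<longleftrightarrow> x \<in> {}"
    proof (rule AE_I2)
      fix x
      have "\<forall>\<^sub>F n in sequentially. - (x \<bullet> i) + 1 \<le> real n"
        using filterlim_real_sequentially unfolding filterlim_at_top by blast
      then show "\<forall>\<^sub>F n in sequentially. x \<in> {x\<in>E. x \<bullet> i \<le> - real n} \<longleftrightarrow> x \<in> {}"
        by eventually_elim auto
    qed
  qed (use ms E \<mu>'(2) finite_measure_axioms in auto)
  consider "m = 0" | "m = measure \<mu> E" | "0 < m" "m < measure \<mu> E" using m by linarith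
  then show ?thesis
  proof cases
    case 1 then show ?thesis by (intro bexI[of _ "{}"]) auto
  next
    case 2 then show ?thesis using E by blast
  next
    case 3
    have "\<forall>\<^sub>F n in sequentially. m < f (real n) \<and> f (- real n) < m"
      using order_tendstoD(1)[OF lim1 3(2)] order_tendstoD(2)[OF lim2, of m] 3(1) by (simp add: eventually_conj)
    then obtain n where "m < f (real n)" "f (- real n) < m"
      using eventually_happens'[OF sequentially_bot] by blast
    then have "\<exists>s\<ge>- real n. s \<le> real n \<and> f s = m"
      by (intro IVT' cont) auto
    then obtain s where "f s = m" by blast
    then show ?thesis using ms[of s] by (intro bexI[of _ "{x\<in>E. x \<bullet> i \<le> s}"]) (auto simp: f_def)
  qed
qed

text \<open>The maps on the pieces are known only through masses, so \<open>g j\<close> may leave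
  \<open>Q j\<close> on a null part of \<open>P j\<close>; this is why the localization is stated
  almost everywhere.\<close>

lemma glue_transport:
  fixes \<mu> \<nu> :: "'a::euclidean_space measure" and P Q :: "'i \<Rightarrow> 'a set"
  assumes \<mu>: "finite_ac \<mu>" and \<nu>: "finite_measure \<nu>" "sets \<nu> = sets borel" and J: "finite J"
    and P: "\<And>j. j \<in> J \<Longrightarrow> P j \<in> sets borel" "disjoint_family_on P J" "(\<Union>j\<in>J. P j) = UNIV"
    and Q: "\<And>j. j \<in> J \<Longrightarrow> Q j \<in> sets borel" "disjoint_family_on Q J" "(\<Union>j\<in>J. Q j) = UNIV"
    and PQ: "\<And>j. j \<in> J \<Longrightarrow> measure \<mu> (P j) = measure \<nu> (Q j)"
  shows "\<exists>\<gamma> \<in> borel_measurable borel. distr \<mu> borel \<gamma> = \<nu> \<and> (\<forall>j\<in>J. AE x in \<mu>. x \<in> P j \<longrightarrow> \<gamma> x \<in> Q j)"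
proof -
  note \<mu>' = finite_acD[OF \<mu>]
  interpret M: finite_measure \<mu> by fact
  interpret N: finite_measure \<nu> by fact
  have "\<exists>g \<in> borel_measurable borel. \<forall>A\<in>sets borel. emeasure \<mu> (P j \<inter> g -` A) = emeasure \<nu> (Q j \<inter> A)"
    if "j \<in> J" for j by (rule transport_pieces[OF \<mu> \<nu> P(1)[OF that] Q(1)[OF that] PQ[OF that]])
  then obtain g where g: "\<And>j. j \<in> J \<Longrightarrow> g j \<in> borel_measurable borel"
    "\<And>j A. j \<in> J \<Longrightarrow> A \<in> sets borel \<Longrightarrow> emeasure \<mu> (P j \<inter> g j -` A) = emeasure \<nu> (Q j \<inter> A)" by metis
  define \<gamma> where "\<gamma> x = (\<Sum>j\<in>J. indicat_real (P j) x *\<^sub>R g j x)" for x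
  have \<gamma>P: "\<gamma> x = g j x" if "j \<in> J" "x \<in> P j" for j x
  proof -
    have "\<gamma> x = (\<Sum>k\<in>J. if k = j then g j x else 0)"
      unfolding \<gamma>_def
    proof (rule sum.cong[OF refl])
      fix k assume "k \<in> J"
      then have "k \<noteq> j \<Longrightarrow> x \<notin> P k" using P(2) that unfolding disjoint_family_on_def by blast
      then show "indicat_real (P k) x *\<^sub>R g k x = (if k = j then g j x else 0)"
        using that(2) by (auto simp: indicator_def)
    qed
    then show ?thesis using J that(1) by simp
  qed
  have \<gamma>: "\<gamma> \<in> borel_measurable borel"
    unfolding \<gamma>_def using g(1) P(1) by (intro borel_measurable_sum borel_measurable_scaleR borel_measurable_indicator) auto
  have "distr \<mu> borel \<gamma> = \<nu>"
  proof (rule measure_eqI)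
    show "sets (distr \<mu> borel \<gamma>) = sets \<nu>" using \<nu>(2) by simp
    fix A assume "A \<in> sets (distr \<mu> borel \<gamma>)"
    then have A: "A \<in> sets borel" by simp
    have \<gamma>m: "\<gamma> \<in> measurable \<mu> borel" using \<gamma> \<mu>'(2) by (simp cong: measurable_cong_sets)
    have "emeasure (distr \<mu> borel \<gamma>) A = emeasure \<mu> (\<gamma> -` A)"
      using A \<mu>'(3) by (simp add: emeasure_distr[OF \<gamma>m])
    also have "\<gamma> -` A = (\<Union>j\<in>J. P j \<inter> g j -` A)"
      using P(3) \<gamma>P by fastforce
    also have "emeasure \<mu> \<dots> = (\<Sum>j\<in>J. emeasure \<mu> (P j \<inter> g j -` A))"
    proof (rule sum_emeasure[symmetric, OF _ _ J])
      show "(\<lambda>j. P j \<inter> g j -` A) ` J \<subseteq> sets \<mu>"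
        using P(1) measurable_sets_borel[OF g(1) A] \<mu>'(2) by auto
      show "disjoint_family_on (\<lambda>j. P j \<inter> g j -` A) J"
        using P(2) unfolding disjoint_family_on_def by blast
    qed
    also have "\<dots> = (\<Sum>j\<in>J. emeasure \<nu> (Q j \<inter> A))" using g(2) A by simp
    also have "\<dots> = emeasure \<nu> (\<Union>j\<in>J. Q j \<inter> A)"
    proof (rule sum_emeasure[OF _ _ J])
      show "(\<lambda>j. Q j \<inter> A) ` J \<subseteq> sets \<nu>" using Q(1) A \<nu>(2) by auto
      show "disjoint_family_on (\<lambda>j. Q j \<inter> A) J"
        using Q(2) unfolding disjoint_family_on_def by blast
    qed
    also have "(\<Union>j\<in>J. Q j \<inter> A) = A" using Q(3) by blast
    finally show "emeasure (distr \<mu> borel \<gamma>) A = emeasure \<nu> A" .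
  qed
  moreover have "AE x in \<mu>. x \<in> P j \<longrightarrow> \<gamma> x \<in> Q j" if j: "j \<in> J" for j
  proof -
    have "- Q j \<in> sets borel" using Q(1)[OF j] by auto
    then have "emeasure \<mu> (P j \<inter> g j -` (- Q j)) = 0" and "P j \<inter> g j -` (- Q j) \<in> sets \<mu>"
      using g(2)[OF j] P(1)[OF j] measurable_sets_borel[OF g(1)[OF j]] \<mu>'(2) by auto
    then have "AE x in \<mu>. x \<notin> P j \<inter> g j -` (- Q j)" by (intro AE_not_in null_setsI)
    then show ?thesis by eventually_elim (use \<gamma>P[OF j] in auto)
  qed
  ultimately show ?thesis using \<gamma> by blast
qed

text \<open>In each cell the mass \<open>m E\<close> available to both measures is moved within the
  cell, by at most \<eta>; the remaining mass, at most \<kappa>, is moved inside the ball of radius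
  \<open>S\<close>, by at most \<open>2 S\<close>.\<close>

lemma wasserstein_le:
  fixes \<mu> \<nu> :: "'a::euclidean_space measure"
  assumes p: "p \<ge> 1" and \<mu>: "finite_ac \<mu>" "prob_space \<mu>" and \<nu>: "finite_ac \<nu>" "prob_space \<nu>"
    and S: "AE x in \<mu>. norm x \<le> S" "AE x in \<nu>. norm x \<le> S" "0 \<le> S"
    and F: "finite F" "\<And>E. E \<in> F \<Longrightarrow> E \<in> sets borel" "\<And>E E'. E \<in> F \<Longrightarrow> E' \<in> F \<Longrightarrow> E \<noteq> E' \<Longrightarrow> E \<inter> E' = {}"
      "\<And>E x y. E \<in> F \<Longrightarrow> x \<in> E \<Longrightarrow> y \<in> E \<Longrightarrow> norm (x - y) \<le> \<eta>"
    and m: "\<And>E. E \<in> F \<Longrightarrow> 0 \<le> m E" "\<And>E. E \<in> F \<Longrightarrow> m E \<le> measure \<mu> E" "\<And>E. E \<in> F \<Longrightarrow> m E \<le> measure \<nu> E"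
      "1 - \<kappa> \<le> (\<Sum>E\<in>F. m E)" and "0 \<le> \<eta>"
  shows "wasserstein p \<mu> \<nu> \<le> ennreal ((\<eta> powr p + \<kappa> * (2 * S) powr p) powr (1 / p))"
proof -
  note \<mu>' = finite_acD[OF \<mu>(1)] and \<nu>' = finite_acD[OF \<nu>(1)]
  interpret M: prob_space \<mu> by fact
  interpret N: prob_space \<nu> by fact
  obtain P0 where P0: "\<And>E. E \<in> F \<Longrightarrow> P0 E \<in> sets borel \<and> P0 E \<subseteq> E \<and> measure \<mu> (P0 E) = m E"
    using subset_of_mass[OF \<mu>(1) F(2) m(1,2)] by metis
  obtain Q0 where Q0: "\<And>E. E \<in> F \<Longrightarrow> Q0 E \<in> sets borel \<and> Q0 E \<subseteq> E \<and> measure \<nu> (Q0 E) = m E"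
    using subset_of_mass[OF \<nu>(1) F(2) m(1,3)] by metis
  \<comment> \<open>\<open>None\<close> indexes what is left of the space once the selected parts of
    the cells are removed.\<close>
  define ext where "ext R j = (case j of Some E \<Rightarrow> R E | None \<Rightarrow> - (\<Union>E\<in>F. R E))" for R :: "'a set \<Rightarrow> 'a set" and j
  define J where "J = insert None (Some ` F)"
  have J: "finite J" using F(1) by (simp add: J_def)
  have ext: "\<And>j. j \<in> J \<Longrightarrow> ext R j \<in> sets borel" "disjoint_family_on (ext R) J" "(\<Union>j\<in>J. ext R j) = UNIV"
    "measure \<rho> (ext R None) = 1 - (\<Sum>E\<in>F. m E)"
    if R: "\<And>E. E \<in> F \<Longrightarrow> R E \<in> sets borel \<and> R E \<subseteq> E \<and> measure \<rho> (R E) = m E"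
      and \<rho>: "prob_space \<rho>" "sets \<rho> = sets borel" for R and \<rho> :: "'a measure"
  proof -
    interpret R: prob_space \<rho> by fact
    have dR: "disjoint_family_on R F"
      unfolding disjoint_family_on_def using R F(3) by blast
    have UR: "(\<Union>E\<in>F. R E) \<in> sets borel" using F(1) R by auto
    show "ext R j \<in> sets borel" if "j \<in> J" for j
    proof (cases j)
      case None
      then show ?thesis using borel_comp[OF UR] by (simp only: ext_def option.case)
    next
      case (Some E)
      then show ?thesis using that R by (auto simp: ext_def J_def)
    qed
    show "disjoint_family_on (ext R) J"
      using dR unfolding disjoint_family_on_def ext_def J_def by auto
    show "(\<Union>j\<in>J. ext R j) = UNIV" by (auto simp: ext_def J_def)
    have "measure \<rho> (\<Union>E\<in>F. R E) = (\<Sum>E\<in>F. measure \<rho> (R E))"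
      using R \<rho>(2) dR by (intro R.finite_measure_finite_Union[OF F(1)]) auto
    also have "\<dots> = (\<Sum>E\<in>F. m E)" using R by simp
    moreover have "space \<rho> = UNIV" using sets_eq_imp_space_eq[OF \<rho>(2)] by simp
    ultimately show "measure \<rho> (ext R None) = 1 - (\<Sum>E\<in>F. m E)"
      using R.prob_compl[of "\<Union>E\<in>F. R E"] UR \<rho>(2) by (simp add: ext_def Compl_eq_Diff_UNIV)
  qed
  note eP = ext[OF P0 \<mu>(2) \<mu>'(2)] and eQ = ext[OF Q0 \<nu>(2) \<nu>'(2)]
  have "measure \<mu> (ext P0 j) = measure \<nu> (ext Q0 j)" if "j \<in> J" for j
    using that eP(4) eQ(4) P0 Q0 by (auto simp: J_def ext_def)
  from glue_transport[OF \<mu>(1) \<nu>'(1,2) J eP(1-3) eQ(1-3) this]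
  obtain \<gamma> where \<gamma>: "\<gamma> \<in> borel_measurable borel" "distr \<mu> borel \<gamma> = \<nu>"
    "\<And>j. j \<in> J \<Longrightarrow> AE x in \<mu>. x \<in> ext P0 j \<longrightarrow> \<gamma> x \<in> ext Q0 j" by blast
  have \<gamma>m: "\<gamma> \<in> measurable \<mu> borel" using \<gamma>(1) \<mu>'(2) by (simp cong: measurable_cong_sets)
  have "AE x in distr \<mu> borel \<gamma>. norm x \<le> S" unfolding \<gamma>(2) by (rule S(2))
  then have aS: "AE x in \<mu>. norm (\<gamma> x) \<le> S" by (rule AE_distrD[OF \<gamma>m])
  have "AE x in \<mu>. \<forall>j\<in>J. x \<in> ext P0 j \<longrightarrow> \<gamma> x \<in> ext Q0 j"
    using \<gamma>(3) J by (intro AE_finite_allI) auto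
  then have bound: "AE x in \<mu>. norm (\<gamma> x - x) powr p \<le> \<eta> powr p + (2 * S) powr p * indicat_real (ext P0 None) x"
    using aS S(1)
  proof eventually_elim
    fix x assume x: "\<forall>j\<in>J. x \<in> ext P0 j \<longrightarrow> \<gamma> x \<in> ext Q0 j" "norm (\<gamma> x) \<le> S" "norm x \<le> S"
    obtain j where j: "j \<in> J" "x \<in> ext P0 j" using eP(3) by blast
    show "norm (\<gamma> x - x) powr p \<le> \<eta> powr p + (2 * S) powr p * indicat_real (ext P0 None) x"
    proof (cases j)
      case None
      have "norm (\<gamma> x - x) \<le> 2 * S" using x(2,3) norm_triangle_ineq4[of "\<gamma> x" x] by linarith
      then have "norm (\<gamma> x - x) powr p \<le> (2 * S) powr p" using p by (intro powr_mono2) auto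
      then show ?thesis using None j(2) by (simp add: add_increasing)
    next
      case (Some E)
      then have E: "E \<in> F" "x \<in> P0 E" "\<gamma> x \<in> Q0 E" using j x(1) by (auto simp: J_def ext_def)
      then have "norm (\<gamma> x - x) \<le> \<eta>" using P0[OF E(1)] Q0[OF E(1)] by (intro F(4)[OF E(1)]) auto
      then have "norm (\<gamma> x - x) powr p \<le> \<eta> powr p" using p by (intro powr_mono2) auto
      then show ?thesis by (simp add: add_increasing2)
    qed
  qed
  have fm: "(\<lambda>x. norm (\<gamma> x - x) powr p) \<in> borel_measurable \<mu>"
  proof -
    have "(\<lambda>x. x) \<in> borel_measurable \<mu>" using \<mu>'(2) by (simp cong: measurable_cong_sets)
    then have "(\<lambda>x. norm (\<gamma> x - x)) \<in> borel_measurable \<mu>" using \<gamma>m by measurable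
    then show ?thesis by measurable
  qed
  have PNm: "ext P0 None \<in> sets \<mu>" using eP(1)[of None] \<mu>'(2) by (simp add: J_def)
  have int: "integrable \<mu> (\<lambda>x. norm (\<gamma> x - x) powr p)"
  proof (rule M.integrable_const_bound[OF _ fm])
    show "AE x in \<mu>. norm (norm (\<gamma> x - x) powr p) \<le> \<eta> powr p + (2 * S) powr p"
      using bound
    proof eventually_elim
      fix x assume "norm (\<gamma> x - x) powr p \<le> \<eta> powr p + (2 * S) powr p * indicat_real (ext P0 None) x"
      moreover have "(2 * S) powr p * indicat_real (ext P0 None) x \<le> (2 * S) powr p"
        by (simp add: indicator_def)
      ultimately show "norm (norm (\<gamma> x - x) powr p) \<le> \<eta> powr p + (2 * S) powr p" by simp
    qed
  qed
  have int2: "integrable \<mu> (\<lambda>x. \<eta> powr p + (2 * S) powr p * indicat_real (ext P0 None) x)"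
    using PNm by (intro Bochner_Integration.integrable_add integrable_mult_right integrable_const) (auto simp: less_top[symmetric])
  have "(\<integral>x. norm (\<gamma> x - x) powr p \<partial>\<mu>) \<le> (\<integral>x. \<eta> powr p + (2 * S) powr p * indicat_real (ext P0 None) x \<partial>\<mu>)"
    by (rule integral_mono_AE[OF int int2 bound])
  also have "\<dots> = \<eta> powr p + (2 * S) powr p * measure \<mu> (ext P0 None)"
    using PNm by (subst Bochner_Integration.integral_add) (auto simp: M.prob_space less_top[symmetric])
  also have "\<dots> \<le> \<eta> powr p + \<kappa> * (2 * S) powr p"
    using eP(4) m(4) by (simp add: mult.commute mult_right_mono)
  finally have "(\<integral>x. norm (\<gamma> x - x) powr p \<partial>\<mu>) powr (1 / p) \<le> (\<eta> powr p + \<kappa> * (2 * S) powr p) powr (1 / p)"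
    using p by (intro powr_mono2) auto
  then have "ennreal ((\<integral>x. norm (\<gamma> x - x) powr p \<partial>\<mu>) powr (1 / p)) \<le> ennreal ((\<eta> powr p + \<kappa> * (2 * S) powr p) powr (1 / p))"
    by (rule ennreal_leI)
  moreover have "\<gamma> \<in> {\<gamma>. \<gamma> \<in> borel_measurable borel \<and> distr \<mu> borel \<gamma> = \<nu> \<and> integrable \<mu> (\<lambda>x. norm (\<gamma> x - x) powr p)}"
    using \<gamma>(1,2) int by blast
  ultimately show ?thesis
    unfolding wasserstein_def by (rule INF_lower2[rotated])
qed

section \<open>Approximate controllability\<close>

lemma basis_list_exists:
  "\<exists>L. set L \<subseteq> (Basis :: 'a::euclidean_space set) \<and> (\<forall>j\<in>Basis. count_list L j = n)"
proof (induction n)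
  case 0
  then show ?case by (intro exI[of _ "[]"]) simp
next
  case (Suc n)
  then obtain L where L: "set L \<subseteq> (Basis :: 'a set)" "\<forall>j\<in>Basis. count_list L j = n" by blast
  obtain bs where bs: "set bs = (Basis :: 'a set)" "distinct bs"
    using finite_distinct_list[OF finite_Basis] by blast
  have "distinct xs \<Longrightarrow> count_list xs j = of_bool (j \<in> set xs)" for xs and j :: 'a
    by (induction xs) auto
  with bs have "count_list bs j = 1" if "j \<in> Basis" for j using that by simp
  then show ?case using L bs(1) by (intro exI[of _ "bs @ L"]) auto
qed

lemma box_norm_diff_le:
  fixes c d :: "'a::euclidean_space"
  assumes "x \<in> box c d" "y \<in> box c d"
  shows "norm (x - y) \<le> (\<Sum>j\<in>Basis. (d - c) \<bullet> j)"
proof -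
  have "norm (x - y) \<le> (\<Sum>j\<in>Basis. \<bar>(x - y) \<bullet> j\<bar>)" by (rule norm_le_l1)
  also have "\<dots> \<le> (\<Sum>j\<in>Basis. (d - c) \<bullet> j)"
  proof (rule sum_mono)
    fix j :: 'a assume "j \<in> Basis"
    then show "\<bar>(x - y) \<bullet> j\<bar> \<le> (d - c) \<bullet> j"
      using assms by (fastforce simp: mem_box inner_diff_left abs_le_iff)
  qed
  finally show ?thesis .
qed

text \<open>Gathering takes one extra unit of time; less than \<open>\<delta> / 2\<close> is lost
  before reaching \<open>V\<close> and less than \<open>\<delta> / 2\<close> afterwards.\<close>

lemma (in steering) steer_into_box:
  assumes \<mu>: "finite_ac \<mu>" and \<Psi>1: "steerable v \<omega> R M T \<Psi>1" "measure \<mu> {x. \<Psi>1 x \<notin> V} < \<delta> / 2"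
    and V: "ball_chain \<omega> B0 V" "open B0" "bounded B0" "closure B0 \<subseteq> \<omega>" "V \<subseteq> D" and "0 < \<delta>"
  shows "\<exists>\<Psi>. steerable v \<omega> R M (T + 1) \<Psi> \<and> measure \<mu> {x. \<Psi> x \<notin> B0} < \<delta>"
proof -
  note \<mu>' = finite_acD[OF \<mu>]
  interpret finite_measure \<mu> by fact
  note push = steerable_push[OF \<mu> \<Psi>1(1)]
  have oV: "open V" using ball_chain_props[OF V(1-4)] by blast
  obtain \<Psi>2 where \<Psi>2: "steerable v \<omega> R M 1 \<Psi>2" "measure (distr \<mu> borel \<Psi>1) {x\<in>V. \<Psi>2 x \<notin> B0} < \<delta> / 2"
    using gather[OF V push(1), of "\<delta> / 2" 1] \<open>0 < \<delta>\<close> by auto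
  have m2: "{x\<in>V. \<Psi>2 x \<notin> B0} \<in> sets borel"
    using steerable_push(4)[OF \<mu> \<Psi>2(1), of "- B0"] oV V(2) by (simp add: Collect_conj_eq)
  have m1: "{x. \<Psi>1 x \<in> - V} \<in> sets borel" by (rule push(4)) (use oV in auto)
  have "{x. \<Psi>2 (\<Psi>1 x) \<notin> B0} \<subseteq> {x. \<Psi>1 x \<in> - V} \<union> {x. \<Psi>1 x \<in> {x\<in>V. \<Psi>2 x \<notin> B0}}" by auto
  then have "measure \<mu> {x. \<Psi>2 (\<Psi>1 x) \<notin> B0} \<le> measure \<mu> ({x. \<Psi>1 x \<in> - V} \<union> {x. \<Psi>1 x \<in> {x\<in>V. \<Psi>2 x \<notin> B0}})"
    using m1 push(4)[OF m2] \<mu>'(2) by (intro finite_measure_mono) auto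
  also have "\<dots> \<le> measure \<mu> {x. \<Psi>1 x \<in> - V} + measure \<mu> {x. \<Psi>1 x \<in> {x\<in>V. \<Psi>2 x \<notin> B0}}"
    using m1 push(4)[OF m2] \<mu>'(2) by (intro measure_Un_le) auto
  also have "\<dots> < \<delta>" using \<Psi>1(2) \<Psi>2(2) push(3)[OF m2] by simp
  finally show ?thesis using steerable_compose[OF \<Psi>2(1) \<Psi>1(1)] by blast
qed

lemma ac_compact_prob_finite_ac:
  assumes "ac_compact_prob \<mu>"
  shows "finite_ac \<mu>" "prob_space \<mu>" "\<exists>r. AE x in \<mu>. norm x \<le> r"
proof -
  have s: "sets \<mu> = sets borel" and p: "prob_space \<mu>" and c: "compact (measure_support \<mu>)"
    and a: "absolutely_continuous lborel \<mu>"
    using assms unfolding ac_compact_prob_def by auto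
  interpret prob_space \<mu> by fact
  show "finite_ac \<mu>" unfolding finite_ac_def using s a finite_measure_axioms by blast
  show "prob_space \<mu>" by fact
  obtain r where r: "\<And>x. x \<in> measure_support \<mu> \<Longrightarrow> norm x \<le> r"
    using compact_imp_bounded[OF c] unfolding bounded_iff by blast
  have "AE x in \<mu>. norm x \<le> r"
    using null_outside_measure_support[OF s] by eventually_elim (rule r)
  then show "\<exists>r. AE x in \<mu>. norm x \<le> r" by blast
qed

text \<open>With \<open>\<zeta>\<close> the steering of \<open>\<mu>1\<close> into the box backward in time, undoing \<open>\<zeta>\<close> turns
  the match of \<open>\<alpha>\<close> and \<open>\<zeta>#\<mu>1\<close> on small cells of the box into one of \<open>\<mu>(T)\<close> and \<open>\<mu>1\<close>
  on their preimages. The cells are chosen after \<open>\<zeta>\<close>, whose inverse is Lipschitz.\<close>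

lemma (in steering) match_in_box:
  assumes \<mu>0: "finite_ac \<mu>0" "prob_space \<mu>0" and \<mu>1: "finite_ac \<mu>1" "prob_space \<mu>1"
    and A: "steerable v \<omega> R M s A" "measure \<mu>0 {x. A x \<notin> box a b} < \<delta>"
    and \<zeta>: "steerable (\<lambda>x. - v x) \<omega> R M t \<zeta>" "measure \<mu>1 {x. \<zeta> x \<notin> box a b} < \<delta>"
    and box: "box a b \<noteq> {}" "box a b \<subseteq> D" and \<delta>: "0 < \<delta>" "\<delta> < 1" and "0 < \<eta>"
  shows "\<exists>\<Theta> F. steerable v \<omega> R M (s + 1 + t) \<Theta> \<and> finite F \<and> (\<forall>E\<in>F. E \<in> sets borel) \<and>
    (\<forall>E\<in>F. \<forall>E'\<in>F. E \<noteq> E' \<longrightarrow> E \<inter> E' = {}) \<and> (\<forall>E\<in>F. \<forall>x\<in>E. \<forall>y\<in>E. norm (x - y) \<le> \<eta>) \<and>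
    (\<forall>E\<in>F. (1 - \<delta>)\<^sup>2 * measure \<mu>1 E \<le> measure (distr \<mu>0 borel \<Theta>) E) \<and>
    1 - \<delta> \<le> (\<Sum>E\<in>F. measure \<mu>1 E)"
proof -
  interpret P0: prob_space \<mu>0 by fact
  interpret P1: prob_space \<mu>1 by fact
  note \<mu>0' = finite_acD[OF \<mu>0(1)] and \<mu>1' = finite_acD[OF \<mu>1(1)]
  \<comment> \<open>Reversing the drift keeps all hypotheses, so the results on steering also apply
    to the backward motion of \<mu>1.\<close>
  interpret S': steering "\<lambda>x. - v x" \<omega> R M D
    using bounded_lipschitz_minus[OF v] M open_\<omega> compact_D D_sub D_ne D_ball by unfold_locales auto
  note pA = steerable_push[OF \<mu>0(1) A(1)] and p\<zeta> = S'.steerable_push[OF \<mu>1(1) \<zeta>(1)]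
  define \<alpha> where "\<alpha> = distr \<mu>0 borel A"
  define \<beta> where "\<beta> = distr \<mu>1 borel \<zeta>"
  define m where "m = measure \<alpha> (box a b)"
  define q where "q = measure \<beta> (box a b)"
  have m_eq: "m = 1 - measure \<mu>0 {x. A x \<notin> box a b}"
  proof -
    have "{x. A x \<notin> box a b} = space \<mu>0 - {x. A x \<in> box a b}" using \<mu>0'(3) by auto
    then show ?thesis using P0.prob_compl[of "{x. A x \<in> box a b}"] pA(3,4)[of "box a b"] \<mu>0'(2)
      by (simp add: m_def \<alpha>_def)
  qed
  have q_eq: "q = 1 - measure \<mu>1 {x. \<zeta> x \<notin> box a b}"
  proof -
    have "{x. \<zeta> x \<notin> box a b} = space \<mu>1 - {x. \<zeta> x \<in> box a b}" using \<mu>1'(3) by auto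
    then show ?thesis using P1.prob_compl[of "{x. \<zeta> x \<in> box a b}"] p\<zeta>(3,4)[of "box a b"] \<mu>1'(2)
      by (simp add: q_def \<beta>_def)
  qed
  have mq: "1 - \<delta> < m" "1 - \<delta> < q" "q \<le> 1" using m_eq q_eq A(2) \<zeta>(2) by auto
  then have pos: "0 < m" "0 < q" using \<delta> by auto
  \<comment> \<open>The targets follow \<beta> up to a \<delta> share of normalized Lebesgue
    measure, which gives every nonempty cell positive mass; the factor \<open>m\<close> adjusts the
    total to the mass actually present in the box.\<close>
  define w where "w E = m * ((1 - \<delta>) * (measure \<beta> E / q) + \<delta> * (measure lborel E / measure lborel (box a b)))" for E
  have lpos: "0 < measure lborel (box c d)" if "box c d \<noteq> {}" for c d :: 'a
    using that by (simp add: box_ne_empty measure_lborel_box_eq inner_diff_left prod_pos less_imp_le)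
  have \<beta>: "finite_ac \<beta>" unfolding \<beta>_def by (rule p\<zeta>(1))
  have "box_additive (measure \<beta>)"
    using finite_acD(1,2)[OF \<beta>] \<beta> unfolding finite_ac_def
    by (intro measure_box_additive) (auto simp: finite_measure.emeasure_finite less_top[symmetric])
  moreover have "box_additive (measure (lborel :: 'a measure))"
    by (rule measure_box_additive) (auto simp: absolutely_continuous_def intro: emeasure_bounded_finite[OF bounded_box, unfolded infinity_ennreal_def])
  ultimately have w: "box_additive w"
    unfolding box_additive_def w_def by (simp add: add_divide_distrib distrib_left)
  have wpos: "0 < w (box c d)" if "box c d \<noteq> {}" for c d
  proof -
    have "0 \<le> (1 - \<delta>) * (measure \<beta> (box c d) / q)" using \<delta> pos by simp
    moreover have "0 < \<delta> * (measure lborel (box c d) / measure lborel (box a b))"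
      using \<delta> lpos[OF that] lpos[OF box(1)] by simp
    ultimately show ?thesis unfolding w_def using pos by (intro mult_pos_pos) auto
  qed
  \<comment> \<open>One factor \<open>1 - \<delta>\<close> is the price of the Lebesgue share, the
    other comes from \<open>m > 1 - \<delta>\<close>; dividing by \<open>q \<le> 1\<close> only
    increases the target.\<close>
  have wge: "(1 - \<delta>)\<^sup>2 * measure \<beta> E \<le> w E" for E
  proof -
    have "measure \<beta> E * q \<le> measure \<beta> E" using mq(3) pos(2) by (intro mult_left_le) auto
    then have "measure \<beta> E \<le> measure \<beta> E / q" using pos(2) by (simp add: pos_le_divide_eq)
    then have "(1 - \<delta>) * measure \<beta> E \<le> (1 - \<delta>) * (measure \<beta> E / q)" using \<delta> by (intro mult_left_mono) auto
    also have "\<dots> \<le> (1 - \<delta>) * (measure \<beta> E / q) + \<delta> * (measure lborel E / measure lborel (box a b))"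
      using \<delta> by simp
    finally have "m * ((1 - \<delta>) * measure \<beta> E) \<le> w E" unfolding w_def using pos by (intro mult_left_mono) auto
    moreover have "(1 - \<delta>) * ((1 - \<delta>) * measure \<beta> E) \<le> m * ((1 - \<delta>) * measure \<beta> E)"
      using mq \<delta> by (intro mult_right_mono) auto
    ultimately show ?thesis by (simp add: power2_eq_square mult.assoc)
  qed
  have "w (box a b) = m" unfolding w_def q_def[symmetric] using pos lpos[OF box(1)] by (simp add: algebra_simps)
  then have tot: "measure \<alpha> (box a b) = w (box a b)" by (simp add: m_def)
  obtain X where X: "steerable v \<omega> R M t X" "\<And>x. X (\<zeta> x) = x" "\<And>x. \<zeta> (X x) = x"
    using steerable_reverse[OF \<zeta>(1)] by blast
  obtain K where K: "K-lipschitz_on UNIV X" using steerable_bilipschitz[OF X(1)] by blast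
  have K0: "0 \<le> K" by (rule lipschitz_on_nonneg[OF K])
  define W where "W = (\<Sum>j\<in>Basis. (b - a) \<bullet> j)"
  \<comment> \<open>\<open>W\<close> bounds the diameter of the box. After \<open>n\<close> cuts in
    every direction the cells have diameter at most \<open>W / 2 ^ n\<close>, and undoing \<zeta>
    enlarges it by a factor of at most \<open>K\<close>.\<close>
  obtain n where n: "K * W / \<eta> < 2 ^ n" using real_arch_pow[of 2 "K * W / \<eta>"] by auto
  then have n': "K * (W / 2 ^ n) \<le> \<eta>" using \<open>0 < \<eta>\<close> by (simp add: field_simps)
  obtain L where L: "set L \<subseteq> (Basis :: 'a set)" "\<forall>j\<in>Basis. count_list L j = n"
    using basis_list_exists by blast
  have \<alpha>: "finite_ac \<alpha>" unfolding \<alpha>_def by (rule pA(1))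
  have "\<forall>c d. box c d \<noteq> {} \<longrightarrow> 0 < w (box c d)" using wpos by simp
  from box_matching[OF w this L(1) \<alpha> box tot zero_less_one]
  obtain \<Psi> F where \<Psi>: "local_steering (box a b) 1 \<Psi>" and F: "finite F"
    "\<forall>C\<in>F. \<exists>c d. C = box c d \<and> C \<noteq> {} \<and> C \<subseteq> box a b \<and>
        (\<forall>j\<in>Basis. (d - c) \<bullet> j = (b - a) \<bullet> j / 2 ^ count_list L j)"
    "\<forall>C\<in>F. \<forall>C'\<in>F. C \<noteq> C' \<longrightarrow> C \<inter> C' = {}"
    "\<forall>\<phi>. box_additive \<phi> \<longrightarrow> (\<Sum>C\<in>F. \<phi> C) = \<phi> (box a b)"
    "\<forall>C\<in>F. measure \<alpha> {x. \<Psi> x \<in> C} = w C"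
    by (elim exE conjE)
  have \<Psi>s: "steerable v \<omega> R M 1 \<Psi>" using \<Psi> unfolding local_steering_def by blast
  define \<Theta> where "\<Theta> x = X (\<Psi> (A x))" for x
  have \<Theta>: "steerable v \<omega> R M (s + 1 + t) \<Theta>"
    unfolding \<Theta>_def by (rule steerable_compose[OF X(1) steerable_compose[OF \<Psi>s A(1)]])
  note p\<Theta> = steerable_push[OF \<mu>0(1) \<Theta>]
  define pre where "pre C = {x. \<zeta> x \<in> C}" for C
  have F_open: "open C" if C: "C \<in> F" for C
  proof -
    from bspec[OF F(2) C] obtain c d where "C = box c d" by (elim exE conjE)
    then show ?thesis by (metis open_box)
  qed
  have pre_borel: "pre C \<in> sets borel" if "C \<in> F" for C
    unfolding pre_def using p\<zeta>(4) F_open[OF that] by simp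
  have \<mu>1pre: "measure \<mu>1 (pre C) = measure \<beta> C" if "C \<in> F" for C
    unfolding pre_def \<beta>_def using p\<zeta>(3)[of C] F_open[OF that] by simp
  have small: "norm (x - y) \<le> \<eta>" if C: "C \<in> F" and xy: "x \<in> pre C" "y \<in> pre C" for C x y
  proof -
    from bspec[OF F(2) C] obtain c d where cd: "C = box c d"
      and sides: "\<forall>j\<in>Basis. (d - c) \<bullet> j = (b - a) \<bullet> j / 2 ^ count_list L j" by (elim exE conjE)
    have "norm (\<zeta> x - \<zeta> y) \<le> (\<Sum>j\<in>Basis. (d - c) \<bullet> j)"
      using xy cd by (intro box_norm_diff_le) (auto simp: pre_def)
    also have "\<dots> = W / 2 ^ n"
      unfolding W_def sum_divide_distrib by (rule sum.cong) (use sides L(2) in auto)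
    finally have "K * norm (\<zeta> x - \<zeta> y) \<le> K * (W / 2 ^ n)" by (rule mult_left_mono[OF _ K0])
    moreover have "norm (X (\<zeta> x) - X (\<zeta> y)) \<le> K * norm (\<zeta> x - \<zeta> y)"
      using lipschitz_onD[OF K, of "\<zeta> x" "\<zeta> y"] by (simp add: dist_norm)
    ultimately show ?thesis using n' X(2) by simp
  qed
  have mass: "(1 - \<delta>)\<^sup>2 * measure \<mu>1 (pre C) \<le> measure (distr \<mu>0 borel \<Theta>) (pre C)" if C: "C \<in> F" for C
  proof -
    have "measure (distr \<mu>0 borel \<Theta>) (pre C) = measure \<mu>0 {x. \<Theta> x \<in> pre C}"
      by (rule p\<Theta>(3)[OF pre_borel[OF C]])
    also have "{x. \<Theta> x \<in> pre C} = {x. A x \<in> {y. \<Psi> y \<in> C}}" by (simp add: pre_def \<Theta>_def X(3))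
    also have "measure \<mu>0 \<dots> = measure \<alpha> {y. \<Psi> y \<in> C}"
      using pA(3)[of "{y. \<Psi> y \<in> C}"] steerable_push(4)[OF \<mu>0(1) \<Psi>s, of C] F_open[OF C] unfolding \<alpha>_def by simp
    also have "\<dots> = w C" using F(5) C by simp
    finally show ?thesis using wge[of C] \<mu>1pre[OF C] by simp
  qed
  have inj: "inj_on pre F"
  proof (rule inj_onI)
    fix C C' assume "pre C = pre C'"
    then have "X x \<in> pre C \<longleftrightarrow> X x \<in> pre C'" for x by simp
    then show "C = C'" unfolding pre_def by (auto simp: X(3))
  qed
  have "(\<Sum>E\<in>pre ` F. measure \<mu>1 E) = (\<Sum>C\<in>F. measure \<beta> C)"
    using \<mu>1pre by (simp add: sum.reindex[OF inj])
  \<comment> \<open>The bisection identity is applied to \<beta>, although the masses were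
    prescribed by \<open>w\<close>.\<close>
  also have "\<dots> = q" using F(4) \<open>box_additive (measure \<beta>)\<close> unfolding q_def by blast
  finally have sum: "1 - \<delta> \<le> (\<Sum>E\<in>pre ` F. measure \<mu>1 E)" using mq by simp
  have disj: "pre C \<inter> pre C' = {}" if "C \<in> F" "C' \<in> F" "pre C \<noteq> pre C'" for C C'
  proof -
    from that(3) have "C \<noteq> C'" by auto
    with bspec[OF bspec[OF F(3) that(1)] that(2)] have "C \<inter> C' = {}" by simp
    then show ?thesis unfolding pre_def by blast
  qed
  show ?thesis
  proof (rule exI[of _ \<Theta>], rule exI[of _ "pre ` F"], intro conjI \<Theta> sum)
    show "finite (pre ` F)" using F(1) by simp
    show "\<forall>E\<in>pre ` F. E \<in> sets borel" using pre_borel by blast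
    show "\<forall>E\<in>pre ` F. \<forall>E'\<in>pre ` F. E \<noteq> E' \<longrightarrow> E \<inter> E' = {}" using disj by (simp add: ball_simps)
    show "\<forall>E\<in>pre ` F. \<forall>x\<in>E. \<forall>y\<in>E. norm (x - y) \<le> \<eta>" using small by (simp add: ball_simps)
    show "\<forall>E\<in>pre ` F. (1 - \<delta>)\<^sup>2 * measure \<mu>1 E \<le> measure (distr \<mu>0 borel \<Theta>) E"
      using mass by (simp add: ball_simps)
  qed
qed

lemma approximate_controllability:
  fixes \<omega> :: "'a::euclidean_space set"
  assumes p: "p \<ge> 1" and \<omega>: "open \<omega>" "connected \<omega>" "\<omega> \<noteq> {}" and v: "bounded_lipschitz v"
    and \<mu>0: "ac_compact_prob \<mu>0" and \<mu>1: "ac_compact_prob \<mu>1"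
    and hit0: "\<forall>x\<in>measure_support \<mu>0. \<exists>t>0. flow v t x \<in> \<omega>"
    and hit1: "\<forall>x\<in>measure_support \<mu>1. \<exists>t>0. flow v (- t) x \<in> \<omega>"
  shows "\<exists>T>0. approximately_controllable p v \<omega> \<mu>0 \<mu>1 T"
proof -
  obtain M where M: "M > 0" "\<And>x. norm (v x) \<le> M" using bounded_lipschitzE[OF v] by metis
  have M': "norm (- v x) \<le> M" for x using M(2)[of x] by simp
  note v' = bounded_lipschitz_minus[OF v]
  have hit1': "\<forall>x\<in>measure_support \<mu>1. \<exists>t>0. flow (\<lambda>x. - v x) t x \<in> \<omega>"
    using hit1 by (simp add: flow_minus[OF v])
  obtain T0 C0 where T0: "T0 > 0" and C0: "compact C0" "C0 \<subseteq> \<omega>" and steer0: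
    "\<forall>N R M \<delta>. open N \<longrightarrow> C0 \<subseteq> N \<longrightarrow> (\<forall>x. norm (v x) \<le> M) \<longrightarrow> 0 < \<delta> \<longrightarrow>
       (\<exists>\<Psi>. steerable v \<omega> R M T0 \<Psi> \<and> measure \<mu>0 {x. \<Psi> x \<notin> N} < \<delta>)"
    using steer_support_into[OF v \<omega>(1) \<mu>0 hit0] by (elim exE conjE)
  obtain T1 C1 where T1: "T1 > 0" and C1: "compact C1" "C1 \<subseteq> \<omega>" and steer1:
    "\<forall>N R M \<delta>. open N \<longrightarrow> C1 \<subseteq> N \<longrightarrow> (\<forall>x. norm (- v x) \<le> M) \<longrightarrow> 0 < \<delta> \<longrightarrow>
       (\<exists>\<Psi>. steerable (\<lambda>x. - v x) \<omega> R M T1 \<Psi> \<and> measure \<mu>1 {x. \<Psi> x \<notin> N} < \<delta>)"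
    using steer_support_into[OF v' \<omega>(1) \<mu>1 hit1'] by (elim exE conjE)
  obtain z where "z \<in> \<omega>" using \<omega>(3) by blast
  then obtain a b where ab: "cbox a b \<subseteq> \<omega>" "z \<in> box a b"
    using open_contains_cbox[OF \<omega>(1)] by metis
  then have ne: "box a b \<noteq> {}" by blast
  have cl: "closure (box a b) \<subseteq> \<omega>" using ab(1) closure_box[OF ne] by simp
  have "compact (C0 \<union> C1)" "C0 \<union> C1 \<subseteq> \<omega>" using C0 C1 by auto
  from ball_chain_covers[OF \<omega>(1,2) open_box bounded_box cl ne this]
  obtain V where V: "ball_chain \<omega> (box a b) V" "C0 \<union> C1 \<subseteq> V" by (elim exE conjE)
  have Vp: "open V" "bounded V" "closure V \<subseteq> \<omega>" "box a b \<subseteq> V"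
    using ball_chain_props[OF V(1) open_box bounded_box cl] by auto
  \<comment> \<open>The closure of the chain is compact in \<omega> and hosts both motions:
    gathering takes place in \<open>V\<close> and bisection in the box.\<close>
  define D where "D = closure V"
  have D: "compact D" "D \<subseteq> \<omega>" "V \<subseteq> D" "D \<noteq> {}"
    using Vp ne closure_subset[of V] unfolding D_def by (auto simp: compact_closure)
  obtain R where R: "D \<subseteq> ball 0 R"
    using bounded_subset_ballD[OF compact_imp_bounded[OF D(1)]] by blast
  interpret S: steering v \<omega> R M D
    by unfold_locales (use v M(2) \<omega>(1) D R in auto)
  interpret S': steering "\<lambda>x. - v x" \<omega> R M D
    by unfold_locales (use v' M' \<omega>(1) D R in auto)
  \<comment> \<open>Braking and gathering take \<open>T0 + 1\<close>, bisection takes 1, and undoing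
    the backward braking and gathering takes \<open>T1 + 1\<close>.\<close>
  define T where "T = (T0 + 1) + 1 + (T1 + 1)"
  have "T > 0" using T0 T1 by (simp add: T_def)
  note f0 = ac_compact_prob_finite_ac[OF \<mu>0] and f1 = ac_compact_prob_finite_ac[OF \<mu>1]
  obtain r0 where r0: "AE x in \<mu>0. norm x \<le> r0" using f0(3) by blast
  obtain r1 where r1: "AE x in \<mu>1. norm x \<le> r1" using f1(3) by blast
  \<comment> \<open>Radius of a ball that carries \<mu>1 and the final measure of every steering
    chosen below; it depends on \<open>T\<close> but not on \<epsilon>.\<close>
  define S where "S = max R (max 0 r0) + M * T + max 0 r1"
  have S: "0 \<le> S" "r1 \<le> S" "max R r0 + M * T \<le> S"
    using M(1) \<open>T > 0\<close> unfolding S_def by (auto simp: max_def add_increasing add_increasing2)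
  have "approximately_controllable p v \<omega> \<mu>0 \<mu>1 T"
    unfolding approximately_controllable_def
  proof (intro allI impI)
    fix \<epsilon> :: real assume "\<epsilon> > 0"
    define Q where "Q = (2 * S) powr p"
    have Q: "0 \<le> Q" by (simp add: Q_def)
    \<comment> \<open>Each of the two error terms gets half of \<open>\<epsilon> powr p\<close>; the
      \<open>Q + 1\<close> in \<kappa> makes the denominator positive knowing only
      \<open>0 \<le> Q\<close>.\<close>
    define \<eta> where "\<eta> = (1 / 2) powr (1 / p) * \<epsilon>"
    define \<kappa> where "\<kappa> = min 1 (\<epsilon> powr p / (2 * (Q + 1)))"
    have \<eta>: "0 < \<eta>" "\<eta> powr p = \<epsilon> powr p / 2"
      using \<open>\<epsilon> > 0\<close> p by (auto simp: \<eta>_def powr_mult powr_powr)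
    have \<kappa>: "0 < \<kappa>" "\<kappa> \<le> 1" using \<open>\<epsilon> > 0\<close> Q by (auto simp: \<kappa>_def)
    have \<kappa>Q: "\<kappa> * Q \<le> \<epsilon> powr p / 2"
    proof -
      have "\<kappa> * Q \<le> \<epsilon> powr p / (2 * (Q + 1)) * (Q + 1)"
        using \<kappa> Q by (intro mult_mono) (auto simp: \<kappa>_def)
      also have "\<dots> = \<epsilon> powr p / 2"
      proof -
        have *: "x / (2 * y) * y = x / 2" if "y \<noteq> 0" for x y :: real using that by simp
        show ?thesis by (rule *) (use Q in simp)
      qed
      finally show ?thesis .
    qed
    \<comment> \<open>This gives
      \<open>(1 - \<delta>) ^ 3 \<ge> 1 - 3 * \<delta> \<ge> 1 - \<kappa>\<close>: two factors come
      from the masses of the cells and one from the part of \<mu>1 that reaches the box.\<close>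
    define \<delta> where "\<delta> = \<kappa> / 4"
    have \<delta>: "0 < \<delta>" "\<delta> < 1" "0 < \<delta> / 2" using \<kappa> by (auto simp: \<delta>_def)
    have "C0 \<subseteq> V" "C1 \<subseteq> V" using V(2) by auto
    obtain \<Psi>0 where \<Psi>0: "steerable v \<omega> R M T0 \<Psi>0" "measure \<mu>0 {x. \<Psi>0 x \<notin> V} < \<delta> / 2"
      using steer0 Vp(1) \<open>C0 \<subseteq> V\<close> M(2) \<delta>(3) by blast
    obtain \<Psi>1 where \<Psi>1: "steerable (\<lambda>x. - v x) \<omega> R M T1 \<Psi>1" "measure \<mu>1 {x. \<Psi>1 x \<notin> V} < \<delta> / 2"
      using steer1 Vp(1) \<open>C1 \<subseteq> V\<close> M' \<delta>(3) by blast
    obtain A where A: "steerable v \<omega> R M (T0 + 1) A" "measure \<mu>0 {x. A x \<notin> box a b} < \<delta>"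
      using S.steer_into_box[OF f0(1) \<Psi>0 V(1) open_box bounded_box cl D(3) \<delta>(1)] by blast
    obtain \<zeta> where \<zeta>: "steerable (\<lambda>x. - v x) \<omega> R M (T1 + 1) \<zeta>" "measure \<mu>1 {x. \<zeta> x \<notin> box a b} < \<delta>"
      using S'.steer_into_box[OF f1(1) \<Psi>1 V(1) open_box bounded_box cl D(3) \<delta>(1)] by blast
    have bD: "box a b \<subseteq> D" using Vp(4) D(3) by blast
    from S.match_in_box[OF f0(1,2) f1(1,2) A \<zeta> ne bD \<delta>(1,2) \<eta>(1)]
    obtain \<Theta> F where \<Theta>: "steerable v \<omega> R M T \<Theta>" and F: "finite F" "\<forall>E\<in>F. E \<in> sets borel"
      "\<forall>E\<in>F. \<forall>E'\<in>F. E \<noteq> E' \<longrightarrow> E \<inter> E' = {}" "\<forall>E\<in>F. \<forall>x\<in>E. \<forall>y\<in>E. norm (x - y) \<le> \<eta>"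
      "\<forall>E\<in>F. (1 - \<delta>)\<^sup>2 * measure \<mu>1 E \<le> measure (distr \<mu>0 borel \<Theta>) E"
      "1 - \<delta> \<le> (\<Sum>E\<in>F. measure \<mu>1 E)"
      unfolding T_def by (elim exE conjE)
    note push = S.steerable_push[OF f0(1) \<Theta>]
    have \<Theta>m: "\<Theta> \<in> measurable \<mu>0 borel" using push(2) finite_acD(2)[OF f0(1)] by (simp cong: measurable_cong_sets)
    have "AE x in \<mu>0. norm (\<Theta> x) \<le> S"
      using r0
    proof eventually_elim
      fix x :: 'a assume "norm x \<le> r0"
      then have "max R (norm x) \<le> max R r0" by simp
      then show "norm (\<Theta> x) \<le> S" using steerable_norm[OF \<Theta> less_imp_le[OF M(1)], of x] S(3) by linarith
    qed
    then have S0: "AE x in distr \<mu>0 borel \<Theta>. norm x \<le> S"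
      by (subst AE_distr_iff[OF \<Theta>m]) auto
    have S1: "AE x in \<mu>1. norm x \<le> S" using r1 by eventually_elim (use S(2) in linarith)
    have \<delta>2: "(1 - \<delta>)\<^sup>2 \<le> 1" using \<delta> by (simp add: power_le_one)
    have "1 - \<kappa> \<le> (1 - \<delta>)\<^sup>2 * (1 - \<delta>)"
    proof -
      have "(1 - \<delta>)\<^sup>2 * (1 - \<delta>) = 1 - 3 * \<delta> + \<delta>\<^sup>2 * (3 - \<delta>)" by (simp add: power2_eq_square algebra_simps)
      moreover have "0 \<le> \<delta>\<^sup>2 * (3 - \<delta>)" using \<delta> by (intro mult_nonneg_nonneg) auto
      ultimately show ?thesis using \<delta>(1) by (simp add: \<delta>_def)
    qed
    also have "\<dots> \<le> (1 - \<delta>)\<^sup>2 * (\<Sum>E\<in>F. measure \<mu>1 E)" using F(6) by (intro mult_left_mono) auto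
    also have "\<dots> = (\<Sum>E\<in>F. (1 - \<delta>)\<^sup>2 * measure \<mu>1 E)" by (rule sum_distrib_left)
    finally have sum: "1 - \<kappa> \<le> (\<Sum>E\<in>F. (1 - \<delta>)\<^sup>2 * measure \<mu>1 E)" .
    have "wasserstein p (distr \<mu>0 borel \<Theta>) \<mu>1 \<le> ennreal ((\<eta> powr p + \<kappa> * (2 * S) powr p) powr (1 / p))"
    proof (rule wasserstein_le[OF p push(1) _ f1(1,2) S0 S1 S(1) F(1)])
      show "prob_space (distr \<mu>0 borel \<Theta>)" by (rule prob_space.prob_space_distr[OF f0(2) \<Theta>m])
      show "(1 - \<delta>)\<^sup>2 * measure \<mu>1 E \<le> measure \<mu>1 E" for E
        using \<delta>2 by (simp add: mult_left_le_one_le)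
      show "1 - \<kappa> \<le> (\<Sum>E\<in>F. (1 - \<delta>)\<^sup>2 * measure \<mu>1 E)" by (rule sum)
    qed (use F \<eta> in auto)
    also have "\<dots> \<le> ennreal \<epsilon>"
    proof (rule ennreal_leI)
      have "\<eta> powr p + \<kappa> * (2 * S) powr p \<le> \<epsilon> powr p"
        using \<kappa>Q \<eta>(2) unfolding Q_def by linarith
      then have "(\<eta> powr p + \<kappa> * (2 * S) powr p) powr (1 / p) \<le> (\<epsilon> powr p) powr (1 / p)"
        using p \<kappa> by (intro powr_mono2) auto
      then show "(\<eta> powr p + \<kappa> * (2 * S) powr p) powr (1 / p) \<le> \<epsilon>"
        using p \<open>\<epsilon> > 0\<close> by (simp add: powr_powr)
    qed
    finally have le: "wasserstein p (distr \<mu>0 borel \<Theta>) \<mu>1 \<le> ennreal \<epsilon>" .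
    obtain f where f: "f \<in> admissible_controls \<omega>" "\<forall>\<mu>. solution_measure v f \<mu> T = distr \<mu> borel \<Theta>"
      using steerable_solution_measure[OF \<Theta> v] by blast
    show "\<exists>f\<in>admissible_controls \<omega>. wasserstein p (solution_measure v f \<mu>0 T) \<mu>1 \<le> ennreal \<epsilon>"
      using f le by (intro bexI[of _ f]) auto
  qed
  then show ?thesis using \<open>T > 0\<close> by blast
qed

theorem theorem1:
  fixes \<omega> :: "(real ^ 'd) set"
    and v :: "real ^ 'd \<Rightarrow> real ^ 'd"
    and \<mu>0 \<mu>1 :: "(real ^ 'd) measure"
    and p :: real
  assumes "p \<ge> 1"
    and "open \<omega>" and "connected \<omega>" and "\<omega> \<noteq> {}"
    and "\<exists>L. L-lipschitz_on UNIV v" and "bounded (range v)"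
    and "ac_compact_prob \<mu>0" and "ac_compact_prob \<mu>1"
    and "\<forall>x0 \<in> measure_support \<mu>0. \<exists>t0>0. flow v t0 x0 \<in> \<omega>"
    and "\<forall>x1 \<in> measure_support \<mu>1. \<exists>t1>0. flow v (- t1) x1 \<in> \<omega>"
  shows "\<exists>T>0. approximately_controllable p v \<omega> \<mu>0 \<mu>1 T"
  using assms by (intro approximate_controllability) (auto simp: bounded_lipschitz_def)

end
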